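(* Let $D\subset\mathbb{C}$ be a bounded domain whose boundary $bD$ consists of finitely many pairwise disjoint simple closed curves, and let $f\colon bD\to\mathbb{C}$ be continuous. Then $f$ extends meromorphically through $D$ if and only if there is $N\in\mathbb{N}\cup\{0\}$ such that $$\mathcal{W}(Pf+Q)\ge -N$$ for all $P,Q\in A(D)$ such that $Pf+Q\neq 0$ everywhere on $bD$. Moreover, if this holds for some $N$, then the meromorphic extension of $f$ has at most $N$ poles in $D$, counting multiplicity.
   Context: $A(D)$ is the algebra of continuous functions on $\overline D$ that are holomorphic on $D$. For a continuous function $\varphi\colon bD\to\mathbb{C}\setminus\{0\}$, $\mathcal{W}(\varphi)$ denotes its winding number around $0$ along $bD$, i.e. $2\pi\mathcal{W}(\varphi)$ is the total change of argument of $\varphi(z)$ as $z$ runs over all boundary curves of $D$ with the standard (positive with respect to $D$) orientation. A continuous $f$ on $bD$ extends meromorphically through $D$ if there are $h\in A(D)$ and a nonzero polynomial $Q$ with all zeros in $D$ such that $f=h/Q$ on $bD$, i.e. $f$ is the boundary value of a function $\tilde f=h/Q$ meromorphic on $D$ with finitely many poles, continuous up to $bD$; the number of poles of the extension, counting multiplicity, is the total multiplicity of the poles of $\tilde f$ in $D$. *)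

theory Defs
  imports "HOL-Analysis.Analysis" "HOL-Computational_Algebra.Polynomial"
begin

definition disc_alg :: "complex set \<Rightarrow> (complex \<Rightarrow> complex) set" where
  "disc_alg D = {h. continuous_on (closure D) h \<and> h holomorphic_on D}"

definition arg_change :: "(real \<Rightarrow> complex) \<Rightarrow> real" where
  "arg_change g = (SOME n. \<exists>\<theta>. continuous_on {0..1} \<theta> \<and>
       (\<forall>t\<in>{0..1}. g t = of_real (norm (g t)) * exp (\<i> * of_real (\<theta> t))) \<and>
       n = (\<theta> 1 - \<theta> 0) / (2 * pi))"

definition bdry_winding :: "nat \<Rightarrow> (nat \<Rightarrow> real \<Rightarrow> complex) \<Rightarrow> (complex \<Rightarrow> complex) \<Rightarrow> real" where
  "bdry_winding m \<gamma> \<phi> = (\<Sum>j<m. arg_change (\<phi> \<circ> \<gamma> j))"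

definition pole_order :: "(complex \<Rightarrow> complex) \<Rightarrow> complex \<Rightarrow> nat" where
  "pole_order g a = (LEAST k. \<exists>e>0. bounded ((\<lambda>z. (z - a) ^ k * g z) ` (ball a e - {a})))"

definition mero_rep :: "complex set \<Rightarrow> (complex \<Rightarrow> complex) \<Rightarrow> (complex \<Rightarrow> complex) \<Rightarrow> complex poly \<Rightarrow> bool" where
  "mero_rep D f h Q \<longleftrightarrow> h \<in> disc_alg D \<and> Q \<noteq> 0 \<and> (\<forall>z. poly Q z = 0 \<longrightarrow> z \<in> D) \<and>
     (\<forall>z\<in>frontier D. f z = h z / poly Q z)"

definition extends_mero :: "complex set \<Rightarrow> (complex \<Rightarrow> complex) \<Rightarrow> bool" where
  "extends_mero D f \<longleftrightarrow> (\<exists>h Q. mero_rep D f h Q)"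

definition num_poles :: "complex set \<Rightarrow> (complex \<Rightarrow> complex) \<Rightarrow> complex poly \<Rightarrow> nat" where
  "num_poles D h Q = (\<Sum>a\<in>{a\<in>D. poly Q a = 0}. pole_order (\<lambda>z. h z / poly Q z) a)"

definition winding_bound :: "complex set \<Rightarrow> nat \<Rightarrow> (nat \<Rightarrow> real \<Rightarrow> complex) \<Rightarrow> (complex \<Rightarrow> complex) \<Rightarrow> nat \<Rightarrow> bool" where
  "winding_bound D m \<gamma> f N \<longleftrightarrow> (\<forall>P Q. P \<in> disc_alg D \<longrightarrow> Q \<in> disc_alg D \<longrightarrow>
      (\<forall>z\<in>frontier D. P z * f z + Q z \<noteq> 0) \<longrightarrow>
      bdry_winding m \<gamma> (\<lambda>z. P z * f z + Q z) \<ge> - real N)"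

end

theory Submission
  imports Defs "HOL-Complex_Analysis.Complex_Analysis" "HOL-Computational_Algebra.Fundamental_Theorem_Algebra"
begin

text \<open>
  If \<open>f = h / Q\<close>, the argument principle for \<open>P * h + T * Q\<close> gives \<open>W(P * f + T) \<ge> - degree Q\<close>, and a
  Bezout identity \<open>P * h + T * Q = 1\<close> shows that this bound is attained when \<open>h\<close> and \<open>Q\<close> have no
  common zero.

  Conversely, choose \<open>g = P * f + Q\<close> of least winding number. Then \<open>F = 1 / g\<close> and \<open>F = f / g\<close> satisfy
  \<open>W(P * F + Q) \<ge> 0\<close> whenever this is defined, and it suffices to extend such \<open>F\<close> to \<open>A(D)\<close>. The real parts of
  \<open>A(D)\<close> are, up to uniform closure, of finite codimension in the continuous functions on \<open>bD\<close>, so there is a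
  polynomial \<open>p \<noteq> 0\<close> such that \<open>p * F\<close> and \<open>z * p * F\<close> are boundary values of harmonic functions that
  are uniform limits of \<open>\<alpha> + cnj \<beta>\<close> with \<open>\<alpha>\<close>, \<open>\<beta>\<close> in \<open>A(D)\<close>. If \<open>q\<close> in \<open>A(D)\<close> vanishes at \<open>w\<close>, then so does the
  extension of \<open>q * F\<close>, as otherwise dividing by \<open>z - w\<close> would produce winding number \<open>-1\<close>. For
  \<open>q = (z - w) * p\<close> this makes multiplication by \<open>z\<close> commute with the extension of \<open>p * F\<close>, which
  therefore is holomorphic. The same winding argument cancels the zeros of \<open>p\<close> in \<open>D\<close> and bounds the
  quotient by \<open>max \<bar>F\<bar>\<close>. Finally a maximum principle, used with log-moduli that approximate the real
  parts of rotations of \<open>F\<close>, gives continuity of the quotient up to the boundary.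
\<close>

section \<open>Change of argument along a path\<close>

text \<open>The boundary curves are merely continuous, so nothing can be integrated over
  \<open>frontier D\<close>. Winding numbers are therefore handled through continuous logarithms,
  and harmonic extensions through uniform limits built from \<open>disc_alg D\<close>, to which the
  maximum principle for holomorphic functions applies.

  Minimality enters as follows: if g = P0 * f + Q0 has least winding and F is 1 / g or f / g, then
  (P * F + Q) * g is again of the form P' * f + Q', so the winding of P * F + Q is a difference that
  cannot be negative. Afterwards f is the quotient of the two extensions, with poles only at zeros
  of the extension of 1 / g.

  The obstruction to a single-valued harmonic conjugate is one real period per hole; this is the
  finite codimension. A polynomial with more coefficients than periods can be chosen to make all of
  them vanish. What remains is the density of real parts and logarithms in the continuous functions,
  which is reached by averaging logarithms with centres off the frontier until Gaussians are
  obtained.\<close>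

lemma exp_eq_norm_mult_exp: "exp z = of_real (norm (exp z)) * exp (\<i> * of_real (Im z))"
  using exp_eq_polar[of z] by (metis cis_conv_exp norm_exp_eq_Re)

text \<open>\<open>arg_change\<close> selects a value by choice, so all lifts must give the same
  one: two continuous arguments differ by 2 * pi times a continuous integer-valued function, which
  is constant on the interval.\<close>

lemma arg_change_eqI:
  assumes q: "continuous_on {0..1} q" and g: "\<And>t. t \<in> {0..1} \<Longrightarrow> g t = exp (q t)"
  shows "arg_change g = (Im (q 1) - Im (q 0)) / (2 * pi)"
proof -
  let ?P = "\<lambda>n. \<exists>\<theta>. continuous_on {0..1} \<theta> \<and>
       (\<forall>t\<in>{0..1}. g t = of_real (norm (g t)) * exp (\<i> * of_real (\<theta> t))) \<and>
       n = (\<theta> 1 - \<theta> 0) / (2 * pi)"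
  have "?P ((Im (q 1) - Im (q 0)) / (2 * pi))"
  proof (intro exI[of _ "\<lambda>t. Im (q t)"] conjI ballI)
    show "continuous_on {0..1} (\<lambda>t. Im (q t))"
      by (intro continuous_intros q)
    show "g t = of_real (norm (g t)) * exp (\<i> * of_real (Im (q t)))" if "t \<in> {0..1}" for t
      using g[OF that] exp_eq_norm_mult_exp[of "q t"] by metis
  qed simp
  moreover have "n = (Im (q 1) - Im (q 0)) / (2 * pi)" if "?P n" for n
  proof -
    obtain \<theta> where \<theta>: "continuous_on {0..1} \<theta>" "n = (\<theta> 1 - \<theta> 0) / (2 * pi)"
      "\<And>t. t \<in> {0..1} \<Longrightarrow> g t = of_real (norm (g t)) * exp (\<i> * of_real (\<theta> t))"
      using \<open>?P n\<close> by blast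
    define d where "d = (\<lambda>t. (\<theta> t - Im (q t)) / (2 * pi))"
    have dint: "d t \<in> \<int>" if t: "t \<in> {0..1}" for t
    proof -
      have "exp (\<i> * of_real (\<theta> t)) = exp (\<i> * of_real (Im (q t)))"
        using \<theta>(3)[OF t] g[OF t] exp_eq_norm_mult_exp[of "q t"]
        by (metis exp_not_eq_zero mult_cancel_left norm_eq_zero of_real_eq_0_iff)
      then obtain k :: int where "\<i> * of_real (\<theta> t) = \<i> * of_real (Im (q t)) + of_real (of_int (2 * k) * pi) * \<i>"
        by (auto simp: exp_eq)
      then have "Im (\<i> * of_real (\<theta> t)) = Im (\<i> * of_real (Im (q t)) + of_real (of_int (2 * k) * pi) * \<i>)"
        by simp
      then have "d t = of_int k"
        by (simp add: d_def field_simps)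
      then show ?thesis by simp
    qed
    have "d constant_on {0..1}"
    proof (rule continuous_discrete_range_constant)
      show "continuous_on {0..1} d"
        unfolding d_def by (intro continuous_intros \<theta> q) auto
      show "\<exists>e>0. \<forall>y. y \<in> {0..1} \<and> d y \<noteq> d x \<longrightarrow> e \<le> norm (d y - d x)"
        if "x \<in> {0..1}" for x
      proof (intro exI[of _ 1] conjI allI impI)
        fix y assume y: "y \<in> {0..1} \<and> d y \<noteq> d x"
        then have "d y - d x \<in> \<int>" "d y - d x \<noteq> 0"
          using dint that by auto
        then show "1 \<le> norm (d y - d x)"
          using Ints_nonzero_abs_ge1[of "d y - d x"] by simp
      qed simp
    qed auto
    then have "d 1 = d 0"
      by (auto simp: constant_on_def)
    then show ?thesis
      using \<theta>(2) by (simp add: d_def field_simps)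
  qed
  ultimately show ?thesis
    unfolding arg_change_def by (rule some_equality)
qed

lemma exists_path_log:
  fixes g :: "real \<Rightarrow> complex"
  assumes "continuous_on {0..1} g" "\<And>t. t \<in> {0..1} \<Longrightarrow> g t \<noteq> 0"
  obtains q where "continuous_on {0..1} q" "\<And>t. t \<in> {0..1} \<Longrightarrow> g t = exp (q t)"
  using continuous_logarithm_on_contractible[OF assms(1) convex_imp_contractible assms(2)]
  by auto

lemma arg_change_cong:
  "(\<And>t. t \<in> {0..1} \<Longrightarrow> g t = h t) \<Longrightarrow> arg_change g = arg_change h"
  unfolding arg_change_def by simp

lemma arg_change_mult:
  assumes "continuous_on {0..1} g" "\<And>t. t \<in> {0..1} \<Longrightarrow> g t \<noteq> 0"
      and "continuous_on {0..1} h" "\<And>t. t \<in> {0..1} \<Longrightarrow> h t \<noteq> 0"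
  shows "arg_change (\<lambda>t. g t * h t) = arg_change g + arg_change h"
proof -
  obtain q where q: "continuous_on {0..1} q" "\<And>t. t \<in> {0..1} \<Longrightarrow> g t = exp (q t)"
    using exists_path_log assms(1,2) by blast
  obtain r where r: "continuous_on {0..1} r" "\<And>t. t \<in> {0..1} \<Longrightarrow> h t = exp (r t)"
    using exists_path_log assms(3,4) by blast
  have "arg_change (\<lambda>t. g t * h t) = (Im (q 1 + r 1) - Im (q 0 + r 0)) / (2 * pi)"
    by (rule arg_change_eqI) (auto intro!: continuous_intros q r simp: q r exp_add)
  then show ?thesis
    using arg_change_eqI[OF q] arg_change_eqI[OF r] by (simp add: diff_divide_distrib add_divide_distrib)
qed

lemma arg_change_inverse:
  assumes "continuous_on {0..1} g" "\<And>t. t \<in> {0..1} \<Longrightarrow> g t \<noteq> 0"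
  shows "arg_change (\<lambda>t. inverse (g t)) = - arg_change g"
proof -
  obtain q where q: "continuous_on {0..1} q" "\<And>t. t \<in> {0..1} \<Longrightarrow> g t = exp (q t)"
    using exists_path_log assms(1,2) by blast
  have "arg_change (\<lambda>t. inverse (g t)) = (Im (- q 1) - Im (- q 0)) / (2 * pi)"
    by (rule arg_change_eqI) (auto intro!: continuous_intros q simp: q exp_minus)
  then show ?thesis
    using arg_change_eqI[OF q] by (simp add: diff_divide_distrib)
qed

lemma arg_change_power:
  assumes "continuous_on {0..1} g" "\<And>t. t \<in> {0..1} \<Longrightarrow> g t \<noteq> 0"
  shows "arg_change (\<lambda>t. g t ^ n) = n * arg_change g"
proof -
  obtain q where q: "continuous_on {0..1} q" "\<And>t. t \<in> {0..1} \<Longrightarrow> g t = exp (q t)"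
    using exists_path_log assms(1,2) by blast
  have "arg_change (\<lambda>t. g t ^ n) = (Im (n * q 1) - Im (n * q 0)) / (2 * pi)"
    by (rule arg_change_eqI[where q="\<lambda>t. of_nat n * q t"]) (auto intro!: continuous_intros q simp: q exp_of_nat_mult)
  then show ?thesis
    using arg_change_eqI[OF q] by (simp add: right_diff_distrib)
qed

lemma arg_change_powi:
  assumes "continuous_on {0..1} g" "\<And>t. t \<in> {0..1} \<Longrightarrow> g t \<noteq> 0"
  shows "arg_change (\<lambda>t. g t powi n) = n * arg_change g"
proof (cases "n \<ge> 0")
  case True
  then show ?thesis
    using arg_change_power[OF assms, of "nat n"] by (simp add: power_int_def)
next
  case False
  have "arg_change (\<lambda>t. inverse (g t ^ nat (-n))) = - arg_change (\<lambda>t. g t ^ nat (-n))"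
    by (rule arg_change_inverse) (auto intro!: continuous_intros assms simp: assms)
  then show ?thesis
    using False arg_change_power[OF assms, of "nat (-n)"] by (simp add: power_int_def power_inverse)
qed

lemma arg_change_Re_pos:
  assumes "continuous_on {0..1} g" "\<And>t. t \<in> {0..1} \<Longrightarrow> Re (g t) > 0" "g 0 = g 1"
  shows "arg_change g = 0"
proof -
  have "arg_change g = (Im (Ln (g 1)) - Im (Ln (g 0))) / (2 * pi)"
  proof (rule arg_change_eqI[where q="\<lambda>t. Ln (g t)"])
    show "continuous_on {0..1} (\<lambda>t. Ln (g t))"
      using assms(2) by (intro continuous_intros assms(1)) (force simp: complex_nonpos_Reals_iff)
    show "g t = exp (Ln (g t))" if "t \<in> {0..1}" for t
      using assms(2)[OF that] by (subst exp_Ln) auto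
  qed
  then show ?thesis using assms(3) by simp
qed

lemma arg_change_const: "c \<noteq> 0 \<Longrightarrow> arg_change (\<lambda>t. c) = 0"
  using arg_change_eqI[of "\<lambda>t. Ln c" "\<lambda>t. c"] by simp

lemma arg_change_Ints:
  assumes "continuous_on {0..1} g" "\<And>t. t \<in> {0..1} \<Longrightarrow> g t \<noteq> 0" "g 0 = g 1"
  shows "arg_change g \<in> \<int>"
proof -
  obtain q where q: "continuous_on {0..1} q" "\<And>t. t \<in> {0..1} \<Longrightarrow> g t = exp (q t)"
    using exists_path_log assms(1,2) by blast
  have "exp (q 1) = exp (q 0)"
    using q(2) assms(3) by (metis atLeastAtMost_iff order_refl zero_le_one)
  then obtain k :: int where "q 1 = q 0 + of_int (2 * k) * of_real pi * \<i>"
    by (auto simp: exp_eq)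
  then have "arg_change g = of_int k"
    using arg_change_eqI[OF q] by simp
  then show ?thesis by simp
qed

lemma arg_change_winding_number:
  assumes "path p" "pathfinish p = pathstart p" "c \<notin> path_image p"
  shows "of_real (arg_change (\<lambda>t. p t - c)) = winding_number p c"
proof -
  obtain q where q: "path q" "pathfinish q - pathstart q = 2 * of_real pi * \<i> * winding_number p c"
                  "\<And>t. t \<in> {0..1} \<Longrightarrow> p t = c + exp (q t)"
    using winding_number_as_continuous_log[OF assms(1,3)] by blast
  have "arg_change (\<lambda>t. p t - c) = (Im (q 1) - Im (q 0)) / (2 * pi)"
    using q by (intro arg_change_eqI) (auto simp: path_def)
  also have "\<dots> = Im (pathfinish q - pathstart q) / (2 * pi)"
    by (simp add: pathfinish_def pathstart_def)
  also have "\<dots> = Re (winding_number p c)"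
    by (simp add: q(2))
  finally show ?thesis
    using integer_winding_number[OF assms(1,2,3)]
    by (simp add: complex_eq_iff complex_is_Int_iff)
qed

text \<open>With zero change of argument the logarithm along the path agrees at both ends, and this
  is the only identification that a simple closed path makes; hence it descends to the
  curve.\<close>

lemma loop_log_factors:
  fixes p :: "real \<Rightarrow> complex" and g :: "complex \<Rightarrow> complex"
  assumes p: "simple_path p" "pathfinish p = pathstart p"
      and g: "continuous_on (path_image p) g" "\<And>z. z \<in> path_image p \<Longrightarrow> g z \<noteq> 0"
      and arg: "arg_change (g \<circ> p) = 0"
  obtains w where "continuous_on (path_image p) w" "\<And>z. z \<in> path_image p \<Longrightarrow> g z = exp (w z)"
proof -
  have contp: "continuous_on {0..1} p"
    using p(1) by (simp add: simple_path_def path_def)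
  obtain q where q: "continuous_on {0..1} q" "\<And>t. t \<in> {0..1} \<Longrightarrow> g (p t) = exp (q t)"
    using exists_path_log[of "\<lambda>t. g (p t)"] continuous_on_compose2[OF g(1) contp] g(2)
    by (auto simp: path_image_def)
  have "(Im (q 1) - Im (q 0)) / (2 * pi) = 0"
    using arg_change_eqI[OF q] arg by (simp add: o_def)
  moreover have "exp (q 1) = exp (q 0)"
    using q(2)[of 0] q(2)[of 1] p(2) by (simp add: pathfinish_def pathstart_def)
  then have "Re (q 1) = Re (q 0)"
    by (metis norm_exp_eq_Re exp_inj_iff)
  ultimately have q01: "q 1 = q 0"
    by (simp add: complex_eq_iff)
  have wd: "q s = q t" if "s \<in> {0..1}" "t \<in> {0..1}" "p s = p t" for s t
  proof -
    have "s = t \<or> s = 0 \<and> t = 1 \<or> s = 1 \<and> t = 0"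
      using that p(1) unfolding simple_path_def loop_free_def by blast
    then show ?thesis using q01 by auto
  qed
  define w where "w = (\<lambda>z. q (SOME t. t \<in> {0..1} \<and> p t = z))"
  have w: "w (p t) = q t" if "t \<in> {0..1}" for t
  proof -
    have "(SOME s. s \<in> {0..1} \<and> p s = p t) \<in> {0..1} \<and> p (SOME s. s \<in> {0..1} \<and> p s = p t) = p t"
      by (rule someI[of "\<lambda>s. s \<in> {0..1} \<and> p s = p t" t]) (use that in auto)
    then show ?thesis unfolding w_def using wd[OF _ that] by blast
  qed
  show ?thesis
  proof
    have clp: "closed (path_image p)"
      using closed_path_image[OF simple_path_imp_path[OF p(1)]] .
    \<comment> \<open>By compactness the path is a quotient map onto its image: closed preimages
      under \<open>w\<close> are images of compact sets of parameters.\<close>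
    show "continuous_on (path_image p) w"
      unfolding continuous_on_closed_vimage[OF clp]
    proof (intro allI impI)
      fix T :: "complex set" assume "closed T"
      have "w -` T \<inter> path_image p = p ` ({0..1} \<inter> q -` T)"
        using w by (auto simp: path_image_def)
      moreover have "compact ({0..1} \<inter> q -` T)"
        using continuous_closed_preimage[OF q(1) _ \<open>closed T\<close>]
        by (simp add: compact_eq_bounded_closed bounded_Int)
      then have "compact (p ` ({0..1} \<inter> q -` T))"
        by (intro compact_continuous_image continuous_on_subset[OF contp]) auto
      ultimately show "closed (w -` T \<inter> path_image p)"
        by (simp add: compact_imp_closed)
    qed
    show "g z = exp (w z)" if "z \<in> path_image p" for z
      using that w q(2) by (auto simp: path_image_def)
  qed
qed

section \<open>Winding numbers on the boundary of a Jordan domain\<close>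

text \<open>The last two assumptions encode the standard orientation: together the curves wind once
  around each point of \<open>D\<close> and not at all around points off its closure. They say
  nothing about single curves; how the total is distributed is derived in
  \<open>W_in_D\<close>.\<close>

locale jordan_domain =
  fixes D :: "complex set" and m :: nat and \<gamma> :: "nat \<Rightarrow> real \<Rightarrow> complex"
  assumes open_D: "open D" and conn_D: "connected D" and bdd_D: "bounded D" and ne_D: "D \<noteq> {}"
    and simple_gamma: "\<And>j. j < m \<Longrightarrow> simple_path (\<gamma> j)"
    and loop_gamma: "\<And>j. j < m \<Longrightarrow> pathfinish (\<gamma> j) = pathstart (\<gamma> j)"
    and disj_gamma: "\<And>i j. i < m \<Longrightarrow> j < m \<Longrightarrow> i \<noteq> j \<Longrightarrow> path_image (\<gamma> i) \<inter> path_image (\<gamma> j) = {}"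
    and frontier_eq: "(\<Union>j<m. path_image (\<gamma> j)) = frontier D"
    and winding_in: "\<And>w. w \<in> D \<Longrightarrow> bdry_winding m \<gamma> (\<lambda>z. z - w) = 1"
    and winding_out: "\<And>w. w \<notin> closure D \<Longrightarrow> bdry_winding m \<gamma> (\<lambda>z. z - w) = 0"
begin

lemma closure_eq: "closure D = D \<union> frontier D"
  using closure_Un_frontier by blast

lemma D_frontier_disj: "z \<in> D \<Longrightarrow> z \<notin> frontier D"
  using open_D by (simp add: frontier_def interior_open)

lemma compact_closure_D: "compact (closure D)"
  using bdd_D by (simp add: compact_closure)

lemma compact_frontier_D: "compact (frontier D)"
  using bdd_D by (simp add: compact_frontier_bounded)

lemma frontier_in_closure: "z \<in> frontier D \<Longrightarrow> z \<in> closure D"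
  by (simp add: frontier_def)

lemma D_in_closure: "z \<in> D \<Longrightarrow> z \<in> closure D"
  using closure_subset by auto

lemma path_gamma: "j < m \<Longrightarrow> path (\<gamma> j)"
  using simple_gamma simple_path_imp_path by blast

lemma cont_gamma: "j < m \<Longrightarrow> continuous_on {0..1} (\<gamma> j)"
  using path_gamma by (simp add: path_def)

lemma gamma_frontier: "j < m \<Longrightarrow> t \<in> {0..1} \<Longrightarrow> \<gamma> j t \<in> frontier D"
  using frontier_eq by (force simp: path_image_def)

lemma path_image_gamma_frontier: "j < m \<Longrightarrow> path_image (\<gamma> j) \<subseteq> frontier D"
  using frontier_eq by auto

lemma gamma_loop: "j < m \<Longrightarrow> \<gamma> j 0 = \<gamma> j 1"
  using loop_gamma by (simp add: pathfinish_def pathstart_def)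

lemma cont_compose_gamma:
  "continuous_on (frontier D) g \<Longrightarrow> j < m \<Longrightarrow> continuous_on {0..1} (\<lambda>t. g (\<gamma> j t))"
  using continuous_on_compose2[OF _ cont_gamma, of "frontier D" g j] gamma_frontier by blast

definition W :: "(complex \<Rightarrow> complex) \<Rightarrow> nat \<Rightarrow> real" where
  "W g j = arg_change (g \<circ> \<gamma> j)"

definition inv_on_frontier :: "(complex \<Rightarrow> complex) \<Rightarrow> bool" where
  "inv_on_frontier g \<longleftrightarrow> continuous_on (frontier D) g \<and> (\<forall>z\<in>frontier D. g z \<noteq> 0)"

lemma bdry_winding_W: "bdry_winding m \<gamma> g = (\<Sum>j<m. W g j)"
  by (simp add: bdry_winding_def W_def)

lemma W_cong: "(\<And>z. z \<in> frontier D \<Longrightarrow> g z = h z) \<Longrightarrow> j < m \<Longrightarrow> W g j = W h j"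
  unfolding W_def using gamma_frontier by (intro arg_change_cong) simp

lemma bdry_winding_cong:
  "(\<And>z. z \<in> frontier D \<Longrightarrow> g z = h z) \<Longrightarrow> bdry_winding m \<gamma> g = bdry_winding m \<gamma> h"
  unfolding bdry_winding_W by (intro sum.cong refl W_cong) auto

lemma inv_on_frontier_mult:
  "inv_on_frontier g \<Longrightarrow> inv_on_frontier h \<Longrightarrow> inv_on_frontier (\<lambda>z. g z * h z)"
  by (auto simp: inv_on_frontier_def intro: continuous_intros)

lemma inv_on_frontier_inverse:
  "inv_on_frontier g \<Longrightarrow> inv_on_frontier (\<lambda>z. inverse (g z))"
  by (auto simp: inv_on_frontier_def intro: continuous_intros)

lemma inv_on_frontier_divide:
  "inv_on_frontier g \<Longrightarrow> inv_on_frontier h \<Longrightarrow> inv_on_frontier (\<lambda>z. g z / h z)"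
  by (auto simp: inv_on_frontier_def intro: continuous_intros)

lemma inv_on_frontier_powi:
  "inv_on_frontier g \<Longrightarrow> inv_on_frontier (\<lambda>z. g z powi n)"
  by (auto simp: inv_on_frontier_def intro: continuous_intros)

lemma inv_on_frontier_linear: "w \<notin> frontier D \<Longrightarrow> inv_on_frontier (\<lambda>z. z - w)"
  by (auto simp: inv_on_frontier_def intro!: continuous_intros)

lemma inv_on_frontier_prod:
  "(\<And>i. i \<in> I \<Longrightarrow> inv_on_frontier (g i)) \<Longrightarrow> inv_on_frontier (\<lambda>z. \<Prod>i\<in>I. g i z)"
  by (cases "finite I") (auto simp: inv_on_frontier_def intro!: continuous_intros)

lemma W_facts:
  assumes "inv_on_frontier g" "j < m"
  shows "continuous_on {0..1} (\<lambda>t. g (\<gamma> j t))" "t \<in> {0..1} \<Longrightarrow> g (\<gamma> j t) \<noteq> 0"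
  using assms cont_compose_gamma gamma_frontier by (auto simp: inv_on_frontier_def)

lemma W_mult:
  assumes "inv_on_frontier g" "inv_on_frontier h" "j < m"
  shows "W (\<lambda>z. g z * h z) j = W g j + W h j"
  unfolding W_def o_def by (intro arg_change_mult W_facts assms)

lemma W_inverse:
  assumes "inv_on_frontier g" "j < m"
  shows "W (\<lambda>z. inverse (g z)) j = - W g j"
  unfolding W_def o_def by (intro arg_change_inverse W_facts assms)

lemma W_divide:
  assumes "inv_on_frontier g" "inv_on_frontier h" "j < m"
  shows "W (\<lambda>z. g z / h z) j = W g j - W h j"
  using W_mult[OF assms(1) inv_on_frontier_inverse[OF assms(2)] assms(3)] W_inverse[OF assms(2,3)]
  by (simp add: divide_inverse)

lemma W_powi:
  assumes "inv_on_frontier g" "j < m"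
  shows "W (\<lambda>z. g z powi n) j = n * W g j"
  unfolding W_def o_def by (intro arg_change_powi W_facts assms)

lemma W_one: "W (\<lambda>z. 1) j = 0"
  unfolding W_def o_def by (simp add: arg_change_const)

lemma W_prod:
  assumes "finite I" "\<And>i. i \<in> I \<Longrightarrow> inv_on_frontier (g i)" "j < m"
  shows "W (\<lambda>z. \<Prod>i\<in>I. g i z) j = (\<Sum>i\<in>I. W (g i) j)"
  using assms(1,2)
proof (induction I rule: finite_induct)
  case (insert i I)
  have "W (\<lambda>z. g i z * (\<Prod>i\<in>I. g i z)) j = W (g i) j + W (\<lambda>z. \<Prod>i\<in>I. g i z) j"
    using insert.prems by (intro W_mult assms(3) inv_on_frontier_prod) auto
  then show ?case using insert by simp
qed (simp add: W_one)

lemma W_Ints: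
  assumes "inv_on_frontier g" "j < m"
  shows "W g j \<in> \<int>"
  unfolding W_def o_def
  by (rule arg_change_Ints) (use W_facts[OF assms] gamma_loop[OF assms(2)] in auto)

lemma bdry_winding_Ints: "inv_on_frontier g \<Longrightarrow> bdry_winding m \<gamma> g \<in> \<int>"
  unfolding bdry_winding_W using W_Ints by (intro Ints_sum) auto

lemma bdry_winding_mult:
  assumes "inv_on_frontier g" "inv_on_frontier h"
  shows "bdry_winding m \<gamma> (\<lambda>z. g z * h z) = bdry_winding m \<gamma> g + bdry_winding m \<gamma> h"
  unfolding bdry_winding_W using W_mult[OF assms] by (simp add: sum.distrib)

lemma bdry_winding_divide:
  assumes "inv_on_frontier g" "inv_on_frontier h"
  shows "bdry_winding m \<gamma> (\<lambda>z. g z / h z) = bdry_winding m \<gamma> g - bdry_winding m \<gamma> h"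
  unfolding bdry_winding_W using W_divide[OF assms] by (simp add: sum_subtractf)

lemma bdry_winding_one: "bdry_winding m \<gamma> (\<lambda>z. 1) = 0"
  by (simp add: bdry_winding_W W_one)

lemma bdry_winding_Re_pos:
  assumes "continuous_on (frontier D) g" "\<And>z. z \<in> frontier D \<Longrightarrow> Re (g z) > 0"
  shows "bdry_winding m \<gamma> g = 0"
proof -
  have "W g j = 0" if "j < m" for j
    unfolding W_def o_def
    by (rule arg_change_Re_pos)
       (use assms cont_compose_gamma[OF assms(1) that] gamma_loop[OF that] gamma_frontier[OF that] in auto)
  then show ?thesis by (simp add: bdry_winding_W)
qed

lemma W_linear: "j < m \<Longrightarrow> c \<notin> path_image (\<gamma> j) \<Longrightarrow> of_real (W (\<lambda>z. z - c) j) = winding_number (\<gamma> j) c"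
  unfolding W_def o_def by (rule arg_change_winding_number[OF path_gamma loop_gamma])

section \<open>Position of \<open>D\<close> relative to the single boundary curves\<close>

abbreviation "ins j \<equiv> inside (path_image (\<gamma> j))"
abbreviation "outs j \<equiv> outside (path_image (\<gamma> j))"

lemma Jordan_facts:
  assumes "j < m"
  shows "ins j \<noteq> {}" "open (ins j)" "connected (ins j)" "outs j \<noteq> {}" "open (outs j)"
    "connected (outs j)" "bounded (ins j)" "\<not> bounded (outs j)" "ins j \<inter> outs j = {}"
    "ins j \<union> outs j = - path_image (\<gamma> j)" "frontier (ins j) = path_image (\<gamma> j)"
    "frontier (outs j) = path_image (\<gamma> j)"
  using Jordan_inside_outside[OF simple_gamma[OF assms] loop_gamma[OF assms]] by auto

lemma insD: "j < m \<Longrightarrow> x \<in> ins j \<Longrightarrow> x \<notin> outs j \<and> x \<notin> path_image (\<gamma> j)"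
  using Jordan_facts(9,10)[of j] by blast

lemma outsD: "j < m \<Longrightarrow> x \<in> outs j \<Longrightarrow> x \<notin> ins j \<and> x \<notin> path_image (\<gamma> j)"
  using Jordan_facts(9,10)[of j] by blast

lemma closure_ins: "j < m \<Longrightarrow> closure (ins j) = ins j \<union> path_image (\<gamma> j)"
  by (simp add: closure_Un_frontier Jordan_facts)

lemma closure_outs: "j < m \<Longrightarrow> closure (outs j) = outs j \<union> path_image (\<gamma> j)"
  by (simp add: closure_Un_frontier Jordan_facts)

lemma connected_ins_or_outs:
  assumes "j < m" "connected S" "S \<inter> path_image (\<gamma> j) = {}"
  shows "S \<subseteq> ins j \<or> S \<subseteq> outs j"
proof -
  have "S \<subseteq> ins j \<union> outs j"
    using Jordan_facts(10)[OF assms(1)] assms(3) by auto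
  then show ?thesis
    using connectedD[OF assms(2) Jordan_facts(2,5)[OF assms(1)]] Jordan_facts(9)[OF assms(1)] by blast
qed

lemma D_ins_or_outs: "j < m \<Longrightarrow> D \<subseteq> ins j \<or> D \<subseteq> outs j"
  using connected_ins_or_outs[OF _ conn_D] path_image_gamma_frontier D_frontier_disj by blast

text \<open>If curve i lies inside curve j, then the outside of j is connected, unbounded and misses
  curve i, hence lies outside i; so curve j, being in its closure, cannot lie inside i.\<close>

lemma not_mutually_inside:
  assumes "i < m" "j < m" "path_image (\<gamma> i) \<subseteq> ins j" "path_image (\<gamma> j) \<subseteq> ins i"
  shows False
proof -
  have "outs j \<inter> path_image (\<gamma> i) = {}"
    using assms(3) insD[OF assms(2)] by blast
  then have "outs j \<subseteq> outs i"
    using connected_ins_or_outs[OF assms(1) Jordan_facts(6)[OF assms(2)]]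
      bounded_subset[OF Jordan_facts(7)[OF assms(1)]] Jordan_facts(8)[OF assms(2)] by blast
  then have "closure (outs j) \<subseteq> closure (outs i)"
    by (rule closure_mono)
  then have "path_image (\<gamma> j) \<subseteq> outs i \<union> path_image (\<gamma> i)"
    using closure_outs assms by auto
  moreover obtain x where "x \<in> path_image (\<gamma> j)"
    using path_image_nonempty[of "\<gamma> j"] by blast
  ultimately show False
    using assms(4) insD[OF assms(1), of x] by blast
qed

lemma gamma_inside_of_D_inside:
  assumes "i < m" "j < m" "i \<noteq> j" "D \<subseteq> ins j"
  shows "path_image (\<gamma> i) \<subseteq> ins j"
proof -
  have "closure D \<subseteq> closure (ins j)"
    using assms(4) by (rule closure_mono)
  moreover have "path_image (\<gamma> i) \<subseteq> closure D"
    using path_image_gamma_frontier[OF assms(1)] frontier_in_closure by blast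
  ultimately show ?thesis
    using closure_ins[OF assms(2)] disj_gamma[OF assms(1-3)] by blast
qed

lemma W_outs:
  assumes "j < m" "c \<in> outs j"
  shows "W (\<lambda>z. z - c) j = 0"
proof -
  have "of_real (W (\<lambda>z. z - c) j) = (0 :: complex)"
    using W_linear[OF assms(1)] outsD[OF assms]
      winding_number_zero_in_outside[OF path_gamma[OF assms(1)] loop_gamma[OF assms(1)] assms(2)] by simp
  then show ?thesis by simp
qed

text \<open>Otherwise every curve would have winding 0 around a point of \<open>D\<close>, against
  the total of 1.\<close>

lemma outer_exists: "\<exists>j. j < m \<and> D \<subseteq> ins j"
proof (rule ccontr)
  assume *: "\<not> ?thesis"
  obtain a where a: "a \<in> D" using ne_D by auto
  have "W (\<lambda>z. z - a) j = 0" if j: "j < m" for j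
  proof -
    have "a \<in> outs j" using D_ins_or_outs[OF j] * j a by blast
    then show ?thesis by (rule W_outs[OF j])
  qed
  then show False
    using winding_in[OF a] by (simp add: bdry_winding_W)
qed

definition outer :: nat where "outer = (SOME j. j < m \<and> D \<subseteq> ins j)"

lemma outer: "outer < m" "D \<subseteq> ins outer"
  using someI_ex[OF outer_exists] by (auto simp: outer_def)

text \<open>A second curve enclosing \<open>D\<close> would have the outer curve inside it and
  conversely, because both curves lie in the closure of \<open>D\<close>.\<close>

lemma D_outs:
  assumes "j < m" "j \<noteq> outer"
  shows "D \<subseteq> outs j"
proof (rule ccontr)
  assume "\<not> D \<subseteq> outs j"
  then have "D \<subseteq> ins j" using D_ins_or_outs[OF assms(1)] by blast
  then show False
    using not_mutually_inside[OF assms(1) outer(1)] gamma_inside_of_D_inside[OF assms(1) outer(1) assms(2) outer(2)]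
      gamma_inside_of_D_inside[OF outer(1) assms(1) assms(2)[symmetric]] by blast
qed

text \<open>The component of the complement of the j-th curve that is disjoint from
  \<open>D\<close>: the unbounded one for the outer curve, a hole for every other curve.\<close>

definition side :: "nat \<Rightarrow> complex set" where
  "side j = (if j = outer then outs j else ins j)"

lemma side_facts:
  assumes "j < m"
  shows "open (side j)" "connected (side j)" "side j \<noteq> {}" "frontier (side j) = path_image (\<gamma> j)"
    "side j \<inter> closure D = {}"
proof -
  show o: "open (side j)" "connected (side j)" "side j \<noteq> {}" "frontier (side j) = path_image (\<gamma> j)"
    using Jordan_facts[OF assms] by (auto simp: side_def)
  have "side j \<inter> D = {}"
    using outer D_outs[OF assms] insD[OF assms] by (auto simp: side_def)
  then show "side j \<inter> closure D = {}"
    using o(1) open_Int_closure_eq_empty by blast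
qed

definition holes :: "nat set" where "holes = {..<m} - {outer}"

definition ctr :: "nat \<Rightarrow> complex" where "ctr j = (SOME c. c \<in> ins j)"

lemma finite_holes [simp]: "finite holes"
  by (simp add: holes_def)

lemma holesD: "j \<in> holes \<Longrightarrow> j < m \<and> j \<noteq> outer"
  by (auto simp: holes_def)

lemma ctr_ins: "j \<in> holes \<Longrightarrow> ctr j \<in> ins j"
  using Jordan_facts(1) holesD unfolding ctr_def by (metis some_in_eq)

lemma ctr_notin: "j \<in> holes \<Longrightarrow> ctr j \<notin> closure D"
  using ctr_ins side_facts(5) holesD by (fastforce simp: side_def)

text \<open>A point of \<open>D\<close> lies outside every other curve, so the prescribed total of 1
  must come from the outer curve alone.\<close>

lemma W_in_D:
  assumes "w \<in> D" "j < m"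
  shows "W (\<lambda>z. z - w) j = (if j = outer then 1 else 0)"
proof -
  have 0: "W (\<lambda>z. z - w) j = 0" if "j < m" "j \<noteq> outer" for j
    using W_outs[OF that(1)] D_outs[OF that] assms(1) by blast
  have "1 = (\<Sum>j<m. W (\<lambda>z. z - w) j)"
    using winding_in[OF assms(1)] by (simp add: bdry_winding_W)
  also have "\<dots> = W (\<lambda>z. z - w) outer + (\<Sum>j\<in>{..<m} - {outer}. W (\<lambda>z. z - w) j)"
    using outer(1) by (intro sum.remove) auto
  also have "\<dots> = W (\<lambda>z. z - w) outer"
    using 0 by simp
  finally show ?thesis using 0 assms(2) by auto
qed

text \<open>The inside of curve j lies outside curve i. If it lay inside i, then taking closures
  would put curve j inside or on i, whereas it lies outside i together with
  \<open>D\<close>.\<close>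

lemma W_ctr_other:
  assumes "j \<in> holes" "i < m" "i \<noteq> j" "i \<noteq> outer"
  shows "W (\<lambda>z. z - ctr j) i = 0"
proof -
  have j: "j < m" "j \<noteq> outer" using holesD assms by auto
  have sub: "path_image (\<gamma> k) \<subseteq> outs l" if "k < m" "l < m" "k \<noteq> l" "l \<noteq> outer" for k l
  proof -
    have "closure D \<subseteq> closure (outs l)"
      using D_outs that by (intro closure_mono) auto
    moreover have "path_image (\<gamma> k) \<subseteq> closure D"
      using path_image_gamma_frontier[OF that(1)] frontier_in_closure by blast
    ultimately show ?thesis
      using closure_outs[OF that(2)] disj_gamma[OF that(1-3)] by blast
  qed
  have "path_image (\<gamma> i) \<inter> ins j = {}"
    using sub[of i j] assms j insD[OF j(1)] by blast
  then consider "ins j \<subseteq> ins i" | "ins j \<subseteq> outs i"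
    using connected_ins_or_outs[OF assms(2) Jordan_facts(3)[OF j(1)]] by blast
  then have "ctr j \<in> outs i"
  proof cases
    case 1
    then have "closure (ins j) \<subseteq> closure (ins i)" by (rule closure_mono)
    then have "path_image (\<gamma> j) \<subseteq> ins i \<union> path_image (\<gamma> i)"
      using closure_ins assms j by auto
    moreover have "path_image (\<gamma> j) \<subseteq> outs i"
      using sub[of j i] assms j by auto
    moreover obtain x where "x \<in> path_image (\<gamma> j)"
      using path_image_nonempty[of "\<gamma> j"] by blast
    ultimately show ?thesis
      using outsD[OF assms(2), of x] by blast
  next
    case 2
    then show ?thesis using ctr_ins[OF assms(1)] by auto
  qed
  then show ?thesis by (rule W_outs[OF assms(2)])
qed

lemma W_ctr_self:
  assumes "j \<in> holes"
  shows "\<bar>W (\<lambda>z. z - ctr j) j\<bar> = 1"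
proof -
  have j: "j < m" using holesD assms by auto
  have "norm (of_real (W (\<lambda>z. z - ctr j) j) :: complex) = 1"
    using W_linear[OF j, of "ctr j"] simple_closed_path_norm_winding_number_inside[OF simple_gamma[OF j] ctr_ins[OF assms]]
      insD[OF j ctr_ins[OF assms]] by metis
  then show ?thesis by simp
qed

text \<open>Glueing a continuous nowhere zero \<open>g\<close> on the closure to a comparison function \<open>e\<close> on the
  complement of \<open>D\<close> yields a nowhere zero function on the simply connected plane.\<close>

lemma glue_log:
  assumes g: "continuous_on (closure D) g" "\<And>z. z \<in> closure D \<Longrightarrow> g z \<noteq> 0"
      and e: "continuous_on (- D) e" "\<And>z. z \<notin> D \<Longrightarrow> e z \<noteq> 0"
      and W: "\<And>j. j < m \<Longrightarrow> W g j = W e j"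
  obtains w l where "continuous_on UNIV w" "continuous_on UNIV l"
    "\<And>z. z \<in> closure D \<Longrightarrow> g z = exp (w z + l z)" "\<And>z. z \<in> frontier D \<Longrightarrow> e z = exp (l z)"
proof -
  have fr: "frontier D \<subseteq> closure D" "frontier D \<subseteq> - D"
    using D_frontier_disj frontier_in_closure by auto
  have inv: "inv_on_frontier g" "inv_on_frontier e"
    using g e fr unfolding inv_on_frontier_def by (auto intro: continuous_on_subset)
  let ?q = "\<lambda>z. g z / e z"
  have invq: "inv_on_frontier ?q"
    using inv by (rule inv_on_frontier_divide)
  have "\<exists>w. continuous_on (path_image (\<gamma> j)) w \<and> (\<forall>z\<in>path_image (\<gamma> j). ?q z = exp (w z))" if j: "j < m" for j
  proof -
    have "arg_change (?q \<circ> \<gamma> j) = 0"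
      using W_divide[OF inv j] W[OF j] by (simp add: W_def)
    moreover have "continuous_on (path_image (\<gamma> j)) ?q" "\<And>z. z \<in> path_image (\<gamma> j) \<Longrightarrow> ?q z \<noteq> 0"
      using invq path_image_gamma_frontier[OF j] unfolding inv_on_frontier_def
      by (blast intro: continuous_on_subset)+
    ultimately show ?thesis
      using loop_log_factors[OF simple_gamma[OF j] loop_gamma[OF j], of ?q] by metis
  qed
  then obtain w where w: "\<And>j. j < m \<Longrightarrow> continuous_on (path_image (\<gamma> j)) (w j)"
      "\<And>j z. j < m \<Longrightarrow> z \<in> path_image (\<gamma> j) \<Longrightarrow> ?q z = exp (w j z)"
    by metis
  \<comment> \<open>The curves are disjoint and closed, so the logarithms on the single curves
    combine to one continuous function on the frontier, which Tietze's theorem extends to the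
    plane.\<close>
  define w0 where "w0 = (\<lambda>z. w (THE j. j < m \<and> z \<in> path_image (\<gamma> j)) z)"
  have w0: "w0 z = w j z" if "j < m" "z \<in> path_image (\<gamma> j)" for j z
  proof -
    have "(THE j. j < m \<and> z \<in> path_image (\<gamma> j)) = j"
      using that disj_gamma by (intro the_equality) blast+
    then show ?thesis by (simp add: w0_def)
  qed
  have "continuous_on (\<Union>j\<in>{..<m}. path_image (\<gamma> j)) w0"
  proof (rule continuous_on_closed_Union)
    show "closed (path_image (\<gamma> j))" if "j \<in> {..<m}" for j
      using that path_gamma closed_path_image by auto
    show "continuous_on (path_image (\<gamma> j)) w0" if "j \<in> {..<m}" for j
      using that w(1)[of j] w0 by (subst continuous_on_cong[OF refl]) auto
  qed auto
  then have "continuous_on (frontier D) w0"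
    by (simp add: frontier_eq)
  then obtain u where u: "continuous_on UNIV u" "\<And>z. z \<in> frontier D \<Longrightarrow> u z = w0 z"
    using Tietze_unbounded[of "frontier D" w0 UNIV] by (auto simp: closed_closedin[symmetric])
  have qu: "g z = e z * exp (u z)" if "z \<in> frontier D" for z
  proof -
    obtain j where j: "j < m" "z \<in> path_image (\<gamma> j)"
      using \<open>z \<in> frontier D\<close> frontier_eq by auto
    then have "?q z = exp (u z)"
      using w(2) w0 u(2) that by simp
    then show ?thesis
      using e(2)[of z] fr that by (auto simp: field_simps)
  qed
  define E where "E = (\<lambda>z. if z \<in> closure D then g z * exp (- u z) else e z)"
  have Efr: "g z * exp (- u z) = e z" if "z \<in> frontier D" for z
    using qu[OF that] by (simp add: exp_minus)
  have "continuous_on (closure D \<union> (- D)) E"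
    unfolding E_def
  proof (rule continuous_on_cases)
    show "continuous_on (closure D) (\<lambda>z. g z * exp (- u z))"
      by (intro continuous_intros g(1) continuous_on_subset[OF u(1)]) auto
    show "\<forall>x. x \<in> closure D \<and> x \<notin> closure D \<or> x \<in> - D \<and> x \<in> closure D \<longrightarrow> g x * exp (- u x) = e x"
      using Efr closure_eq by auto
  qed (use open_D e(1) in auto)
  moreover have "closure D \<union> (- D) = UNIV"
    using D_in_closure by auto
  ultimately have "continuous_on UNIV E" by simp
  moreover have "E z \<noteq> 0" for z
    using g(2)[of z] e(2)[of z] D_in_closure[of z] by (auto simp: E_def)
  ultimately obtain l where l: "continuous_on UNIV l" "\<And>z. E z = exp (l z)"
    using continuous_logarithm_on_contractible[of UNIV E] convex_imp_contractible[OF convex_UNIV] by auto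
  show ?thesis
  proof
    show "continuous_on UNIV u" "continuous_on UNIV l" by fact+
    show "g z = exp (u z + l z)" if "z \<in> closure D" for z
      using l(2)[of z] that by (simp add: E_def exp_add exp_minus field_simps)
    show "e z = exp (l z)" if "z \<in> frontier D" for z
      using l(2)[of z] that Efr[OF that] frontier_in_closure[OF that] by (simp add: E_def)
  qed
qed

text \<open>Up to exponentials, continuous nowhere zero functions on the closure are classified by their
  winding numbers around the holes.\<close>

lemma exp_representation:
  assumes g: "continuous_on (closure D) g" "\<And>z. z \<in> closure D \<Longrightarrow> g z \<noteq> 0"
  obtains q k where "continuous_on (closure D) q"
    "\<And>z. z \<in> closure D \<Longrightarrow> g z = exp (q z) * (\<Prod>j\<in>holes. (z - ctr j) powi (k j))"
proof -
  obtain a where a: "a \<in> D" using ne_D by auto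
  have inv: "inv_on_frontier g"
    using g frontier_in_closure unfolding inv_on_frontier_def
    by (meson continuous_on_subset subsetI)
  \<comment> \<open>The winding of \<open>z - ctr j\<close> along curve j is 1 or -1. Using it as a
    factor of the exponent produces its square, which is 1 whatever the direction of the
    curve.\<close>
  define k where "k = (\<lambda>j. \<lfloor>W g j\<rfloor> * \<lfloor>W (\<lambda>z. z - ctr j) j\<rfloor>)"
  let ?p = "\<lambda>z. \<Prod>j\<in>holes. (z - ctr j) powi (k j)"
  have invc: "inv_on_frontier (\<lambda>z. z - ctr j)" if "j \<in> holes" for j
    using ctr_notin[OF that] frontier_in_closure by (auto intro: inv_on_frontier_linear)
  have invp: "inv_on_frontier ?p"
    by (intro inv_on_frontier_prod inv_on_frontier_powi invc)
  have Wp: "W ?p i = W g i" if "i \<in> holes" for i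
  proof -
    have i: "i < m" "i \<noteq> outer" using holesD that by auto
    have "W ?p i = (\<Sum>j\<in>holes. k j * W (\<lambda>z. z - ctr j) i)"
      using W_prod[of holes "\<lambda>j z. (z - ctr j) powi (k j)" i] W_powi invc i(1) inv_on_frontier_powi by simp
    also have "\<dots> = (\<Sum>j\<in>holes. if j = i then k i * W (\<lambda>z. z - ctr i) i else 0)"
      using W_ctr_other i by (intro sum.cong) auto
    also have "\<dots> = k i * W (\<lambda>z. z - ctr i) i"
      using that by simp
    also have "\<dots> = W g i"
    proof -
      have fl: "of_int \<lfloor>W g i\<rfloor> = W g i" "of_int \<lfloor>W (\<lambda>z. z - ctr i) i\<rfloor> = W (\<lambda>z. z - ctr i) i"
        using W_Ints[OF inv i(1)] W_Ints[OF invc[OF that] i(1)] by (auto elim!: Ints_cases)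
      have sq: "W (\<lambda>z. z - ctr i) i * W (\<lambda>z. z - ctr i) i = 1"
        using W_ctr_self[OF that] by (metis abs_mult_self_eq mult_1)
      show ?thesis unfolding k_def of_int_mult fl mult.assoc sq by simp
    qed
    finally show ?thesis .
  qed
  define g1 where "g1 = (\<lambda>z. g z / ?p z)"
  have pne: "?p z \<noteq> 0" if "z \<in> closure D" for z
    using that ctr_notin by (auto simp: power_int_eq_0_iff)
  have g1: "continuous_on (closure D) g1" "\<And>z. z \<in> closure D \<Longrightarrow> g1 z \<noteq> 0"
    using pne g ctr_notin unfolding g1_def by (fastforce intro!: continuous_intros)+
  have W1: "W g1 j = 0" if "j \<in> holes" for j
    using W_divide[OF inv invp] Wp[OF that] holesD[OF that] by (simp add: g1_def)
  have inv1: "inv_on_frontier g1"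
    unfolding g1_def using inv invp by (rule inv_on_frontier_divide)
  \<comment> \<open>After division by the product only the winding along the outer curve is left.
    The comparison function \<open>(z - a) powi n\<close> with \<open>a\<close> in \<open>D\<close>
    has exactly these windings and no zero off \<open>D\<close>.\<close>
  define n where "n = \<lfloor>W g1 outer\<rfloor>"
  let ?e = "\<lambda>z. (z - a) powi n"
  have inva: "inv_on_frontier (\<lambda>z. z - a)"
    using a D_frontier_disj by (intro inv_on_frontier_linear) auto
  have We: "W g1 j = W ?e j" if "j < m" for j
  proof (cases "j = outer")
    case True
    have "of_int n = W g1 outer"
      using W_Ints[OF inv1 outer(1)] by (simp add: n_def )
    then show ?thesis
      using W_powi[OF inva that] W_in_D[OF a that] True by simp
  next
    case False
    then show ?thesis
      using W_powi[OF inva that] W_in_D[OF a that] W1[of j] that by (simp add: holes_def)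
  qed
  have "continuous_on (- D) ?e" "\<And>z. z \<notin> D \<Longrightarrow> ?e z \<noteq> 0"
    using a by (auto intro!: continuous_intros)
  then obtain w l where wl: "continuous_on UNIV w" "continuous_on UNIV l"
    "\<And>z. z \<in> closure D \<Longrightarrow> g1 z = exp (w z + l z)" "\<And>z. z \<in> frontier D \<Longrightarrow> ?e z = exp (l z)"
    using glue_log[OF g1, of ?e] We by blast
  show ?thesis
  proof
    show "continuous_on (closure D) (\<lambda>z. w z + l z)"
      by (intro continuous_intros continuous_on_subset[OF wl(1)] continuous_on_subset[OF wl(2)]) auto
    show "g z = exp (w z + l z) * ?p z" if "z \<in> closure D" for z
      using wl(3)[OF that] pne[OF that] by (simp add: g1_def field_simps)
  qed
qed

text \<open>The topological half of the argument principle. In the exponential representation the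
  exponential has a single-valued logarithm, and each \<open>z - ctr j\<close> has total winding 0
  because \<open>ctr j\<close> is not in the closure.\<close>

lemma bdry_winding_nonvanishing:
  assumes g: "continuous_on (closure D) g" "\<And>z. z \<in> closure D \<Longrightarrow> g z \<noteq> 0"
  shows "bdry_winding m \<gamma> g = 0"
proof -
  obtain q k where q: "continuous_on (closure D) q"
    "\<And>z. z \<in> closure D \<Longrightarrow> g z = exp (q z) * (\<Prod>j\<in>holes. (z - ctr j) powi (k j))"
    using exp_representation[OF g] by blast
  have fr: "frontier D \<subseteq> closure D"
    using frontier_in_closure by auto
  have inve: "inv_on_frontier (\<lambda>z. exp (q z))"
    using q(1) fr by (auto simp: inv_on_frontier_def intro!: continuous_intros intro: continuous_on_subset)
  have We: "W (\<lambda>z. exp (q z)) j = 0" if "j < m" for j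
  proof -
    have "continuous_on {0..1} (\<lambda>t. q (\<gamma> j t))"
      using cont_compose_gamma[OF _ that] q(1) fr continuous_on_subset by blast
    then have "arg_change (\<lambda>t. exp (q (\<gamma> j t))) = (Im (q (\<gamma> j 1)) - Im (q (\<gamma> j 0))) / (2 * pi)"
      by (intro arg_change_eqI) auto
    then show ?thesis
      using gamma_loop[OF that] by (simp add: W_def o_def)
  qed
  have invc: "inv_on_frontier (\<lambda>z. z - ctr j)" if "j \<in> holes" for j
    using ctr_notin[OF that] frontier_in_closure by (auto intro: inv_on_frontier_linear)
  have Wpi: "W (\<lambda>z. exp (q z) * (\<Prod>j\<in>holes. (z - ctr j) powi (k j))) i
      = (\<Sum>j\<in>holes. k j * W (\<lambda>z. z - ctr j) i)" if "i < m" for i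
    using W_mult[OF inve inv_on_frontier_prod, of holes "\<lambda>j z. (z - ctr j) powi (k j)" i] We[OF that]
      W_prod[of holes "\<lambda>j z. (z - ctr j) powi (k j)" i] W_powi invc that inv_on_frontier_powi by simp
  have "bdry_winding m \<gamma> g = bdry_winding m \<gamma> (\<lambda>z. exp (q z) * (\<Prod>j\<in>holes. (z - ctr j) powi (k j)))"
    using q(2) fr by (intro bdry_winding_cong) auto
  also have "\<dots> = (\<Sum>i<m. \<Sum>j\<in>holes. k j * W (\<lambda>z. z - ctr j) i)"
    using Wpi by (simp add: bdry_winding_W)
  also have "\<dots> = (\<Sum>j\<in>holes. k j * (\<Sum>i<m. W (\<lambda>z. z - ctr j) i))"
    by (subst sum.swap) (simp add: sum_distrib_left)
  also have "\<dots> = 0"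
    using winding_out ctr_notin by (intro sum.neutral) (simp add: bdry_winding_W)
  finally show ?thesis .
qed

end

section \<open>The argument principle\<close>

text \<open>Near each point continuity keeps \<open>q\<close> within distance 1 of its value there,
  so the principal branch of the logarithm recovers \<open>q\<close> from its exponential.\<close>

lemma holomorphic_on_continuous_log:
  assumes "open S" "continuous_on S q" "(\<lambda>z. exp (q z)) holomorphic_on S"
  shows "q holomorphic_on S"
proof -
  have "\<exists>T. open T \<and> z0 \<in> T \<and> q holomorphic_on T" if z0: "z0 \<in> S" for z0
  proof -
    have "isCont q z0"
      using assms(1,2) z0 continuous_on_eq_continuous_at by blast
    then obtain d where d: "d > 0" "\<And>z. dist z z0 < d \<Longrightarrow> dist (q z) (q z0) < 1"
      unfolding continuous_at_eps_delta by (metis zero_less_one)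
    obtain e where e: "e > 0" "ball z0 e \<subseteq> S"
      using assms(1) z0 open_contains_ball by blast
    let ?T = "ball z0 (min d e)"
    have im: "\<bar>Im (q z - q z0)\<bar> < 1" if "z \<in> ?T" for z
      using d(2)[of z] that abs_Im_le_cmod[of "q z - q z0"] by (auto simp: dist_norm norm_minus_commute)
    have ex: "exp (q z) / exp (q z0) \<notin> \<real>\<^sub>\<le>\<^sub>0" "q z = q z0 + Ln (exp (q z) / exp (q z0))" if "z \<in> ?T" for z
    proof -
      have *: "exp (q z) / exp (q z0) = exp (q z - q z0)"
        by (simp add: exp_diff)
      have "cos (Im (q z - q z0)) > 0"
        using im[OF that] pi_gt3 by (intro cos_gt_zero_pi) auto
      then have "Re (exp (q z - q z0)) > 0"
        unfolding Re_exp by simp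
      then show "exp (q z) / exp (q z0) \<notin> \<real>\<^sub>\<le>\<^sub>0"
        unfolding * by (auto simp: complex_nonpos_Reals_iff)
      have "Ln (exp (q z - q z0)) = q z - q z0"
        using im[OF that] pi_gt3 by (intro Ln_exp) auto
      then show "q z = q z0 + Ln (exp (q z) / exp (q z0))"
        unfolding * by simp
    qed
    have "?T \<subseteq> S"
      using e(2) by auto
    then have "(\<lambda>z. exp (q z)) holomorphic_on ?T"
      using assms(3) holomorphic_on_subset by blast
    then have "(\<lambda>z. q z0 + Ln (exp (q z) / exp (q z0))) holomorphic_on ?T"
      using ex(1) by (intro holomorphic_on_add holomorphic_on_const holomorphic_on_Ln' holomorphic_on_divide) auto
    then have "q holomorphic_on ?T"
      by (rule holomorphic_transform) (simp add: ex(2)[symmetric])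
    then show ?thesis
      using d(1) e(1) by (intro exI[of _ ?T]) auto
  qed
  then have "\<And>z0. z0 \<in> S \<Longrightarrow> q field_differentiable at z0"
    by (meson holomorphic_on_imp_differentiable_at)
  then show ?thesis
    by (simp add: field_differentiable_at_within holomorphic_on_def)
qed

section \<open>Closure properties of \<open>disc_alg D\<close> and division by zeros\<close>

lemma disc_algD: "h \<in> disc_alg D \<Longrightarrow> continuous_on (closure D) h" "h \<in> disc_alg D \<Longrightarrow> h holomorphic_on D"
  by (auto simp: disc_alg_def)

lemma disc_alg_const: "(\<lambda>z. c) \<in> disc_alg D"
  by (simp add: disc_alg_def)

lemma disc_alg_ident: "(\<lambda>z. z) \<in> disc_alg D"
  by (simp add: disc_alg_def)

lemma disc_alg_add: "g \<in> disc_alg D \<Longrightarrow> h \<in> disc_alg D \<Longrightarrow> (\<lambda>z. g z + h z) \<in> disc_alg D"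
  by (auto simp: disc_alg_def intro!: continuous_intros holomorphic_intros)

lemma disc_alg_diff: "g \<in> disc_alg D \<Longrightarrow> h \<in> disc_alg D \<Longrightarrow> (\<lambda>z. g z - h z) \<in> disc_alg D"
  by (auto simp: disc_alg_def intro!: continuous_intros holomorphic_intros)

lemma disc_alg_minus: "g \<in> disc_alg D \<Longrightarrow> (\<lambda>z. - g z) \<in> disc_alg D"
  by (auto simp: disc_alg_def intro!: continuous_intros holomorphic_intros)

lemma disc_alg_mult: "g \<in> disc_alg D \<Longrightarrow> h \<in> disc_alg D \<Longrightarrow> (\<lambda>z. g z * h z) \<in> disc_alg D"
  by (auto simp: disc_alg_def intro!: continuous_intros holomorphic_intros)

lemma disc_alg_power: "g \<in> disc_alg D \<Longrightarrow> (\<lambda>z. g z ^ n) \<in> disc_alg D"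
  by (auto simp: disc_alg_def intro!: continuous_intros holomorphic_intros)

lemma disc_alg_exp: "g \<in> disc_alg D \<Longrightarrow> (\<lambda>z. exp (g z)) \<in> disc_alg D"
  by (auto simp: disc_alg_def intro!: continuous_intros holomorphic_intros)

lemma disc_alg_poly: "poly p \<in> disc_alg D"
  by (auto simp: disc_alg_def intro!: continuous_intros holomorphic_intros)

lemma disc_alg_divide:
  "g \<in> disc_alg D \<Longrightarrow> h \<in> disc_alg D \<Longrightarrow> (\<And>z. z \<in> closure D \<Longrightarrow> h z \<noteq> 0) \<Longrightarrow> (\<lambda>z. g z / h z) \<in> disc_alg D"
  using closure_subset[of D] by (auto simp: disc_alg_def intro!: continuous_intros holomorphic_intros)

lemma disc_alg_powi:
  "g \<in> disc_alg D \<Longrightarrow> (\<And>z. z \<in> closure D \<Longrightarrow> g z \<noteq> 0) \<Longrightarrow> (\<lambda>z. g z powi n) \<in> disc_alg D"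
  using closure_subset[of D] by (auto simp: disc_alg_def intro!: continuous_intros holomorphic_intros)

lemma disc_alg_prod:
  "(\<And>i. i \<in> I \<Longrightarrow> g i \<in> disc_alg D) \<Longrightarrow> (\<lambda>z. \<Prod>i\<in>I. g i z) \<in> disc_alg D"
  by (auto simp: disc_alg_def intro!: continuous_intros holomorphic_intros)

lemma disc_alg_cong:
  assumes "g \<in> disc_alg D" "\<And>z. z \<in> closure D \<Longrightarrow> g z = h z"
  shows "h \<in> disc_alg D"
proof -
  have "continuous_on (closure D) h"
    using disc_algD(1)[OF assms(1)] assms(2) by (subst continuous_on_cong[OF refl]) auto
  moreover have "h holomorphic_on D"
    using disc_algD(2)[OF assms(1)] by (rule holomorphic_transform) (use assms(2) closure_subset in auto)
  ultimately show ?thesis by (simp add: disc_alg_def)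
qed

lemma continuous_on_closureI:
  fixes D :: "complex set"
  assumes "open D" "finite S" "S \<subseteq> D" "continuous_on D k" "continuous_on (closure D - S) k"
  shows "continuous_on (closure D) k"
proof -
  have "openin (top_of_set (closure D)) D"
    using assms(1) closure_subset by (metis open_subset)
  moreover have "openin (top_of_set (closure D)) (closure D - S)"
    using openin_open_Int[OF open_Compl[OF finite_imp_closed[OF assms(2)]], of "closure D"] by (simp add: Diff_eq)
  moreover have "D \<union> (closure D - S) = closure D"
    using assms(3) closure_subset by blast
  ultimately show ?thesis
    using continuous_on_Un_local_open[of D "closure D - S" k] assms(4,5) by simp
qed

text \<open>The quotient is critical only at the interior point \<open>a\<close>, where
  \<open>k\<close> is already holomorphic; everywhere else, in particular on the frontier,
  continuity comes from the quotient.\<close>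

lemma disc_alg_remove_point:
  assumes "open D" "a \<in> D" "k holomorphic_on D" "h \<in> disc_alg D" "g \<in> disc_alg D"
    and "\<And>z. z \<in> closure D - {a} \<Longrightarrow> g z \<noteq> 0" "\<And>z. z \<in> closure D - {a} \<Longrightarrow> k z = h z / g z"
  shows "k \<in> disc_alg D"
proof -
  have "continuous_on (closure D - {a}) (\<lambda>z. h z / g z)"
    using assms(6) by (intro continuous_intros continuous_on_subset[OF disc_algD(1)[OF assms(4)]]
      continuous_on_subset[OF disc_algD(1)[OF assms(5)]]) auto
  then have "continuous_on (closure D - {a}) k"
    using assms(7) by (subst continuous_on_cong[OF refl]) auto
  then have "continuous_on (closure D) k"
    using assms(1,2,3) holomorphic_on_imp_continuous_on by (intro continuous_on_closureI[of D "{a}"]) auto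
  then show ?thesis
    using assms(3) by (simp add: disc_alg_def)
qed

lemma disc_alg_factor:
  assumes "open D" "h \<in> disc_alg D" "a \<in> D" "h a = 0"
  obtains k where "k \<in> disc_alg D" "\<And>z. z \<in> closure D \<Longrightarrow> h z = (z - a) * k z"
proof -
  define k where "k = (\<lambda>z. if z = a then deriv h a else h z / (z - a) - h a / (z - a))"
  have hol: "k holomorphic_on D"
    unfolding k_def using assms by (intro pole_theorem_open disc_algD) auto
  have "k \<in> disc_alg D"
    by (rule disc_alg_remove_point[OF assms(1,3) hol assms(2), of "\<lambda>z. z - a"])
       (auto simp: k_def assms(4) intro!: disc_alg_diff disc_alg_ident disc_alg_const)
  moreover have "h z = (z - a) * k z" if "z \<in> closure D" for z
    using assms(4) by (auto simp: k_def)
  ultimately show ?thesis using that by blast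
qed

context jordan_domain
begin

lemma frontier_nonempty: "frontier D \<noteq> {}"
proof -
  obtain j where "j < m" using outer(1) by auto
  then show ?thesis
    using path_image_nonempty[of "\<gamma> j"] path_image_gamma_frontier by blast
qed

lemma disc_alg_cont_frontier: "h \<in> disc_alg D \<Longrightarrow> continuous_on (frontier D) h"
  using disc_algD(1) continuous_on_subset frontier_in_closure by (metis subsetI)

lemma inv_on_frontier_disc_alg:
  "h \<in> disc_alg D \<Longrightarrow> (\<And>z. z \<in> frontier D \<Longrightarrow> h z \<noteq> 0) \<Longrightarrow> inv_on_frontier h"
  using disc_alg_cont_frontier by (auto simp: inv_on_frontier_def)

lemma bdry_winding_poly:
  assumes "s \<noteq> 0" "\<And>z. poly s z = 0 \<Longrightarrow> z \<in> D"
  shows "bdry_winding m \<gamma> (poly s) = degree s"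
  using assms
proof (induction "degree s" arbitrary: s)
  case 0
  then obtain c where c: "s = [:c:]" "c \<noteq> 0"
    by (metis degree_eq_zeroE pCons_eq_0_iff)
  have "bdry_winding m \<gamma> (poly s) = bdry_winding m \<gamma> (\<lambda>z. c)"
    by (rule bdry_winding_cong) (simp add: c)
  also have "\<dots> = 0"
    using c(2) by (intro bdry_winding_nonvanishing) auto
  finally show ?case using 0 by simp
next
  case (Suc n)
  have "\<not> constant (poly s)"
    using Suc(2) by (simp add: constant_degree)
  then obtain a where a: "poly s a = 0"
    using Fundamental_Theorem_Algebra.fundamental_theorem_of_algebra by blast
  then obtain s' where s': "s = [:-a, 1:] * s'"
    by (metis dvdE poly_eq_0_iff_dvd)
  have ne: "s' \<noteq> 0" using Suc.prems s' by auto
  have deg: "degree s' = n"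
    using Suc(2) s' ne by (subst (asm) s', subst (asm) degree_mult_eq) auto
  have IH: "bdry_winding m \<gamma> (poly s') = n"
    using Suc(1)[of s'] ne deg Suc.prems(2) s' by auto
  have aD: "a \<in> D" using a Suc.prems(2) by auto
  have i1: "inv_on_frontier (\<lambda>z. z - a)"
    using aD D_frontier_disj by (intro inv_on_frontier_linear) auto
  have i2: "inv_on_frontier (poly s')"
    using Suc.prems(2) s' D_frontier_disj by (intro inv_on_frontier_disc_alg disc_alg_poly) auto
  have "bdry_winding m \<gamma> (poly s) = bdry_winding m \<gamma> (\<lambda>z. (z - a) * poly s' z)"
    by (rule bdry_winding_cong) (simp add: s' algebra_simps)
  also have "\<dots> = 1 + n"
    using bdry_winding_mult[OF i1 i2] winding_in[OF aD] IH by simp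
  finally show ?case using Suc(2) by simp
qed

text \<open>Zeros in the compact closure could accumulate only in \<open>D\<close>, as
  \<open>g\<close> has none on the frontier, and then \<open>g\<close> would vanish identically.
  Hence they are finitely many and can be divided out one after the other.\<close>

lemma zeros_factor:
  assumes "g \<in> disc_alg D" "\<And>z. z \<in> frontier D \<Longrightarrow> g z \<noteq> 0"
  obtains s g1 where "s \<noteq> 0" "\<And>z. poly s z = 0 \<Longrightarrow> z \<in> D" "g1 \<in> disc_alg D"
    "\<And>z. z \<in> closure D \<Longrightarrow> g1 z \<noteq> 0" "\<And>z. z \<in> closure D \<Longrightarrow> g z = poly s z * g1 z"
proof -
  let ?Z = "\<lambda>g. {z \<in> closure D. g z = (0::complex)}"
  have nonzero: "\<not> (\<forall>z\<in>D. g z = 0)"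
  proof
    assume 0: "\<forall>z\<in>D. g z = 0"
    obtain b where b: "b \<in> frontier D" using frontier_nonempty by auto
    have "g b = 0"
      by (rule continuous_constant_on_closure[OF disc_algD(1)[OF assms(1)], of 0])
         (use 0 frontier_in_closure[OF b] in auto)
    then show False using assms(2)[OF b] by simp
  qed
  have fin: "finite (?Z g)"
  proof (rule ccontr)
    assume inf: "infinite (?Z g)"
    have "closed (closure D \<inter> g -` {0})"
      using disc_algD(1)[OF assms(1)] by (intro continuous_closed_preimage) auto
    then have "compact (?Z g)"
      using compact_closure_D compact_Int_closed[of "closure D" "closure D \<inter> g -` {0}"]
      by (auto simp: vimage_def Int_def)
    then obtain x where x: "x \<in> ?Z g" "x islimpt ?Z g"
      using inf unfolding compact_eq_Bolzano_Weierstrass by blast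
    have Zs: "?Z g \<subseteq> D" using assms(2) closure_eq by auto
    have "g w = 0" if "w \<in> D" for w
      by (rule analytic_continuation[OF disc_algD(2)[OF assms(1)] open_D conn_D Zs _ x(2) _ that])
         (use x Zs in auto)
    then show False using nonzero by blast
  qed
  have "\<exists>s g1. s \<noteq> 0 \<and> (\<forall>z. poly s z = 0 \<longrightarrow> z \<in> D) \<and> g1 \<in> disc_alg D \<and>
      (\<forall>z\<in>closure D. g1 z \<noteq> 0) \<and> (\<forall>z\<in>closure D. g z = poly s z * g1 z)"
    using assms(1,2) fin nonzero
  proof (induction "card (?Z g)" arbitrary: g)
    case 0
    then have "\<forall>z\<in>closure D. g z \<noteq> 0" by auto
    then show ?case using 0 by (intro exI[of _ 1] exI[of _ g]) auto
  next
    case (Suc n)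
    have "?Z g \<noteq> {}" using Suc(2) by (metis card.empty nat.distinct(1))
    then obtain a where a: "a \<in> closure D" "g a = 0" by blast
    then have aD: "a \<in> D" using Suc.prems(2) closure_eq by auto
    obtain w where w: "w \<in> D" "g w \<noteq> 0" using Suc.prems(4) by blast
    have "\<not> g constant_on D"
      using w a aD by (metis constant_on_def)
    then obtain k r n' where k: "0 < n'" "0 < r" "ball a r \<subseteq> D" "k holomorphic_on ball a r"
        "\<And>w. w \<in> ball a r \<Longrightarrow> g w = (w - a) ^ n' * k w" "\<And>w. w \<in> ball a r \<Longrightarrow> k w \<noteq> 0"
      using holomorphic_factor_zero_nonconstant[OF disc_algD(2)[OF Suc.prems(1)] open_D conn_D aD a(2)]
      by metis
    \<comment> \<open>Dividing by the full multiplicity removes \<open>a\<close> from the zero set,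
      so the number of distinct zeros drops by one.\<close>
    define g' where "g' = (\<lambda>z. if z = a then k a else g z / (z - a) ^ n')"
    have g'k: "g' z = k z" if "z \<in> ball a r" for z
      using k(5)[OF that] by (auto simp: g'_def)
    have h1: "g' holomorphic_on ball a r"
      using k(4) by (rule holomorphic_transform) (simp add: g'k)
    have "(\<lambda>z. g z / (z - a) ^ n') holomorphic_on (D - {a})"
      using disc_algD(2)[OF Suc.prems(1)] holomorphic_on_subset
      by (intro holomorphic_intros) auto
    then have h2: "g' holomorphic_on (D - {a})"
      by (rule holomorphic_transform) (auto simp: g'_def)
    have "g' holomorphic_on (ball a r \<union> (D - {a}))"
      using h1 h2 open_D by (intro holomorphic_on_Un) auto
    moreover have "ball a r \<union> (D - {a}) = D"
      using k(2,3) aD by auto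
    ultimately have hol: "g' holomorphic_on D" by simp
    have g'A: "g' \<in> disc_alg D"
      by (rule disc_alg_remove_point[OF open_D aD hol Suc.prems(1), of "\<lambda>z. (z - a) ^ n'"])
         (auto simp: g'_def intro!: disc_alg_power disc_alg_diff disc_alg_ident disc_alg_const)
    have gg': "g z = (z - a) ^ n' * g' z" for z
      using k(1) a(2) by (auto simp: g'_def)
    have g'a: "g' a \<noteq> 0" using g'k[of a] k(2,6) by auto
    have Z: "?Z g' = ?Z g - {a}"
      using gg' g'a k(1) by auto
    have "card (?Z g') = n"
      using Suc(2) a Suc.prems(3) Z by (auto simp: card_Diff_singleton)
    moreover have "g' z \<noteq> 0" if "z \<in> frontier D" for z
      using Suc.prems(2)[OF that] gg'[of z] by auto
    moreover have "finite (?Z g')"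
      unfolding Z using Suc.prems(3) by simp
    moreover have "\<not> (\<forall>z\<in>D. g' z = 0)"
      using g'a aD by blast
    ultimately obtain s g1 where IH: "s \<noteq> 0" "\<forall>z. poly s z = 0 \<longrightarrow> z \<in> D" "g1 \<in> disc_alg D"
      "\<forall>z\<in>closure D. g1 z \<noteq> 0" "\<forall>z\<in>closure D. g' z = poly s z * g1 z"
      using Suc(1)[OF _ g'A] by blast
    show ?case
    proof (intro exI[of _ "[:-a, 1:] ^ n' * s"] exI[of _ g1] conjI allI ballI impI)
      show "[:- a, 1:] ^ n' * s \<noteq> 0" using IH(1) by simp
      show "z \<in> D" if "poly ([:- a, 1:] ^ n' * s) z = 0" for z
        using that IH(2) aD by auto
      show "g z = poly ([:- a, 1:] ^ n' * s) z * g1 z" if "z \<in> closure D" for z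
        using gg'[of z] IH(5) that by (simp add: algebra_simps)
    qed (use IH in auto)
  qed
  then show ?thesis using that by blast
qed

text \<open>The winding number counts zeros: after factoring, the polynomial contributes its degree
  and the nowhere zero factor contributes 0.\<close>

lemma argument_principle_disc_alg:
  assumes "g \<in> disc_alg D" "\<And>z. z \<in> frontier D \<Longrightarrow> g z \<noteq> 0"
  shows "bdry_winding m \<gamma> g \<ge> 0"
proof -
  obtain s g1 where s: "s \<noteq> 0" "\<And>z. poly s z = 0 \<Longrightarrow> z \<in> D" "g1 \<in> disc_alg D"
    "\<And>z. z \<in> closure D \<Longrightarrow> g1 z \<noteq> 0" "\<And>z. z \<in> closure D \<Longrightarrow> g z = poly s z * g1 z"
    using zeros_factor[OF assms] by blast
  have i: "inv_on_frontier (poly s)" "inv_on_frontier g1"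
    using s D_frontier_disj frontier_in_closure by (auto intro!: inv_on_frontier_disc_alg disc_alg_poly)
  have "bdry_winding m \<gamma> g = bdry_winding m \<gamma> (\<lambda>z. poly s z * g1 z)"
    using s(5) frontier_in_closure by (intro bdry_winding_cong) auto
  also have "\<dots> = degree s"
    using bdry_winding_mult[OF i] bdry_winding_poly[OF s(1,2)] bdry_winding_nonvanishing[OF disc_algD(1)[OF s(3)] s(4)]
    by simp
  finally show ?thesis by simp
qed

lemma disc_alg_exp_representation:
  assumes "g \<in> disc_alg D" "\<And>z. z \<in> closure D \<Longrightarrow> g z \<noteq> 0"
  obtains q k where "q \<in> disc_alg D"
    "\<And>z. z \<in> closure D \<Longrightarrow> g z = exp (q z) * (\<Prod>j\<in>holes. (z - ctr j) powi (k j))"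
proof -
  obtain q k where q: "continuous_on (closure D) q"
    "\<And>z. z \<in> closure D \<Longrightarrow> g z = exp (q z) * (\<Prod>j\<in>holes. (z - ctr j) powi (k j))"
    using exp_representation[OF disc_algD(1)[OF assms(1)] assms(2)] by blast
  let ?p = "\<lambda>z. \<Prod>j\<in>holes. (z - ctr j) powi (k j)"
  have pA: "?p \<in> disc_alg D"
    using ctr_notin by (intro disc_alg_prod disc_alg_powi disc_alg_diff disc_alg_ident disc_alg_const) auto
  have pne: "?p z \<noteq> 0" if "z \<in> closure D" for z
    using that ctr_notin by (auto simp: power_int_eq_0_iff)
  have eq: "g z / ?p z = exp (q z)" if "z \<in> closure D" for z
    using q(2)[OF that] pne[OF that] by simp
  have "(\<lambda>z. g z / ?p z) \<in> disc_alg D"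
    using pne by (rule disc_alg_divide[OF assms(1) pA])
  then have "(\<lambda>z. exp (q z)) \<in> disc_alg D"
    by (rule disc_alg_cong) (rule eq)
  then have "(\<lambda>z. exp (q z)) holomorphic_on D"
    by (rule disc_algD)
  moreover have "continuous_on D q"
    using continuous_on_subset[OF q(1) closure_subset] .
  ultimately have "q holomorphic_on D"
    using holomorphic_on_continuous_log[OF open_D] by blast
  then show ?thesis
    using that[of q k] q by (auto simp: disc_alg_def)
qed

end

section \<open>Logarithmic kernels as boundary values\<close>

lemma abs_ln_diff_le:
  fixes x y s :: real
  assumes "x > 0" "\<bar>y - x\<bar> \<le> s" "2 * s \<le> x"
  shows "\<bar>ln y - ln x\<bar> \<le> 2 * s / x"
proof -
  have s: "0 \<le> s" using assms(2) by auto
  have y: "y > 0" using assms by linarith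
  have "ln y - ln x \<le> 2 * s / x"
  proof -
    have "ln (y / x) \<le> y / x - 1"
      using assms(1) y by (intro ln_le_minus_one) auto
    also have "\<dots> = (y - x) / x"
      using assms(1) by (simp add: diff_divide_distrib)
    also have "\<dots> \<le> 2 * s / x"
      using assms s by (intro divide_right_mono) auto
    finally show ?thesis using assms(1) y by (simp add: ln_div)
  qed
  moreover have "ln x - ln y \<le> 2 * s / x"
  proof -
    have "ln (x / y) \<le> x / y - 1"
      using assms(1) y by (intro ln_le_minus_one) auto
    also have "\<dots> = (x - y) / y"
      using y by (simp add: diff_divide_distrib)
    also have "\<dots> \<le> s / y"
      using assms y by (intro divide_right_mono) auto
    also have "\<dots> \<le> s / (x / 2)"
      using assms s y by (intro divide_left_mono) auto
    finally show ?thesis using assms(1) y by (simp add: ln_div mult.commute)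
  qed
  ultimately show ?thesis by linarith
qed

lemma ln_fact_ge: "real n * ln (real n) - real n \<le> ln (fact n)"
proof (induction n)
  case (Suc n)
  show ?case
  proof (cases "n = 0")
    case False
    have "ln ((real n + 1) / real n) \<le> (real n + 1) / real n - 1"
      using False by (intro ln_le_minus_one) auto
    also have "\<dots> = 1 / real n"
      using False by (simp add: field_simps)
    finally have "real n * (ln (real n + 1) - ln (real n)) \<le> 1"
      using False by (simp add: ln_div field_simps)
    moreover have "ln (fact (Suc n)) = ln (real n + 1) + ln (fact n)"
      by (simp add: ln_mult add.commute)
    ultimately show ?thesis
      using Suc by (simp add: algebra_simps)
  qed simp
qed simp

text \<open>On either side of \<open>k0\<close> the distances run through an initial segment of 1,
  2, and so on. Each side contributes at least -3 * n: one n is lost in \<open>ln_fact_ge\<close>,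
  and 2 * ln 2 < 2 accounts for the factor 4.\<close>

lemma sum_ln_dist_ge:
  assumes "k0 \<in> {1..n}"
  shows "(\<Sum>k\<in>{1..n} - {k0}. ln (\<bar>real k - real k0\<bar> / (4 * real n))) \<ge> - 6 * real n"
proof -
  define G where "G = (\<lambda>j::nat. ln (real j / (4 * real n)))"
  have n: "n > 0" using assms by auto
  have G0: "G j \<le> 0" if "j \<in> {1..n}" for j
    using that n by (auto simp: G_def)
  have "(\<Sum>j\<in>{1..n}. G j) = (\<Sum>j\<in>{1..n}. ln (real j)) - n * ln (4 * n)"
    using n by (simp add: G_def ln_div sum_subtractf)
  also have "(\<Sum>j\<in>{1..n}. ln (real j)) = ln (fact n)"
    by (subst ln_prod[symmetric]) (auto simp: fact_prod)
  also have "n * ln (4 * n) = n * ln n + n * (2 * ln 2)"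
    using n ln_mult[of 2 2] by (simp add: ln_mult algebra_simps)
  finally have "(\<Sum>j\<in>{1..n}. G j) \<ge> - real n - n * (2 * ln 2)"
    using ln_fact_ge[of n] by linarith
  moreover have "real n * (2 * ln 2) \<le> real n * 2"
    using ln_2_less_1 by (intro mult_left_mono) auto
  ultimately have sG: "(\<Sum>j\<in>{1..n}. G j) \<ge> - 3 * real n"
    by linarith
  have sub: "(\<Sum>j\<in>S. G j) \<ge> - 3 * real n" if "S \<subseteq> {1..n}" for S
  proof -
    have "(\<Sum>j\<in>S. - G j) \<le> (\<Sum>j\<in>{1..n}. - G j)"
      using that G0 by (intro sum_mono2) auto
    then show ?thesis using sG by (simp add: sum_negf)
  qed
  have split: "{1..n} - {k0} = {1..<k0} \<union> {k0<..n}"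
    using assms by auto
  have "(\<Sum>k\<in>{1..n} - {k0}. ln (\<bar>real k - real k0\<bar> / (4 * real n)))
      = (\<Sum>k\<in>{1..<k0}. ln (\<bar>real k - real k0\<bar> / (4 * real n)))
        + (\<Sum>k\<in>{k0<..n}. ln (\<bar>real k - real k0\<bar> / (4 * real n)))"
    unfolding split by (rule sum.union_disjoint) auto
  also have "(\<Sum>k\<in>{1..<k0}. ln (\<bar>real k - real k0\<bar> / (4 * real n))) = (\<Sum>j\<in>{1..<k0}. G j)"
    by (rule sum.reindex_bij_witness[of _ "\<lambda>j. k0 - j" "\<lambda>k. k0 - k"]) (auto simp: G_def of_nat_diff)
  also have "(\<Sum>k\<in>{k0<..n}. ln (\<bar>real k - real k0\<bar> / (4 * real n))) = (\<Sum>j\<in>{1..n - k0}. G j)"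
    by (rule sum.reindex_bij_witness[of _ "\<lambda>j. j + k0" "\<lambda>k. k - k0"]) (auto simp: G_def of_nat_diff)
  finally show ?thesis
    using sub[of "{1..<k0}"] sub[of "{1..n-k0}"] assms by fastforce
qed

text \<open>Averaging the logarithm over points on many circles around \<open>b\<close> smooths its singularity:
  at most one of the points is too close to the argument, and its weight is only \<open>1 / n\<close>.\<close>

lemma mean_ln_bounds:
  fixes a :: "nat \<Rightarrow> real"
  assumes n: "n > 0" "\<bar>ln \<eta> - ln \<delta>\<bar> \<le> real n" and pos: "\<delta> > 0" "\<eta> > 0" "x \<ge> 0"
    and r: "\<And>k. r k = \<delta> / 2 + real k * \<delta> / (2 * real n)"
    and a: "\<And>k. k \<in> {1..n} \<Longrightarrow> \<bar>x - r k\<bar> \<le> a k" "\<And>k. k \<in> {1..n} \<Longrightarrow> a k \<le> x + r k"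
      "\<And>k. k \<in> {1..n} \<Longrightarrow> \<eta> \<le> a k"
  shows "x \<le> 2 * \<delta> \<Longrightarrow> \<bar>(\<Sum>k\<in>{1..n}. ln (a k)) / n - ln \<delta>\<bar> \<le> 7"
    and "2 * \<delta> \<le> x \<Longrightarrow> \<bar>(\<Sum>k\<in>{1..n}. ln (a k)) / n - ln x\<bar> \<le> 2 * \<delta> / x"
proof -
  have apos: "a k > 0" if "k \<in> {1..n}" for k
    using a(3)[OF that] pos by linarith
  have r\<delta>: "0 \<le> r k" "r k \<le> \<delta>" if "k \<in> {1..n}" for k
    using that pos n by (auto simp: r field_simps)
  have card: "(\<Sum>k\<in>{1..n}. c) = real n * c" for c :: real
    by simp
  {
    assume x: "2 * \<delta> \<le> x"
    have "\<bar>ln (a k) - ln x\<bar> \<le> 2 * \<delta> / x" if "k \<in> {1..n}" for k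
      using a(1,2)[OF that] r\<delta>[OF that] x pos by (intro abs_ln_diff_le) auto
    then have "\<bar>\<Sum>k\<in>{1..n}. ln (a k) - ln x\<bar> \<le> (\<Sum>k\<in>{1..n}. 2 * \<delta> / x)"
      by (intro order_trans[OF sum_abs] sum_mono)
    also have "\<dots> = n * (2 * \<delta> / x)"
      by simp
    finally have "\<bar>(\<Sum>k\<in>{1..n}. ln (a k)) - n * ln x\<bar> \<le> n * (2 * \<delta> / x)"
      by (simp add: sum_subtractf)
    moreover have "(\<Sum>k\<in>{1..n}. ln (a k)) / n - ln x = ((\<Sum>k\<in>{1..n}. ln (a k)) - n * ln x) / n"
      using n by (simp add: field_simps)
    ultimately show "\<bar>(\<Sum>k\<in>{1..n}. ln (a k)) / n - ln x\<bar> \<le> 2 * \<delta> / x"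
      using n by (simp add: abs_divide divide_le_eq mult.commute)
  }
  {
    assume x: "x \<le> 2 * \<delta>"
    have "(\<Sum>k\<in>{1..n}. ln (a k)) \<le> (\<Sum>k\<in>{1..n}. ln \<delta> + 2)"
    proof (rule sum_mono)
      fix k assume k: "k \<in> {1..n}"
      have "ln (a k) \<le> ln (3 * \<delta>)"
        using a(2)[OF k] r\<delta>[OF k] x apos[OF k] by (subst ln_le_cancel_iff) auto
      also have "\<dots> = ln 3 + ln \<delta>"
        using pos by (simp add: ln_mult)
      also have "ln (3::real) \<le> 3 - 1"
        by (rule ln_le_minus_one) auto
      finally show "ln (a k) \<le> ln \<delta> + 2" by simp
    qed
    also have "\<dots> = n * (ln \<delta> + 2)" by simp
    finally have upper: "(\<Sum>k\<in>{1..n}. ln (a k)) \<le> n * (ln \<delta> + 2)" .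
    \<comment> \<open>The circle nearest to \<open>x\<close> is the only one without a good lower
      bound. For the others, minimality makes the distance at least half the difference of the
      radii, which is a multiple of the index difference.\<close>
    define k0 where "k0 = arg_min_on (\<lambda>k. \<bar>x - r k\<bar>) {1..n}"
    have k0: "k0 \<in> {1..n}" "\<And>k. k \<in> {1..n} \<Longrightarrow> \<bar>x - r k0\<bar> \<le> \<bar>x - r k\<bar>"
      using arg_min_if_finite[of "{1..n}" "\<lambda>k. \<bar>x - r k\<bar>"] n unfolding k0_def by (auto simp: not_less)
    have far: "ln \<delta> + ln (\<bar>real k - real k0\<bar> / (4 * n)) \<le> ln (a k)" if k: "k \<in> {1..n} - {k0}" for k
    proof -
      have "r k - r k0 = (real k - real k0) * (\<delta> / (2 * n))"
        using n(1) by (simp add: r divide_simps) (simp add: algebra_simps)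
      then have "\<bar>real k - real k0\<bar> * (\<delta> / (2 * n)) = \<bar>r k - r k0\<bar>"
        using pos by (simp add: abs_mult)
      also have "\<dots> \<le> 2 * \<bar>x - r k\<bar>"
      proof -
        have "\<bar>x - r k0\<bar> \<le> \<bar>x - r k\<bar>" using k0(2)[of k] k by blast
        then have "\<bar>x - r k0\<bar> + \<bar>x - r k\<bar> \<le> 2 * \<bar>x - r k\<bar>"
          by (simp only: mult_2 add_right_mono)
        moreover have "\<bar>r k - r k0\<bar> \<le> \<bar>x - r k0\<bar> + \<bar>x - r k\<bar>"
          using abs_triangle_ineq4[of "x - r k0" "x - r k"] by simp
        ultimately show ?thesis by (rule order_trans[rotated])
      qed
      also have "\<dots> \<le> 2 * a k"
        using a(1)[of k] k by auto
      finally have "\<delta> * (\<bar>real k - real k0\<bar> / (4 * n)) \<le> a k"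
        by (simp add: field_simps)
      moreover have "\<bar>real k - real k0\<bar> > 0" using k by auto
      ultimately have "ln (\<delta> * (\<bar>real k - real k0\<bar> / (4 * n))) \<le> ln (a k)"
        using pos n apos[of k] k by (subst ln_le_cancel_iff) auto
      then show ?thesis
        using pos n \<open>\<bar>real k - real k0\<bar> > 0\<close> by (subst (asm) ln_mult) auto
    qed
    have s1: "(\<Sum>k\<in>{1..n}. ln (a k)) = ln (a k0) + (\<Sum>k\<in>{1..n} - {k0}. ln (a k))"
      using k0(1) by (intro sum.remove) auto
    have s2: "ln \<eta> \<le> ln (a k0)"
      using a(3)[OF k0(1)] pos apos[OF k0(1)] by simp
    have s3: "(\<Sum>k\<in>{1..n} - {k0}. ln \<delta> + ln (\<bar>real k - real k0\<bar> / (4 * n))) \<le> (\<Sum>k\<in>{1..n} - {k0}. ln (a k))"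
      using far by (intro sum_mono) auto
    have s4: "(\<Sum>k\<in>{1..n} - {k0}. ln \<delta> + ln (\<bar>real k - real k0\<bar> / (4 * n)))
        = (n - 1) * ln \<delta> + (\<Sum>k\<in>{1..n} - {k0}. ln (\<bar>real k - real k0\<bar> / (4 * n)))"
      using k0(1) by (simp add: sum.distrib card_Diff_singleton)
    have s5: "(\<Sum>k\<in>{1..n} - {k0}. ln (\<bar>real k - real k0\<bar> / (4 * n))) \<ge> - 6 * real n"
      using sum_ln_dist_ge[OF k0(1)] by simp
    have "(\<Sum>k\<in>{1..n}. ln (a k)) \<ge> ln \<eta> + ((n - 1) * ln \<delta> - 6 * real n)"
      using s1 s2 s3 s4 s5 by linarith
    moreover have "(real n - 1) * ln \<delta> = n * ln \<delta> - ln \<delta>"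
      by (simp add: algebra_simps)
    moreover have "real (n - 1) = real n - 1"
      using n by auto
    \<comment> \<open>The constant 7 is 6 from the logarithmic sum plus 1 from the index
      \<open>k0\<close>, whose lower bound \<open>ln \<eta>\<close> lies within n of
      \<open>ln \<delta>\<close>.\<close>
    ultimately have "(\<Sum>k\<in>{1..n}. ln (a k)) \<ge> n * ln \<delta> - 7 * real n"
      using n(2) by auto
    then have "n * (ln \<delta> - 7) \<le> (\<Sum>k\<in>{1..n}. ln (a k))"
      by (simp add: algebra_simps)
    then have "ln \<delta> - 7 \<le> (\<Sum>k\<in>{1..n}. ln (a k)) / n"
      using n by (simp add: le_divide_eq mult.commute)
    moreover have "(\<Sum>k\<in>{1..n}. ln (a k)) / n \<le> ln \<delta> + 2"
      using n upper by (simp add: divide_le_eq mult.commute)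
    ultimately show "\<bar>(\<Sum>k\<in>{1..n}. ln (a k)) / n - ln \<delta>\<bar> \<le> 7"
      by linarith
  }
qed

section \<open>Uniform closure of real parts and logarithms on the frontier\<close>

context jordan_domain
begin

definition lcomb :: "(complex \<Rightarrow> complex) \<Rightarrow> (nat \<Rightarrow> real) \<Rightarrow> complex \<Rightarrow> real" where
  "lcomb q t z = Re (q z) + (\<Sum>j\<in>holes. t j * ln (cmod (z - ctr j)))"

text \<open>The goal is \<open>log_closure_continuous\<close>: every function continuous on the
  frontier lies here. The logarithms supply the periods of harmonic conjugates around the holes;
  their coefficients may change with \<epsilon>.\<close>

definition log_closure :: "(complex \<Rightarrow> real) set" where
  "log_closure = {u. \<forall>\<epsilon>>0. \<exists>q\<in>disc_alg D. \<exists>t. \<forall>z\<in>frontier D. \<bar>u z - lcomb q t z\<bar> \<le> \<epsilon>}"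

lemma log_closure_limit:
  assumes "\<And>\<epsilon>. \<epsilon> > 0 \<Longrightarrow> \<exists>v\<in>log_closure. \<forall>z\<in>frontier D. \<bar>u z - v z\<bar> \<le> \<epsilon>"
  shows "u \<in> log_closure"
  unfolding log_closure_def
proof (intro CollectI allI impI)
  fix \<epsilon> :: real assume "\<epsilon> > 0"
  then obtain v where v: "v \<in> log_closure" "\<forall>z\<in>frontier D. \<bar>u z - v z\<bar> \<le> \<epsilon> / 2"
    using assms[of "\<epsilon> / 2"] by auto
  obtain q t where q: "q \<in> disc_alg D" "\<forall>z\<in>frontier D. \<bar>v z - lcomb q t z\<bar> \<le> \<epsilon> / 2"
    using v(1) half_gt_zero[OF \<open>\<epsilon> > 0\<close>] unfolding log_closure_def by blast
  have "\<bar>u z - lcomb q t z\<bar> \<le> \<epsilon>" if "z \<in> frontier D" for z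
    using bspec[OF v(2) that] bspec[OF q(2) that] by linarith
  then show "\<exists>q\<in>disc_alg D. \<exists>t. \<forall>z\<in>frontier D. \<bar>u z - lcomb q t z\<bar> \<le> \<epsilon>"
    using q(1) by blast
qed

lemma log_closure_exact:
  assumes "q \<in> disc_alg D" "\<And>z. z \<in> frontier D \<Longrightarrow> u z = lcomb q t z"
  shows "u \<in> log_closure"
proof -
  have "\<forall>z\<in>frontier D. \<bar>u z - lcomb q t z\<bar> \<le> \<epsilon>" if "\<epsilon> > 0" for \<epsilon>
    using assms(2) that by simp
  then show ?thesis
    unfolding log_closure_def using assms(1) by blast
qed

lemma log_closure_add:
  assumes "u \<in> log_closure" "v \<in> log_closure"
  shows "(\<lambda>z. u z + v z) \<in> log_closure"
  unfolding log_closure_def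
proof (intro CollectI allI impI)
  fix \<epsilon> :: real assume "\<epsilon> > 0"
  then have e: "\<epsilon> / 2 > 0" by simp
  obtain q t where q: "q \<in> disc_alg D" "\<forall>z\<in>frontier D. \<bar>u z - lcomb q t z\<bar> \<le> \<epsilon> / 2"
    using assms(1) e unfolding log_closure_def by blast
  obtain q' t' where q': "q' \<in> disc_alg D" "\<forall>z\<in>frontier D. \<bar>v z - lcomb q' t' z\<bar> \<le> \<epsilon> / 2"
    using assms(2) e unfolding log_closure_def by blast
  have "\<bar>u z + v z - lcomb (\<lambda>z. q z + q' z) (\<lambda>j. t j + t' j) z\<bar> \<le> \<epsilon>" if "z \<in> frontier D" for z
  proof -
    have "lcomb (\<lambda>z. q z + q' z) (\<lambda>j. t j + t' j) z = lcomb q t z + lcomb q' t' z"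
      by (simp add: lcomb_def distrib_right sum.distrib)
    then show ?thesis
      using bspec[OF q(2) that] bspec[OF q'(2) that] by linarith
  qed
  then show "\<exists>q\<in>disc_alg D. \<exists>t. \<forall>z\<in>frontier D. \<bar>u z + v z - lcomb q t z\<bar> \<le> \<epsilon>"
    using disc_alg_add[OF q(1) q'(1)] by blast
qed

lemma log_closure_scale:
  assumes "u \<in> log_closure"
  shows "(\<lambda>z. c * u z) \<in> log_closure"
  unfolding log_closure_def
proof (intro CollectI allI impI)
  fix \<epsilon> :: real assume "\<epsilon> > 0"
  then have e: "\<epsilon> / (\<bar>c\<bar> + 1) > 0" by (simp add: add_nonneg_pos)
  obtain q t where q: "q \<in> disc_alg D" "\<forall>z\<in>frontier D. \<bar>u z - lcomb q t z\<bar> \<le> \<epsilon> / (\<bar>c\<bar> + 1)"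
    using assms(1) e unfolding log_closure_def by blast
  have "\<bar>c * u z - lcomb (\<lambda>z. of_real c * q z) (\<lambda>j. c * t j) z\<bar> \<le> \<epsilon>" if "z \<in> frontier D" for z
  proof -
    have "c * u z - lcomb (\<lambda>z. of_real c * q z) (\<lambda>j. c * t j) z = c * (u z - lcomb q t z)"
      by (simp add: lcomb_def algebra_simps sum_distrib_left)
    then have "\<bar>c * u z - lcomb (\<lambda>z. of_real c * q z) (\<lambda>j. c * t j) z\<bar> = \<bar>c\<bar> * \<bar>u z - lcomb q t z\<bar>"
      by (simp add: abs_mult)
    also have "\<dots> \<le> (\<bar>c\<bar> + 1) * (\<epsilon> / (\<bar>c\<bar> + 1))"
      using bspec[OF q(2) that] by (intro mult_mono) auto
    also have "\<dots> = \<epsilon>" by (simp add: add_nonneg_pos)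
    finally show ?thesis .
  qed
  then show "\<exists>q\<in>disc_alg D. \<exists>t. \<forall>z\<in>frontier D. \<bar>c * u z - lcomb q t z\<bar> \<le> \<epsilon>"
    using disc_alg_mult[OF disc_alg_const q(1)] by blast
qed

lemma log_closure_const: "(\<lambda>z. c) \<in> log_closure"
  by (rule log_closure_exact[of "\<lambda>z. of_real c" _ "\<lambda>j. 0"]) (auto simp: lcomb_def disc_alg_const)

lemma log_closure_diff: "u \<in> log_closure \<Longrightarrow> v \<in> log_closure \<Longrightarrow> (\<lambda>z. u z - v z) \<in> log_closure"
  using log_closure_add[of u "\<lambda>z. (-1) * v z"] log_closure_scale[of v "-1"] by simp

lemma log_closure_sum: "(\<And>i. i \<in> I \<Longrightarrow> u i \<in> log_closure) \<Longrightarrow> (\<lambda>z. \<Sum>i\<in>I. u i z) \<in> log_closure"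
  by (induction I rule: infinite_finite_induct) (auto simp: log_closure_const intro!: log_closure_add)

text \<open>Taking moduli in the exponential representation of the nowhere zero function
  \<open>z - c\<close> gives an exact combination, with the exponents as coefficients.\<close>

lemma log_closure_ln_outside:
  assumes "c \<notin> closure D"
  shows "(\<lambda>z. ln (cmod (z - c))) \<in> log_closure"
proof -
  have ne: "z - c \<noteq> 0" if "z \<in> closure D" for z
    using that assms by auto
  obtain q k where q: "q \<in> disc_alg D"
    "\<And>z. z \<in> closure D \<Longrightarrow> z - c = exp (q z) * (\<Prod>j\<in>holes. (z - ctr j) powi (k j))"
    using disc_alg_exp_representation[OF disc_alg_diff[OF disc_alg_ident disc_alg_const] ne] by blast
  show ?thesis
  proof (rule log_closure_exact[OF q(1), where t="\<lambda>j. of_int (k j)"])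
    fix z assume z: "z \<in> frontier D"
    have pos: "cmod (z - ctr j) > 0" if "j \<in> holes" for j
      using ctr_notin[OF that] frontier_in_closure[OF z] by auto
    have "cmod (z - c) = exp (Re (q z)) * (\<Prod>j\<in>holes. cmod (z - ctr j) powi (k j))"
      using q(2)[OF frontier_in_closure[OF z]] by (simp add: norm_mult norm_power_int prod_norm[symmetric])
    also have "ln \<dots> = Re (q z) + (\<Sum>j\<in>holes. ln (cmod (z - ctr j) powi (k j)))"
      using pos by (subst ln_mult) (auto intro!: prod_pos simp: ln_prod)
    also have "(\<Sum>j\<in>holes. ln (cmod (z - ctr j) powi (k j))) = (\<Sum>j\<in>holes. of_int (k j) * ln (cmod (z - ctr j)))"
    proof (rule sum.cong[OF refl])
      fix j assume j: "j \<in> holes"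
      have "cmod (z - ctr j) powi (k j) = cmod (z - ctr j) powr (of_int (k j))"
        using pos[OF j] by (simp add: powr_real_of_int')
      then show "ln (cmod (z - ctr j) powi (k j)) = of_int (k j) * ln (cmod (z - ctr j))"
        by (simp add: ln_powr)
    qed
    finally show "ln (cmod (z - c)) = lcomb q (\<lambda>j. of_int (k j)) z"
      by (simp add: lcomb_def)
  qed
qed

text \<open>This plays the role of a barrier at the frontier point \<open>b\<close>. The component
  \<open>side j\<close> is connected, accumulates at \<open>b\<close> and reaches distance
  \<open>r0\<close>, so a path in it crosses every circle around \<open>b\<close> with radius
  between \<delta> / 2 and \<delta>. The crossing points are the centres over which the logarithm is
  averaged.\<close>

lemma smoothed_ln_exists:
  obtains r0 :: real where "r0 > 0" "\<And>b \<delta>. b \<in> frontier D \<Longrightarrow> 0 < \<delta> \<Longrightarrow> \<delta> < r0 \<Longrightarrow>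
    \<exists>v\<in>log_closure. \<forall>z\<in>frontier D. (cmod (z - b) \<le> 2 * \<delta> \<longrightarrow> \<bar>v z - ln \<delta>\<bar> \<le> 7) \<and>
       (2 * \<delta> \<le> cmod (z - b) \<longrightarrow> \<bar>v z - ln (cmod (z - b))\<bar> \<le> 2 * \<delta> / cmod (z - b))"
proof -
  have "\<exists>c c'. c \<in> side j \<and> c' \<in> side j \<and> c \<noteq> c'" if "j < m" for j
  proof -
    obtain c where c: "c \<in> side j" using side_facts(3)[OF \<open>j < m\<close>] by blast
    then obtain e where e: "e > 0" "cball c e \<subseteq> side j"
      using side_facts(1)[OF \<open>j < m\<close>] open_contains_cball by blast
    have "c + of_real e \<in> cball c e" using e(1) by (simp add: dist_norm)
    then show ?thesis using c e by (intro exI[of _ c] exI[of _ "c + of_real e"]) auto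
  qed
  then obtain c c' where c: "\<And>j. j < m \<Longrightarrow> c j \<in> side j" "\<And>j. j < m \<Longrightarrow> c' j \<in> side j"
    "\<And>j. j < m \<Longrightarrow> c j \<noteq> c' j"
    by metis
  \<comment> \<open>Of two points at distance at least 2 * \<open>r0\<close> one has distance at
    least \<open>r0\<close> from \<open>b\<close>, so this radius can be fixed before
    \<open>b\<close>.\<close>
  define r0 where "r0 = Min ((\<lambda>j. cmod (c j - c' j) / 2) ` {..<m})"
  have m: "{..<m} \<noteq> {}" using outer(1) by auto
  have r0: "r0 > 0" unfolding r0_def using m c(3) by (subst Min_gr_iff) auto
  have r0le: "2 * r0 \<le> cmod (c j - c' j)" if "j < m" for j
  proof -
    have "r0 \<le> cmod (c j - c' j) / 2"
      unfolding r0_def using that by (intro Min_le) auto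
    then show ?thesis by simp
  qed
  show ?thesis
  proof (rule that[OF r0])
    fix b \<delta> assume b: "b \<in> frontier D" and \<delta>: "0 < \<delta>" "\<delta> < r0"
    obtain j where j: "j < m" "b \<in> path_image (\<gamma> j)"
      using b frontier_eq by auto
    have sj: "open (side j)" "connected (side j)" "frontier (side j) = path_image (\<gamma> j)" "side j \<inter> closure D = {}"
      using side_facts[OF j(1)] by auto
    obtain y where y: "y \<in> side j" "r0 \<le> cmod (y - b)"
    proof (cases "r0 \<le> cmod (c j - b)")
      case True
      then show ?thesis using that c(1)[OF j(1)] by blast
    next
      case False
      have "cmod (c j - c' j) \<le> cmod (c j - b) + cmod (c' j - b)"
        using norm_triangle_ineq4[of "c j - b" "c' j - b"] by simp
      then have "r0 \<le> cmod (c' j - b)"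
        using r0le[OF j(1)] False by linarith
      then show ?thesis using that c(2)[OF j(1)] by blast
    qed
    have "b \<in> closure (side j)"
      using j(2) sj(3) by (auto simp: frontier_def)
    then obtain x where x: "x \<in> side j" "dist x b < \<delta> / 4"
      using \<delta> closure_approachable[of b "side j"] by (meson zero_less_divide_iff zero_less_numeral)
    have "path_connected (side j)"
      using sj by (simp add: connected_open_path_connected)
    then obtain p where p: "path p" "path_image p \<subseteq> side j" "pathstart p = x" "pathfinish p = y"
      using x(1) y(1) unfolding path_connected_def by blast
    have ptr: "\<exists>c\<in>path_image p. cmod (c - b) = r" if r: "\<delta> / 2 \<le> r" "r \<le> \<delta>" for r
    proof -
      have "continuous_on {0..1} (\<lambda>t. cmod (p t - b))"
        using p(1) by (auto simp: path_def intro!: continuous_intros)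
      moreover have "cmod (p 0 - b) \<le> r"
        using x p(3) r \<delta> by (auto simp: pathstart_def dist_norm)
      moreover have "r \<le> cmod (p 1 - b)"
        using y p(4) r \<delta> by (auto simp: pathfinish_def)
      ultimately obtain t where "t \<in> {0..1}" "cmod (p t - b) = r"
        using IVT'[of "\<lambda>t. cmod (p t - b)" 0 r 1] by auto
      then show ?thesis by (auto simp: path_image_def)
    qed
    have "path_image p \<inter> closure D = {}"
      using p(2) sj(4) by blast
    then obtain \<eta> where \<eta>: "\<eta> > 0" "\<And>c z. c \<in> path_image p \<Longrightarrow> z \<in> closure D \<Longrightarrow> \<eta> \<le> dist c z"
      using separate_compact_closed[OF compact_path_image[OF p(1)] closed_closure, of D] by blast
    \<comment> \<open>The distance \<eta> of the path from the closure is not controlled by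
      \<delta>; enough centres keep the contribution of the single bad term to the mean
      bounded.\<close>
    obtain n0 :: nat where n0: "\<bar>ln \<eta> - ln \<delta>\<bar> \<le> real n0"
      using real_arch_simple by blast
    define n where "n = Suc n0"
    have n: "n > 0" "\<bar>ln \<eta> - ln \<delta>\<bar> \<le> real n"
      using n0 by (auto simp: n_def)
    define r where "r = (\<lambda>k::nat. \<delta> / 2 + real k * \<delta> / (2 * real n))"
    have "\<exists>c\<in>path_image p. cmod (c - b) = r k" if "k \<in> {1..n}" for k
      using that \<delta>(1) n(1) by (intro ptr) (auto simp: r_def field_simps)
    then obtain c where c: "\<And>k. k \<in> {1..n} \<Longrightarrow> c k \<in> path_image p" "\<And>k. k \<in> {1..n} \<Longrightarrow> cmod (c k - b) = r k"
      by metis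
    define v where "v = (\<lambda>z. (\<Sum>k\<in>{1..n}. ln (cmod (z - c k))) / n)"
    show "\<exists>v\<in>log_closure. \<forall>z\<in>frontier D. (cmod (z - b) \<le> 2 * \<delta> \<longrightarrow> \<bar>v z - ln \<delta>\<bar> \<le> 7) \<and>
       (2 * \<delta> \<le> cmod (z - b) \<longrightarrow> \<bar>v z - ln (cmod (z - b))\<bar> \<le> 2 * \<delta> / cmod (z - b))"
    proof (intro bexI[of _ v] ballI)
      have "c k \<notin> closure D" if "k \<in> {1..n}" for k
        using c(1)[OF that] p(2) sj(4) by blast
      then have "(\<lambda>z. \<Sum>k\<in>{1..n}. ln (cmod (z - c k))) \<in> log_closure"
        by (intro log_closure_sum log_closure_ln_outside) auto
      from log_closure_scale[OF this, of "1 / n"] show "v \<in> log_closure"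
        by (simp add: v_def)
    next
      fix z assume z: "z \<in> frontier D"
      have 1: "\<bar>cmod (z - b) - r k\<bar> \<le> cmod (z - c k)" if "k \<in> {1..n}" for k
        using norm_triangle_ineq3[of "z - b" "c k - b"] c(2)[OF that] by simp
      have 2: "cmod (z - c k) \<le> cmod (z - b) + r k" if "k \<in> {1..n}" for k
        using norm_triangle_ineq4[of "z - b" "c k - b"] c(2)[OF that] by simp
      have 3: "\<eta> \<le> cmod (z - c k)" if "k \<in> {1..n}" for k
        using \<eta>(2)[OF c(1)[OF that] frontier_in_closure[OF z]] by (simp add: dist_norm norm_minus_commute)
      show "(cmod (z - b) \<le> 2 * \<delta> \<longrightarrow> \<bar>v z - ln \<delta>\<bar> \<le> 7) \<and>
       (2 * \<delta> \<le> cmod (z - b) \<longrightarrow> \<bar>v z - ln (cmod (z - b))\<bar> \<le> 2 * \<delta> / cmod (z - b))"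
        unfolding v_def using mean_ln_bounds[where r=r and x="cmod (z - b)" and a="\<lambda>k. cmod (z - c k)",
            OF n \<delta>(1) \<eta>(1) norm_ge_zero _ 1 2 3] by (simp add: r_def)
    qed
  qed
qed

end

section \<open>Means over equidistant points of a circle and a discrete maximum principle\<close>

lemma prod_diff_roots_of_unity:
  assumes "n > 0"
  shows "(\<Prod>k<n. x - \<rho> * cis (2 * pi * real k / real n)) = x ^ n - \<rho> ^ n"
proof (cases "\<rho> = 0")
  case False
  define p :: "complex poly" where "p = monom 1 n - 1"
  have lc: "coeff p n = 1" using assms by (simp add: p_def)
  have deg: "degree p = n"
  proof (rule antisym)
    show "degree p \<le> n" unfolding p_def by (rule degree_diff_le) (auto simp: degree_monom_le)
    show "n \<le> degree p" using lc by (intro le_degree) simp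
  qed
  have roots: "poly p z = 0 \<longleftrightarrow> z ^ n = 1" for z
    by (simp add: p_def poly_monom)
  have "rsquarefree p"
    unfolding rsquarefree_roots
  proof (intro allI notI)
    fix a assume a: "poly p a = 0 \<and> poly (pderiv p) a = 0"
    then have "of_nat n * a ^ (n - 1) = 0"
      by (simp add: p_def pderiv_diff pderiv_monom poly_monom)
    then have "a = 0" using assms by auto
    then show False using a assms roots[of a] by (simp add: power_0_left)
  qed
  from complex_poly_decompose_rsquarefree[OF this]
  have "(\<Prod>z | z ^ n = 1. [:- z, 1:]) = p"
    using lc by (simp add: deg roots)
  then have "poly (\<Prod>z | z ^ n = 1. [:- z, 1:]) (x / \<rho>) = poly p (x / \<rho>)"
    by simp
  then have "(\<Prod>z | z ^ n = 1. x / \<rho> - z) = (x / \<rho>) ^ n - 1"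
    by (simp add: poly_prod p_def poly_monom)
  also have "(\<Prod>z | z ^ n = 1. x / \<rho> - z) = (\<Prod>k<n. x / \<rho> - cis (2 * pi * real k / real n))"
    by (rule prod.reindex_bij_betw[OF Complex.bij_betw_roots_unity[OF assms], symmetric])
  finally have "(\<Prod>k<n. x / \<rho> - cis (2 * pi * real k / real n)) * \<rho> ^ n = ((x / \<rho>) ^ n - 1) * \<rho> ^ n"
    by simp
  moreover have "(\<Prod>k<n. x / \<rho> - cis (2 * pi * real k / real n)) * \<rho> ^ n
      = (\<Prod>k<n. (x / \<rho> - cis (2 * pi * real k / real n)) * \<rho>)"
    by (simp add: prod.distrib)
  moreover have "\<dots> = (\<Prod>k<n. x - \<rho> * cis (2 * pi * real k / real n))"
    using False by (intro prod.cong) (auto simp: algebra_simps)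
  moreover have "((x / \<rho>) ^ n - 1) * \<rho> ^ n = x ^ n - \<rho> ^ n"
    using False by (simp add: power_divide algebra_simps)
  ultimately show ?thesis by simp
qed (use assms in \<open>simp add: power_0_left\<close>)

text \<open>Factoring \<open>x ^ n - \<rho> ^ n\<close> evaluates the discretised circle mean of the
  logarithm exactly, so its distance from the true mean can be read off without integrals.\<close>

lemma sum_ln_roots_of_unity:
  assumes "n > 0" "\<And>k. k < n \<Longrightarrow> x \<noteq> \<rho> * cis (2 * pi * real k / real n)"
  shows "(\<Sum>k<n. ln (cmod (x - \<rho> * cis (2 * pi * real k / real n)))) = ln (cmod (x ^ n - \<rho> ^ n))"
proof -
  have "ln (cmod (x ^ n - \<rho> ^ n)) = ln (\<Prod>k<n. cmod (x - \<rho> * cis (2 * pi * real k / real n)))"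
    using prod_diff_roots_of_unity[OF assms(1), of x \<rho>] by (simp add: prod_norm)
  also have "\<dots> = (\<Sum>k<n. ln (cmod (x - \<rho> * cis (2 * pi * real k / real n))))"
    using assms(2) by (intro ln_prod) auto
  finally show ?thesis by simp
qed

text \<open>The surplus \<open>\<rho>\<^sup>2\<close> is the strict subharmonicity of the squared
  modulus that drives \<open>discrete_max_principle\<close>. The mixed terms cancel because the
  roots of unity sum to 0, which is where n >= 2 enters.\<close>

lemma sum_norm_square_circle:
  assumes "n \<ge> 2"
  shows "(\<Sum>k<n. (cmod (w + of_real \<rho> * cis (2 * pi * real k / real n)))\<^sup>2) = n * ((cmod w)\<^sup>2 + \<rho>\<^sup>2)"
proof -
  have s: "(\<Sum>k<n. cis (2 * pi * real k / real n)) = 0"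
    using sum_roots_unity[of n] sum.reindex_bij_betw[OF Complex.bij_betw_roots_unity, of n "\<lambda>x. x"] assms by simp
  have c0: "(\<Sum>k<n. cos (2 * pi * real k / real n)) = 0" "(\<Sum>k<n. sin (2 * pi * real k / real n)) = 0"
    using arg_cong[OF s, of Re] arg_cong[OF s, of Im] by simp_all
  have "(cmod (w + of_real \<rho> * cis t))\<^sup>2 = (cmod w)\<^sup>2 + \<rho>\<^sup>2 + 2 * \<rho> * (Re w * cos t + Im w * sin t)" for t
  proof -
    have "(cmod (w + of_real \<rho> * cis t))\<^sup>2 = (Re w + \<rho> * cos t)\<^sup>2 + (Im w + \<rho> * sin t)\<^sup>2"
      by (simp add: cmod_power2)
    also have "\<dots> = (Re w)\<^sup>2 + (Im w)\<^sup>2 + \<rho>\<^sup>2 * ((cos t)\<^sup>2 + (sin t)\<^sup>2) + 2 * \<rho> * (Re w * cos t + Im w * sin t)"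
      unfolding power2_eq_square by algebra
    finally show ?thesis by (simp only: sin_cos_squared_add2 cmod_power2[of w] mult_1_right)
  qed
  then have "(\<Sum>k<n. (cmod (w + of_real \<rho> * cis (2 * pi * real k / real n)))\<^sup>2)
      = (\<Sum>k<n. (cmod w)\<^sup>2 + \<rho>\<^sup>2 + 2 * \<rho> * (Re w * cos (2 * pi * real k / real n) + Im w * sin (2 * pi * real k / real n)))"
    by (simp only:)
  also have "\<dots> = n * ((cmod w)\<^sup>2 + \<rho>\<^sup>2) + 2 * \<rho> * (Re w * (\<Sum>k<n. cos (2 * pi * real k / real n))
          + Im w * (\<Sum>k<n. sin (2 * pi * real k / real n)))"
    by (simp only: sum.distrib sum_distrib_left[symmetric]) (simp add: algebra_simps)
  finally have "(\<Sum>k<n. (cmod (w + of_real \<rho> * cis (2 * pi * real k / real n)))\<^sup>2)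
      = n * ((cmod w)\<^sup>2 + \<rho>\<^sup>2) + 2 * \<rho> * (Re w * (\<Sum>k<n. cos (2 * pi * real k / real n))
          + Im w * (\<Sum>k<n. sin (2 * pi * real k / real n)))" .
  then show ?thesis by (simp add: c0)
qed

text \<open>A bounded error that decays like s / a is absorbed by the logarithm: for small
  \<open>a\<close> the term \<open>\<kappa> * (ln R - ln a)\<close> alone exceeds C, and for larger
  \<open>a\<close> the decay makes the error at most \<eta> once s is small.\<close>

lemma error_dominated_by_ln:
  fixes C c R \<kappa> \<eta> :: real
  assumes "C > 0" "c > 0" "R > 0" "\<kappa> > 0" "\<eta> > 0"
  obtains s0 where "s0 > 0" "\<And>s a e. 0 < s \<Longrightarrow> s \<le> s0 \<Longrightarrow> 0 < a \<Longrightarrow> a \<le> R \<Longrightarrow> e \<le> C \<Longrightarrow>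
      (c * s \<le> a \<Longrightarrow> e \<le> C * s / a) \<Longrightarrow> e \<le> \<kappa> * (ln R - ln a) + \<eta>"
proof -
  \<comment> \<open>The threshold at which \<open>\<kappa> * (ln R - ln t)\<close> equals C.\<close>
  define t where "t = R * exp (- C / \<kappa>)"
  have t: "t > 0" "ln t = ln R - C / \<kappa>"
    using assms by (auto simp: t_def ln_mult)
  show ?thesis
  proof (rule that[of "min (t / c) (\<eta> * t / C)"])
    show "0 < min (t / c) (\<eta> * t / C)" using assms t by simp
    fix s a e
    assume *: "0 < s" "s \<le> min (t / c) (\<eta> * t / C)" "0 < a" "a \<le> R" "e \<le> C"
      "c * s \<le> a \<Longrightarrow> e \<le> C * s / a"
    have ge0: "\<kappa> * (ln R - ln a) \<ge> 0"
      using * assms by simp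
    show "e \<le> \<kappa> * (ln R - ln a) + \<eta>"
    proof (cases "a \<le> t")
      case True
      then have "ln a \<le> ln R - C / \<kappa>"
        using t *(3) by (metis ln_le_cancel_iff)
      then have "\<kappa> * (C / \<kappa>) \<le> \<kappa> * (ln R - ln a)"
        using assms by (intro mult_left_mono) auto
      then show ?thesis using * assms by simp
    next
      case False
      have "c * s \<le> t"
        using * assms by (simp add: field_simps)
      then have "e \<le> C * s / a" using False * by simp
      also have "\<dots> \<le> C * s / t"
        using False t * assms by (intro divide_left_mono) auto
      also have "\<dots> \<le> \<eta>"
        using * assms t by (simp add: field_simps)
      finally show ?thesis using ge0 by simp
    qed
  qed
qed

lemma abs_ln_le_of_between:
  fixes x s a b :: real
  assumes "s > 0" "0 < a" "a * s \<le> x" "x \<le> b * s"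
  shows "\<bar>ln x - ln s\<bar> \<le> \<bar>ln a\<bar> + \<bar>ln b\<bar>"
proof -
  have x: "x > 0" using assms by (meson less_le_trans mult_pos_pos)
  then have b: "b > 0" using assms by (metis less_le_trans mult.commute zero_less_mult_pos)
  have "ln (a * s) \<le> ln x" "ln x \<le> ln (b * s)"
    using assms x b by simp_all
  then have "ln a + ln s \<le> ln x" "ln x \<le> ln b + ln s"
    using assms b by (simp_all add: ln_mult)
  then show ?thesis by linarith
qed

context jordan_domain
begin

lemma ball_subset_D:
  assumes "w \<in> D" "e \<le> infdist w (frontier D)"
  shows "ball w e \<subseteq> D"
proof (rule ccontr)
  assume n: "\<not> ball w e \<subseteq> D"
  then have "e > 0" by (metis ball_empty empty_subsetI not_less)
  then have "ball w e \<inter> frontier D \<noteq> {}"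
    using n assms(1) by (intro connected_Int_frontier) (auto simp: disjoint_iff)
  then obtain b where b: "b \<in> frontier D" "dist w b < e" by auto
  then show False using infdist_le[OF b(1), of w] assms(2) by simp
qed

lemma nearest_frontier_point:
  obtains b where "b \<in> frontier D" "dist w b = infdist w (frontier D)"
  using infdist_attains_inf[of "frontier D" w] frontier_nonempty by (metis frontier_closed)

lemma infdist_frontier_pos: "w \<notin> frontier D \<Longrightarrow> infdist w (frontier D) > 0"
  using in_closed_iff_infdist_zero[of "frontier D" w] frontier_nonempty infdist_nonneg[of w "frontier D"]
  by (metis frontier_closed le_less)

lemma infdist_frontier_le: "z \<in> frontier D \<Longrightarrow> infdist w (frontier D) \<le> cmod (z - w)"
  using infdist_le[of z "frontier D" w] by (simp add: dist_norm norm_minus_commute)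

lemma diameter_bound:
  obtains R where "R > 0" "\<And>z w. z \<in> closure D \<Longrightarrow> w \<in> closure D \<Longrightarrow> cmod (z - w) \<le> R"
    "\<And>z. z \<in> closure D \<Longrightarrow> cmod z \<le> R"
proof -
  obtain B where B: "B > 0" "\<And>z. z \<in> closure D \<Longrightarrow> cmod z \<le> B"
    using compact_imp_bounded[OF compact_closure_D] unfolding bounded_pos by auto
  show ?thesis
  proof (rule that[of "2 * B"])
    fix z w assume "z \<in> closure D" "w \<in> closure D"
    then show "cmod (z - w) \<le> 2 * B"
      using B(2)[of z] B(2)[of w] norm_triangle_ineq4[of z w] by linarith
  qed (use B in force)+
qed

text \<open>The perturbation by a small multiple of \<open>|w|\<^sup>2\<close> makes the mean value inequality strict.\<close>

lemma discrete_max_principle: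
  fixes d :: "complex \<Rightarrow> real"
  assumes \<delta>: "\<delta> > 0"
    and near: "\<And>w. w \<in> D \<Longrightarrow> infdist w (frontier D) \<le> \<delta> \<Longrightarrow> d w \<le> \<eta>"
    and bdd: "\<And>w. w \<in> D \<Longrightarrow> d w \<le> M"
    and sub: "\<And>w \<epsilon>. w \<in> D \<Longrightarrow> \<delta> < infdist w (frontier D) \<Longrightarrow> \<epsilon> > 0 \<Longrightarrow>
       \<exists>n\<ge>2. d w \<le> (\<Sum>k<n. d (w + of_real (\<delta> / 2) * cis (2 * pi * real k / real n))) / real n + \<epsilon>"
    and w0: "w0 \<in> D"
  shows "d w0 \<le> \<eta>"
proof (rule ccontr)
  assume "\<not> d w0 \<le> \<eta>"
  then have gap: "d w0 - \<eta> > 0" by simp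
  obtain R where R: "R > 0" "\<And>z. z \<in> closure D \<Longrightarrow> cmod z \<le> R"
    using diameter_bound by metis
  have RD: "(cmod w)\<^sup>2 \<le> R\<^sup>2" if "w \<in> D" for w
    using R(2)[OF D_in_closure[OF that]] by (intro power_mono) auto
  \<comment> \<open>With this weight the perturbation uses up at most half of the gap between
    \<open>d w0\<close> and \<eta>.\<close>
  define lam where "lam = (d w0 - \<eta>) / (2 * R\<^sup>2)"
  have lam: "lam > 0" using gap R by (simp add: lam_def)
  have lamR: "lam * R\<^sup>2 = (d w0 - \<eta>) / 2"
    using R by (simp add: lam_def)
  let ?F = "\<lambda>w. d w + lam * (cmod w)\<^sup>2"
  have Fbd: "?F w \<le> M + lam * R\<^sup>2" if "w \<in> D" for w
    using bdd[OF that] RD[OF that] lam by (simp add: add_mono)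
  define S where "S = (SUP w\<in>D. ?F w)"
  have bddF: "bdd_above (?F ` D)"
    using Fbd by (intro bdd_aboveI2)
  have FS: "?F w \<le> S" if "w \<in> D" for w
    unfolding S_def using that bddF by (intro cSUP_upper)
  have S0: "d w0 \<le> S"
    using FS[OF w0] lam by (smt (verit) mult_nonneg_nonneg zero_le_power2)
  \<comment> \<open>The supremum may not be attained, so a point within \<theta> of it is used.
    Averaging gains \<open>lam * (\<delta> / 2)\<^sup>2\<close>; a quarter of this covers the error
    in \<open>sub\<close> and another quarter covers \<theta>.\<close>
  define \<theta> where "\<theta> = min (lam * (\<delta> / 2)\<^sup>2 / 4) ((d w0 - \<eta>) / 2)"
  have \<theta>: "\<theta> > 0" using lam gap \<delta> by (simp add: \<theta>_def)
  then obtain w where w: "w \<in> D" "S - \<theta> < ?F w"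
    using less_cSUP_iff[of D ?F "S - \<theta>"] ne_D bddF by (auto simp: S_def)
  have "\<delta> < infdist w (frontier D)"
  proof (rule ccontr)
    assume "\<not> ?thesis"
    then have "?F w \<le> \<eta> + lam * R\<^sup>2"
      using near[OF w(1)] RD[OF w(1)] lam by (intro add_mono mult_left_mono) auto
    moreover have "\<theta> \<le> (d w0 - \<eta>) / 2" unfolding \<theta>_def by (rule min.cobounded2)
    ultimately show False using w(2) S0 lamR by (simp add: field_simps)
  qed
  note wd = this
  let ?\<epsilon> = "lam * (\<delta> / 2)\<^sup>2 / 4"
  have "?\<epsilon> > 0" using lam \<delta> by simp
  then obtain n :: nat where n: "n \<ge> 2"
     "d w \<le> (\<Sum>k<n. d (w + of_real (\<delta> / 2) * cis (2 * pi * real k / real n))) / n + ?\<epsilon>"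
    using sub[OF w(1) wd] by blast
  let ?w = "\<lambda>k. w + of_real (\<delta> / 2) * cis (2 * pi * real k / real n)"
  have wk: "?w k \<in> D" for k
  proof -
    have "dist w (?w k) = \<delta> / 2"
      using \<delta> by (simp add: dist_norm norm_mult)
    then have "?w k \<in> ball w \<delta>"
      using \<delta> by simp
    then show ?thesis using ball_subset_D[OF w(1), of \<delta>] wd by auto
  qed
  have "(\<Sum>k<n. d (?w k)) \<le> (\<Sum>k<n. S - lam * (cmod (?w k))\<^sup>2)"
    using FS[OF wk] by (intro sum_mono) (simp add: algebra_simps)
  also have "\<dots> = n * S - lam * (\<Sum>k<n. (cmod (?w k))\<^sup>2)"
    by (simp add: sum_subtractf sum_distrib_left)
  also have "\<dots> = n * (S - lam * ((cmod w)\<^sup>2 + (\<delta> / 2)\<^sup>2))"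
    using sum_norm_square_circle[OF n(1), of w "\<delta> / 2"] by (simp add: algebra_simps)
  finally have "(\<Sum>k<n. d (?w k)) / n \<le> S - lam * ((cmod w)\<^sup>2 + (\<delta> / 2)\<^sup>2)"
    using n(1) by (simp add: divide_le_eq mult.commute)
  then have "?F w \<le> S - lam * (\<delta> / 2)\<^sup>2 + ?\<epsilon>"
    using n(2) by (simp add: distrib_left)
  moreover have "\<theta> \<le> ?\<epsilon>" unfolding \<theta>_def by (rule min.cobounded1)
  ultimately show False
    using w(2) \<open>?\<epsilon> > 0\<close> by linarith
qed

text \<open>The error term \<open>\<kappa> * (L - g z)\<close> survives averaging, whereas a uniform bound near a single
  boundary point would not.\<close>

definition near_log_closure :: "real \<Rightarrow> real \<Rightarrow> real \<Rightarrow> (complex \<Rightarrow> real) \<Rightarrow> bool" where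
  "near_log_closure \<kappa> L \<eta> g \<longleftrightarrow> (\<exists>y\<in>log_closure. \<forall>z\<in>frontier D. \<bar>g z - y z\<bar> \<le> \<kappa> * (L - g z) + \<eta>)"

lemma near_log_closure_mono: "near_log_closure \<kappa> L \<eta> g \<Longrightarrow> \<eta> \<le> \<eta>' \<Longrightarrow> near_log_closure \<kappa> L \<eta>' g"
  unfolding near_log_closure_def by (meson add_left_mono order_trans)

text \<open>The error bound is affine in the approximated function, so it survives the passage to
  means without loss.\<close>

lemma near_log_closure_mean:
  assumes "n > 0" "\<And>k. k < n \<Longrightarrow> near_log_closure \<kappa> L (\<eta> k) (g k)"
  shows "near_log_closure \<kappa> L ((\<Sum>k<n. \<eta> k) / real n) (\<lambda>z. (\<Sum>k<n. g k z) / real n)"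
proof -
  have "\<forall>k\<in>{..<n}. \<exists>y. y \<in> log_closure \<and> (\<forall>z\<in>frontier D. \<bar>g k z - y z\<bar> \<le> \<kappa> * (L - g k z) + \<eta> k)"
    using assms(2) by (auto simp: near_log_closure_def)
  then obtain y where y: "\<And>k. k < n \<Longrightarrow> y k \<in> log_closure"
    "\<And>k z. k < n \<Longrightarrow> z \<in> frontier D \<Longrightarrow> \<bar>g k z - y k z\<bar> \<le> \<kappa> * (L - g k z) + \<eta> k"
    by (metis lessThan_iff)
  have "(\<lambda>z. \<Sum>k<n. y k z) \<in> log_closure"
    using y(1) by (intro log_closure_sum) auto
  from log_closure_scale[OF this, of "1 / real n"] have mean_mem: "(\<lambda>z. (\<Sum>k<n. y k z) / real n) \<in> log_closure"
    by simp
  show ?thesis unfolding near_log_closure_def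
  proof (intro bexI[OF _ mean_mem] ballI)
    fix z assume z: "z \<in> frontier D"
    have "\<bar>\<Sum>k<n. g k z - y k z\<bar> \<le> (\<Sum>k<n. \<kappa> * (L - g k z) + \<eta> k)"
      using y(2) z by (intro order_trans[OF sum_abs] sum_mono) auto
    then have "\<bar>\<Sum>k<n. g k z - y k z\<bar> / n \<le> (\<Sum>k<n. \<kappa> * (L - g k z) + \<eta> k) / n"
      by (rule divide_right_mono) simp
    moreover have "\<bar>\<Sum>k<n. g k z - y k z\<bar> / n = \<bar>(\<Sum>k<n. g k z) / n - (\<Sum>k<n. y k z) / n\<bar>"
      by (simp add: sum_subtractf diff_divide_distrib[symmetric])
    moreover have "(\<Sum>k<n. \<kappa> * (L - g k z) + \<eta> k) / n = \<kappa> * (L - (\<Sum>k<n. g k z) / n) + (\<Sum>k<n. \<eta> k) / n"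
      using assms(1) by (simp add: sum.distrib sum_distrib_left[symmetric] sum_subtractf field_simps)
    ultimately show "\<bar>(\<Sum>k<n. g k z) / n - (\<Sum>k<n. y k z) / n\<bar> \<le> \<kappa> * (L - (\<Sum>k<n. g k z) / n) + (\<Sum>k<n. \<eta> k) / n"
      by simp
  qed
qed

lemma near_log_closure_approx:
  assumes "near_log_closure \<kappa> L \<eta> g" "\<kappa> \<ge> 0" "\<And>z. z \<in> frontier D \<Longrightarrow> \<bar>g z - h z\<bar> \<le> \<tau>"
  shows "near_log_closure \<kappa> L (\<eta> + (1 + \<kappa>) * \<tau>) h"
proof -
  obtain y where y: "y \<in> log_closure" "\<forall>z\<in>frontier D. \<bar>g z - y z\<bar> \<le> \<kappa> * (L - g z) + \<eta>"
    using assms(1) by (auto simp: near_log_closure_def)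
  show ?thesis unfolding near_log_closure_def
  proof (intro bexI[OF _ y(1)] ballI)
    fix z assume z: "z \<in> frontier D"
    have 1: "\<bar>g z - y z\<bar> \<le> \<kappa> * (L - g z) + \<eta>" using y(2) z by blast
    have "\<kappa> * (L - g z) \<le> \<kappa> * (L - h z + \<tau>)"
      using assms(2) assms(3)[OF z] by (intro mult_left_mono) auto
    then show "\<bar>h z - y z\<bar> \<le> \<kappa> * (L - h z) + (\<eta> + (1 + \<kappa>) * \<tau>)"
      using 1 assms(3)[OF z] by (simp add: algebra_simps)
  qed
qed

text \<open>For \<open>w\<close> close to the frontier the smoothed logarithm at a nearest frontier
  point \<open>b\<close>, with scale s equal to the distance, serves as approximant: its error is
  bounded near \<open>b\<close> and of order s / a away from it, which
  \<open>error_dominated_by_ln\<close> absorbs.\<close>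

lemma near_log_closure_ln_near_frontier:
  assumes R: "R > 0" "\<And>z w. z \<in> closure D \<Longrightarrow> w \<in> closure D \<Longrightarrow> cmod (z - w) \<le> R"
    and "\<kappa> > 0" "\<eta> > 0"
  obtains \<delta> where "\<delta> > 0" "\<And>w. w \<in> D \<Longrightarrow> infdist w (frontier D) \<le> \<delta> \<Longrightarrow> near_log_closure \<kappa> (ln R) \<eta> (\<lambda>z. ln (cmod (z - w)))"
proof -
  obtain r0 :: real where r0: "r0 > 0" "\<And>b \<delta>. b \<in> frontier D \<Longrightarrow> 0 < \<delta> \<Longrightarrow> \<delta> < r0 \<Longrightarrow>
    \<exists>v\<in>log_closure. \<forall>z\<in>frontier D. (cmod (z - b) \<le> 2 * \<delta> \<longrightarrow> \<bar>v z - ln \<delta>\<bar> \<le> 7) \<and>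
       (2 * \<delta> \<le> cmod (z - b) \<longrightarrow> \<bar>v z - ln (cmod (z - b))\<bar> \<le> 2 * \<delta> / cmod (z - b))"
    using smoothed_ln_exists by blast
  \<comment> \<open>The constant 9 is 7 from the smoothed logarithm plus the bound 2 for ln 3. If
    \<open>a\<close> is at least 4 * s, then x is at least 3 / 4 * a, and the error 4 * s / x stays
    below 9 * s / a.\<close>
  obtain s0 where s0: "s0 > 0" "\<And>s a e. 0 < s \<Longrightarrow> s \<le> s0 \<Longrightarrow> 0 < a \<Longrightarrow> a \<le> R \<Longrightarrow> e \<le> 9 \<Longrightarrow>
      (4 * s \<le> a \<Longrightarrow> e \<le> 9 * s / a) \<Longrightarrow> e \<le> \<kappa> * (ln R - ln a) + \<eta>"
    using error_dominated_by_ln[of 9 4 R \<kappa> \<eta>] assms by auto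
  show ?thesis
  proof (rule that[of "min s0 (r0 / 2)"])
    show "0 < min s0 (r0 / 2)" using r0 s0 by simp
    fix w assume w: "w \<in> D" "infdist w (frontier D) \<le> min s0 (r0 / 2)"
    obtain b where b: "b \<in> frontier D" "dist w b = infdist w (frontier D)"
      using nearest_frontier_point by blast
    define s where "s = infdist w (frontier D)"
    have s: "0 < s" "s \<le> s0" "s < r0"
      using infdist_frontier_pos[of w] w D_frontier_disj r0(1) by (auto simp: s_def)
    obtain v where v: "v \<in> log_closure" "\<And>z. z \<in> frontier D \<Longrightarrow> cmod (z - b) \<le> 2 * s \<Longrightarrow> \<bar>v z - ln s\<bar> \<le> 7"
      "\<And>z. z \<in> frontier D \<Longrightarrow> 2 * s \<le> cmod (z - b) \<Longrightarrow> \<bar>v z - ln (cmod (z - b))\<bar> \<le> 2 * s / cmod (z - b)"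
      using r0(2)[OF b(1) s(1,3)] by blast
    show "near_log_closure \<kappa> (ln R) \<eta> (\<lambda>z. ln (cmod (z - w)))"
      unfolding near_log_closure_def
    proof (intro bexI[OF _ v(1)] ballI)
      fix z assume z: "z \<in> frontier D"
      define a where "a = cmod (z - w)"
      define x where "x = cmod (z - b)"
      have as: "s \<le> a" unfolding a_def s_def using infdist_frontier_le[OF z] .
      have aR: "a \<le> R" unfolding a_def using R(2) z w(1) frontier_in_closure D_in_closure by blast
      have bw: "cmod (b - w) = s"
        using b(2) by (simp add: s_def dist_norm norm_minus_commute)
      have ax: "\<bar>a - x\<bar> \<le> s"
        unfolding a_def x_def using norm_triangle_ineq3[of "z - w" "z - b"] bw by simp
      have far: "\<bar>ln a - v z\<bar> \<le> 4 * s / x" if "2 * s \<le> x"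
      proof -
        have "\<bar>ln a - ln x\<bar> \<le> 2 * s / x"
          using that s(1) ax by (intro abs_ln_diff_le) auto
        moreover have "\<bar>v z - ln x\<bar> \<le> 2 * s / x"
          using v(3)[OF z] that by (simp add: x_def)
        ultimately show ?thesis by (simp add: add_divide_distrib[symmetric])
      qed
      show "\<bar>ln (cmod (z - w)) - v z\<bar> \<le> \<kappa> * (ln R - ln (cmod (z - w))) + \<eta>"
        unfolding a_def[symmetric]
      proof (rule s0(2)[OF s(1,2) _ aR])
        show "0 < a" using as s by simp
        show "\<bar>ln a - v z\<bar> \<le> 9"
        proof (cases "2 * s \<le> x")
          case True
          then have "4 * s / x \<le> 2" using s(1) by (simp add: divide_le_eq)
          then show ?thesis using far[OF True] by linarith
        next
          case False
          then have "\<bar>v z - ln s\<bar> \<le> 7" using v(2)[OF z] by (simp add: x_def)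
          moreover have "\<bar>ln a - ln s\<bar> \<le> \<bar>ln 1\<bar> + \<bar>ln 3\<bar>"
            using s as ax False by (intro abs_ln_le_of_between) auto
          moreover have "ln (3::real) \<le> 3 - 1" by (rule ln_le_minus_one) simp
          ultimately show ?thesis by simp
        qed
        show "\<bar>ln a - v z\<bar> \<le> 9 * s / a" if "4 * s \<le> a"
        proof -
          have x: "3 / 4 * a \<le> x" "2 * s \<le> x" using that ax s(1) by auto
          have "4 * s / x \<le> 4 * s / (3 / 4 * a)"
            using x s that by (intro divide_left_mono) auto
          also have "\<dots> \<le> 9 * s / a"
            using s that by (simp add: field_simps)
          finally show ?thesis using far[OF x(2)] by linarith
        qed
      qed
    qed
  qed
qed

text \<open>The best error \<open>d w\<close> is bounded, small near the frontier and, up to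
  \<epsilon>, at most its mean over a small circle around \<open>w\<close>, because for z on the
  frontier \<open>ln (cmod (z - w))\<close> is the mean of \<open>ln (cmod (z - u))\<close> over u
  on that circle. The maximum principle then makes it small throughout \<open>D\<close>.\<close>

lemma log_closure_ln_inside:
  assumes "w0 \<in> D"
  shows "(\<lambda>z. ln (cmod (z - w0))) \<in> log_closure"
proof -
  obtain R where R: "R > 0" "\<And>z w. z \<in> closure D \<Longrightarrow> w \<in> closure D \<Longrightarrow> cmod (z - w) \<le> R"
    using diameter_bound by metis
  let ?l = "\<lambda>w z. ln (cmod (z - w))"
  have main: "near_log_closure \<kappa> (ln R) (2 * \<eta>) (?l w0)" if \<kappa>: "\<kappa> > 0" and \<eta>: "\<eta> > 0" for \<kappa> \<eta>
  proof -
    obtain \<delta> where \<delta>: "\<delta> > 0" "\<And>w. w \<in> D \<Longrightarrow> infdist w (frontier D) \<le> \<delta> \<Longrightarrow> near_log_closure \<kappa> (ln R) \<eta> (?l w)"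
      using near_log_closure_ln_near_frontier[OF R \<kappa> \<eta>] by blast
    define d where "d = (\<lambda>w. Inf {\<eta>. 0 \<le> \<eta> \<and> near_log_closure \<kappa> (ln R) \<eta> (?l w)})"
    have d_le: "d w \<le> \<eta>'" if "0 \<le> \<eta>'" "near_log_closure \<kappa> (ln R) \<eta>' (?l w)" for w \<eta>'
      unfolding d_def using that by (intro cInf_lower) (auto intro!: bdd_belowI[of _ 0])
    \<comment> \<open>A crude bound: away from the frontier the logarithm is bounded on
      \<open>frontier D\<close>, and the zero function is approximant enough.\<close>
    define M where "M = \<eta> + \<bar>ln \<delta>\<bar> + \<bar>ln R\<bar>"
    have bd: "near_log_closure \<kappa> (ln R) M (?l w)" if w: "w \<in> D" for w
    proof (cases "infdist w (frontier D) \<le> \<delta>")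
      case True
      show ?thesis by (rule near_log_closure_mono[OF \<delta>(2)[OF w True]]) (simp add: M_def)
    next
      case False
      show ?thesis unfolding near_log_closure_def
      proof (intro bexI[of _ "\<lambda>z. 0"] ballI)
        fix z assume z: "z \<in> frontier D"
        have a: "\<delta> \<le> cmod (z - w)" "cmod (z - w) \<le> R"
          using infdist_frontier_le[OF z, of w] False R(2) z w frontier_in_closure D_in_closure by auto
        have "ln \<delta> \<le> ln (cmod (z - w))" "ln (cmod (z - w)) \<le> ln R"
          using a \<delta>(1) R(1) by (subst ln_le_cancel_iff; linarith)+
        moreover have "\<kappa> * (ln R - ln (cmod (z - w))) \<ge> 0"
          using calculation \<kappa> by simp
        ultimately show "\<bar>ln (cmod (z - w)) - 0\<bar> \<le> \<kappa> * (ln R - ln (cmod (z - w))) + M"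
          using \<eta> by (simp add: M_def)
      qed (rule log_closure_const)
    qed
    have M0: "M \<ge> 0" using \<eta> by (simp add: M_def)
    have d_near: "near_log_closure \<kappa> (ln R) (d w + \<epsilon>) (?l w)" if w: "w \<in> D" and \<epsilon>: "\<epsilon> > 0" for w \<epsilon>
    proof -
      have "{\<eta>. 0 \<le> \<eta> \<and> near_log_closure \<kappa> (ln R) \<eta> (?l w)} \<noteq> {}"
        using bd[OF w] M0 by blast
      then obtain \<eta>' where "near_log_closure \<kappa> (ln R) \<eta>' (?l w)" "\<eta>' < d w + \<epsilon>"
        using cInf_lessD[of "{\<eta>. 0 \<le> \<eta> \<and> near_log_closure \<kappa> (ln R) \<eta> (?l w)}" "d w + \<epsilon>"] \<epsilon> by (auto simp: d_def)
      then show ?thesis using near_log_closure_mono by fastforce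
    qed
    have d0: "d w \<ge> 0" if w: "w \<in> D" for w
      unfolding d_def using bd[OF w] M0 by (intro cInf_greatest) auto
    have "d w0 \<le> \<eta>"
    proof (rule discrete_max_principle[OF \<delta>(1) _ _ _ assms])
      show "d w \<le> \<eta>" if "w \<in> D" "infdist w (frontier D) \<le> \<delta>" for w
        using d_le \<delta>(2)[OF that] \<eta> by simp
      show "d w \<le> M" if "w \<in> D" for w
        using d_le[OF M0 bd[OF that]] .
    next
      fix w and \<epsilon> :: real assume w: "w \<in> D" "\<delta> < infdist w (frontier D)" and \<epsilon>: "\<epsilon> > 0"
      \<comment> \<open>Enough points to keep the discretisation error 1 / n, enlarged by the factor
        1 + \<kappa> of \<open>near_log_closure_approx\<close>, below \<epsilon> / 2.\<close>
      obtain n0 :: nat where n0: "2 * (1 + \<kappa>) / \<epsilon> < real n0"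
        using reals_Archimedean2 by blast
      define n where "n = n0 + 2"
      have n: "n \<ge> 2" "n > 0" by (auto simp: n_def)
      have "2 * (1 + \<kappa>) / \<epsilon> < real n" using n0 by (simp add: n_def)
      then have n\<epsilon>: "(1 + \<kappa>) * (1 / real n) \<le> \<epsilon> / 2"
        using \<epsilon> n(2) by (simp add: field_simps)
      let ?w = "\<lambda>k. w + of_real (\<delta> / 2) * cis (2 * pi * real k / real n)"
      have wk: "?w k \<in> D" for k
      proof -
        have "dist w (?w k) = \<delta> / 2"
          using \<delta>(1) by (simp add: dist_norm norm_mult)
        then have "?w k \<in> ball w \<delta>"
          using \<delta>(1) by simp
        then show ?thesis using ball_subset_D[OF w(1), of \<delta>] w(2) by auto
      qed
      have "near_log_closure \<kappa> (ln R) ((\<Sum>k<n. d (?w k) + \<epsilon> / 2) / n) (\<lambda>z. (\<Sum>k<n. ?l (?w k) z) / n)"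
        using \<epsilon> by (intro near_log_closure_mean[OF n(2)] d_near wk) auto
      then have "near_log_closure \<kappa> (ln R) ((\<Sum>k<n. d (?w k) + \<epsilon> / 2) / n + (1 + \<kappa>) * (1 / n)) (?l w)"
      proof (rule near_log_closure_approx)
        show "\<kappa> \<ge> 0" using \<kappa> by simp
        fix z assume z: "z \<in> frontier D"
        have zw: "\<delta> < cmod (z - w)"
          using infdist_frontier_le[OF z, of w] w(2) by simp
        \<comment> \<open>The mean differs from the logarithm at the centre by
          \<open>ln (cmod (1 - ?t)) / n\<close>, and \<open>?t\<close> is small since the circle has
          radius \<delta> / 2 while z is farther than \<delta> from \<open>w\<close>.\<close>
        let ?t = "(of_real (\<delta> / 2) / (z - w)) ^ n"
        have "cmod (of_real (\<delta> / 2) / (z - w)) = (\<delta> / 2) / cmod (z - w)"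
          using \<delta>(1) by (simp only: norm_divide norm_of_real abs_of_pos half_gt_zero)
        also have "\<dots> \<le> 1 / 2"
          using zw \<delta>(1) by (simp only: divide_le_eq) auto
        finally have "cmod (of_real (\<delta> / 2) / (z - w)) \<le> 1 / 2" .
        then have "cmod ?t \<le> (1 / 2) ^ n"
          unfolding norm_power by (intro power_mono) auto
        also have "\<dots> \<le> (1 / 2) ^ 1"
          using n by (intro power_decreasing) auto
        finally have t: "cmod ?t \<le> 1 / 2" by simp
        have t1: "1 / 2 \<le> cmod (1 - ?t)" "cmod (1 - ?t) \<le> 3 / 2"
          using norm_triangle_ineq2[of 1 ?t] norm_triangle_ineq4[of 1 ?t] t by auto
        have zne: "z - w \<noteq> of_real (\<delta> / 2) * cis (2 * pi * real k / real n)" for k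
        proof
          assume "z - w = of_real (\<delta> / 2) * cis (2 * pi * real k / real n)"
          then have "cmod (z - w) = \<bar>\<delta> / 2\<bar> * 1" by (simp only: norm_mult norm_of_real norm_cis)
          then show False using zw \<delta>(1) by simp
        qed
        have "(\<Sum>k<n. ?l (?w k) z) = (\<Sum>k<n. ln (cmod ((z - w) - of_real (\<delta> / 2) * cis (2 * pi * real k / real n))))"
          by (simp add: algebra_simps)
        also have "\<dots> = ln (cmod ((z - w) ^ n - of_real (\<delta> / 2) ^ n))"
          using zne by (intro sum_ln_roots_of_unity n) auto
        also have "(z - w) ^ n - of_real (\<delta> / 2) ^ n = (z - w) ^ n * (1 - ?t)"
        proof -
          have "(z - w) ^ n * (c / (z - w)) ^ n = c ^ n" for c
            using zw \<delta>(1) by (auto simp flip: power_mult_distrib)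
          then show ?thesis by (simp only: right_diff_distrib mult_1_right)
        qed
        also have "ln (cmod \<dots>) = n * ln (cmod (z - w)) + ln (cmod (1 - ?t))"
          using zw \<delta>(1) t1(1) by (subst norm_mult, subst ln_mult) (auto simp: norm_power ln_realpow)
        finally have "(\<Sum>k<n. ?l (?w k) z) / n - ?l w z = ln (cmod (1 - ?t)) / n"
          using n by (simp add: add_divide_distrib)
        moreover have "\<bar>ln (cmod (1 - ?t))\<bar> \<le> 1"
        proof -
          have "ln (cmod (1 - ?t)) \<le> 3 / 2 - 1"
            using t1 by (intro order_trans[OF ln_le_minus_one]) auto
          moreover have "ln (1 / 2) \<le> ln (cmod (1 - ?t))"
            using t1(1) by (subst ln_le_cancel_iff) auto
          moreover have "ln (1 / 2 :: real) \<ge> - 1"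
            using ln_2_less_1 by (simp add: ln_div)
          ultimately show ?thesis by linarith
        qed
        ultimately show "\<bar>(\<Sum>k<n. ?l (?w k) z) / n - ?l w z\<bar> \<le> 1 / n"
          using n by (simp add: abs_divide divide_right_mono)
      qed
      moreover have "(\<Sum>k<n. d (?w k) + \<epsilon> / 2) / n = (\<Sum>k<n. d (?w k)) / n + \<epsilon> / 2"
        using n by (simp add: sum.distrib add_divide_distrib)
      ultimately have "near_log_closure \<kappa> (ln R) ((\<Sum>k<n. d (?w k)) / n + \<epsilon>) (?l w)"
        by (elim near_log_closure_mono) (use n\<epsilon> in linarith)
      moreover have "(\<Sum>k<n. d (?w k)) / n + \<epsilon> \<ge> 0"
        using d0[OF wk] \<epsilon> by (intro add_nonneg_nonneg divide_nonneg_nonneg sum_nonneg) auto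
      ultimately show "\<exists>n\<ge>2. d w \<le> (\<Sum>k<n. d (w + of_real (\<delta> / 2) * cis (2 * pi * real k / real n))) / real n + \<epsilon>"
        using d_le n(1) by blast
    qed
    then show ?thesis
      using d_near[OF assms \<eta>] by (elim near_log_closure_mono) simp
  qed
  show ?thesis
  proof (rule log_closure_limit)
    fix \<epsilon> :: real assume \<epsilon>: "\<epsilon> > 0"
    define s where "s = infdist w0 (frontier D)"
    have s: "s > 0" unfolding s_def using infdist_frontier_pos assms D_frontier_disj by blast
    \<comment> \<open>For the fixed interior point \<open>w0\<close> the weight
      \<open>ln R - ln (cmod (z - w0))\<close> is bounded by \<open>c\<close>, so the weighted error
      becomes uniform.\<close>
    define c where "c = \<bar>ln R - ln s\<bar> + 1"
    have c: "c > 0" by (simp add: c_def)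
    have "\<epsilon> / (2 * c) > 0" "\<epsilon> / 4 > 0" using \<epsilon> c by auto
    from main[OF this] obtain y where y: "y \<in> log_closure"
      "\<forall>z\<in>frontier D. \<bar>?l w0 z - y z\<bar> \<le> \<epsilon> / (2 * c) * (ln R - ?l w0 z) + 2 * (\<epsilon> / 4)"
      unfolding near_log_closure_def by blast
    have "\<bar>?l w0 z - y z\<bar> \<le> \<epsilon>" if z: "z \<in> frontier D" for z
    proof -
      have "ln s \<le> ?l w0 z"
        using infdist_frontier_le[OF z, of w0] s by (subst ln_le_cancel_iff) (auto simp: s_def)
      then have "\<epsilon> / (2 * c) * (ln R - ?l w0 z) \<le> \<epsilon> / (2 * c) * c"
        using \<epsilon> c by (intro mult_left_mono) (auto simp: c_def)
      also have "\<dots> = \<epsilon> / 2" using c by simp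
      finally show ?thesis using bspec[OF y(2) z] by simp
    qed
    then show "\<exists>v\<in>log_closure. \<forall>z\<in>frontier D. \<bar>?l w0 z - v z\<bar> \<le> \<epsilon>"
      using y(1) by blast
  qed
qed

lemma log_closure_ln: "w \<notin> frontier D \<Longrightarrow> (\<lambda>z. ln (cmod (z - w))) \<in> log_closure"
  using log_closure_ln_inside[of w] log_closure_ln_outside[of w] closure_eq by blast

end

section \<open>The Walsh--Lebesgue theorem\<close>

lemma norm_one_plus_power_minus_one:
  fixes h :: complex
  shows "cmod ((1 + h) ^ n - 1) \<le> (1 + cmod h) ^ n - 1"
proof (induction n)
  case (Suc n)
  have "(1 + h) ^ Suc n - 1 = ((1 + h) ^ n - 1) * (1 + h) + h"
    by (simp add: algebra_simps)
  then have "cmod ((1 + h) ^ Suc n - 1) \<le> cmod ((1 + h) ^ n - 1) * cmod (1 + h) + cmod h"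
    by (metis norm_mult norm_triangle_ineq)
  also have "\<dots> \<le> ((1 + cmod h) ^ n - 1) * (1 + cmod h) + cmod h"
    using Suc norm_triangle_ineq[of 1 h] by (intro add_right_mono mult_mono) auto
  also have "\<dots> = (1 + cmod h) ^ Suc n - 1"
    by (simp add: algebra_simps)
  finally show ?case .
qed simp

text \<open>Otherwise the n-th power of x / u would be at distance less than 1 from 1, since n times
  the relative error is below 1 / 2 and \<open>exp (1 / 2)\<close> is at most 2; but this power is
  real and not positive.\<close>

lemma dist_nth_root_ge:
  fixes x u :: complex
  assumes n: "n > 0" and r: "r > 0" and u: "u ^ n = of_real (r ^ n)" "cmod u = r"
    and x: "x ^ n = - of_real s" "s \<ge> 0"
  shows "r / (2 * real n) \<le> cmod (x - u)"
proof (rule ccontr)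
  assume *: "\<not> ?thesis"
  define h where "h = x / u - 1"
  have u0: "u \<noteq> 0" using u r by auto
  have "h = (x - u) / u"
    using u0 by (simp add: h_def diff_divide_distrib)
  then have "cmod h = cmod (x - u) / r"
    using u by (simp add: norm_divide)
  also have "\<dots> < r / (2 * real n) / r"
    using * r by (intro divide_strict_right_mono) auto
  finally have h: "real n * cmod h < 1 / 2"
    using n r by (simp add: field_simps)
  have "(1 + h) ^ n = x ^ n / u ^ n"
    by (simp add: h_def power_divide)
  also have "\<dots> = of_real (- (s / r ^ n))"
    using u x by simp
  finally have "(1 + h) ^ n - 1 = of_real (- (s / r ^ n) - 1)"
    by simp
  then have "cmod ((1 + h) ^ n - 1) = \<bar>- (s / r ^ n) - 1\<bar>"
    by (simp only: norm_of_real)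
  also have "\<dots> = s / r ^ n + 1"
  proof -
    have "0 \<le> s / r ^ n" using x(2) r by simp
    then show ?thesis by linarith
  qed
  finally have "1 \<le> cmod ((1 + h) ^ n - 1)"
    using x(2) r by simp
  also have "\<dots> \<le> (1 + cmod h) ^ n - 1"
    by (rule norm_one_plus_power_minus_one)
  also have "(1 + cmod h) ^ n \<le> exp (cmod h) ^ n"
    by (intro power_mono exp_ge_add_one_self) auto
  also have "\<dots> = exp (real n * cmod h)"
    by (simp add: exp_of_nat_mult)
  also have "\<dots> < exp (1 / 2)"
    using h by simp
  finally show False using exp_half_le2 by simp
qed

lemma norm_cis_diff_le: "cmod (cis a - cis b) \<le> \<bar>a - b\<bar>"
proof -
  have "cis a - cis b = cis b * (cis (a - b) - 1)"
    by (simp add: algebra_simps cis_mult)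
  then have "cmod (cis a - cis b) = cmod (exp (\<i> * of_real (a - b)) - 1)"
    by (simp add: norm_mult cis_conv_exp)
  also have "\<dots> = 2 * \<bar>sin ((a - b) / 2)\<bar>"
    by (rule dist_exp_i_1)
  also have "\<dots> \<le> 2 * \<bar>(a - b) / 2\<bar>"
    by (intro mult_left_mono abs_sin_x_le_abs_x) simp
  finally show ?thesis by simp
qed

lemma rotate_to_negative_power:
  fixes x :: complex
  assumes "n > 0"
  obtains y where "cmod y = cmod x" "cmod (y - x) \<le> 4 * cmod x / real n" "y ^ n = - of_real (cmod x ^ n)"
proof -
  define a where "a = Arg x"
  define j where "j = \<lfloor>a * n / (2 * pi)\<rfloor>"
  \<comment> \<open>The midpoint between the two consecutive multiples of 2 * pi / n that enclose
    the argument, so rotating to it costs an angle of at most pi / n.\<close>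
  define b where "b = (2 * of_int j + 1) * pi / n"
  have x: "x = of_real (cmod x) * cis a"
    using rcis_cmod_Arg[of x] by (simp add: a_def rcis_def)
  have "of_int j \<le> a * n / (2 * pi)" "a * n / (2 * pi) < of_int j + 1"
    by (auto simp: j_def)
  then have j: "of_int j * (2 * pi) \<le> a * n" "a * n < (of_int j + 1) * (2 * pi)"
    by (auto simp: field_simps)
  have bn: "b * n = (2 * of_int j + 1) * pi" using assms by (simp add: b_def)
  have "\<bar>(b - a) * n\<bar> \<le> pi"
    using j unfolding left_diff_distrib bn by (simp add: algebra_simps abs_le_iff)
  then have ba: "\<bar>b - a\<bar> \<le> pi / n"
    using assms by (simp add: abs_mult pos_le_divide_eq)
  let ?y = "of_real (cmod x) * cis b"
  show ?thesis
  proof (rule that[of ?y])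
    show "cmod ?y = cmod x" by (simp add: norm_mult)
    have "?y - x = of_real (cmod x) * (cis b - cis a)"
      by (subst x) (simp add: algebra_simps norm_mult)
    then have "cmod (?y - x) = cmod x * cmod (cis b - cis a)"
      by (simp only: norm_mult norm_of_real abs_norm_cancel)
    also have "\<dots> \<le> cmod x * (4 / n)"
    proof (intro mult_left_mono)
      have "pi / n \<le> 4 / n"
        using pi_less_4 by (intro divide_right_mono) auto
      then show "cmod (cis b - cis a) \<le> 4 / n"
        using norm_cis_diff_le[of b a] ba by linarith
    qed simp
    finally show "cmod (?y - x) \<le> 4 * cmod x / n" by (simp add: mult.commute)
    have "cis b ^ n = cis (b * n)"
      by (simp add: Complex.DeMoivre mult.commute)
    also have "b * n = 2 * pi * of_int j + pi"
      unfolding bn by algebra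
    also have "cis \<dots> = cis (2 * pi * of_int j) * cis pi"
      by (simp only: cis_mult)
    also have "\<dots> = -1"
      by (simp add: cis_multiple_2pi)
    finally show "?y ^ n = - of_real (cmod x ^ n)"
      by (simp add: power_mult_distrib)
  qed
qed

text \<open>These functions form an algebra, and completing the square makes every Gaussian radial around
  some centre.\<close>

inductive_set gauss_ring :: "(complex \<Rightarrow> real) set" where
  const: "(\<lambda>z. c) \<in> gauss_ring"
| gauss: "t > 0 \<Longrightarrow> (\<lambda>z. c * exp (- t * (cmod z)\<^sup>2 + Re (z * v))) \<in> gauss_ring"
| add: "f \<in> gauss_ring \<Longrightarrow> g \<in> gauss_ring \<Longrightarrow> (\<lambda>z. f z + g z) \<in> gauss_ring"

lemma gauss_ring_scale: "f \<in> gauss_ring \<Longrightarrow> (\<lambda>z. c * f z) \<in> gauss_ring"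
proof (induction rule: gauss_ring.induct)
  case (gauss t c' v)
  show ?case using gauss_ring.gauss[OF gauss, of "c * c'" v] by (simp add: mult.assoc)
qed (auto simp: distrib_left intro: gauss_ring.intros)

lemma gauss_ring_mult: "f \<in> gauss_ring \<Longrightarrow> g \<in> gauss_ring \<Longrightarrow> (\<lambda>z. f z * g z) \<in> gauss_ring"
proof (induction rule: gauss_ring.induct)
  case (const c)
  then show ?case by (rule gauss_ring_scale)
next
  case (gauss t c v)
  from gauss(2,1) show ?case
  proof (induction rule: gauss_ring.induct)
    case (const c')
    then show ?case using gauss_ring.gauss[of t "c * c'" v] by (simp add: algebra_simps)
  next
    case (gauss t' c' v')
    have "(\<lambda>z. (c * c') * exp (- (t + t') * (cmod z)\<^sup>2 + Re (z * (v + v')))) \<in> gauss_ring"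
      using gauss by (intro gauss_ring.gauss) auto
    moreover have eq: "(c * c') * exp (- (t + t') * (cmod z)\<^sup>2 + Re (z * (v + v')))
       = c * exp (- t * (cmod z)\<^sup>2 + Re (z * v)) * (c' * exp (- t' * (cmod z)\<^sup>2 + Re (z * v')))" for z
    proof -
      have "- (t + t') * (cmod z)\<^sup>2 + Re (z * (v + v')) = (- t * (cmod z)\<^sup>2 + Re (z * v)) + (- t' * (cmod z)\<^sup>2 + Re (z * v'))"
        by (simp add: algebra_simps)
      then show ?thesis by (simp only: exp_add) (simp only: ac_simps)
    qed
    ultimately show ?case by (simp only:)
  next
    case (add f g)
    then show ?case using gauss_ring.add by (simp add: distrib_left)
  qed
next
  case (add f g)
  then show ?case using gauss_ring.add by (simp add: distrib_right)
qed

lemma gauss_ring_continuous: "f \<in> gauss_ring \<Longrightarrow> continuous_on S f"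
  by (induction rule: gauss_ring.induct) (auto intro!: continuous_intros)

section \<open>From logarithms to radial functions and to all continuous functions\<close>

context jordan_domain
begin

text \<open>If \<open>u\<close> is at distance at least s from the frontier, its own logarithm can
  be used; otherwise the smoothed logarithm at a nearest frontier point. The displaced distance
  \<open>a\<close> is quantified after \<open>y\<close>, since in the application it depends on z
  while one \<open>y\<close> must serve all z.\<close>

lemma ln_replacement:
  obtains r0 :: real where "r0 > 0" "\<And>u s c. 0 < s \<Longrightarrow> s < r0 \<Longrightarrow> 0 < c \<Longrightarrow>
    \<exists>y\<in>log_closure. \<forall>z\<in>frontier D. \<forall>a. \<bar>a - cmod (z - u)\<bar> \<le> 4 * s \<longrightarrow> c * s \<le> a \<longrightarrow>
       \<bar>y z - ln a\<bar> \<le> 30 + \<bar>ln c\<bar> \<and> (10 * s \<le> a \<longrightarrow> \<bar>y z - ln a\<bar> \<le> 30 * s / a)"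
proof -
  obtain r0 :: real where r0: "r0 > 0" "\<And>b \<delta>. b \<in> frontier D \<Longrightarrow> 0 < \<delta> \<Longrightarrow> \<delta> < r0 \<Longrightarrow>
    \<exists>v\<in>log_closure. \<forall>z\<in>frontier D. (cmod (z - b) \<le> 2 * \<delta> \<longrightarrow> \<bar>v z - ln \<delta>\<bar> \<le> 7) \<and>
       (2 * \<delta> \<le> cmod (z - b) \<longrightarrow> \<bar>v z - ln (cmod (z - b))\<bar> \<le> 2 * \<delta> / cmod (z - b))"
    using smoothed_ln_exists by blast
  have lnb: "\<bar>ln x\<bar> \<le> x - 1" if "x \<ge> 1" for x :: real
    using ln_le_minus_one[of x] that by simp
  show ?thesis
  proof (rule that[OF r0(1)])
    fix u :: complex and s c :: real assume s: "0 < s" "s < r0" and c: "0 < c"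
    have near_a: "\<bar>ln a - ln s\<bar> \<le> \<bar>ln c\<bar> + 9" if "c * s \<le> a" "a < 10 * s" for a
      using abs_ln_le_of_between[OF s(1) c that(1), of 10] that(2) lnb[of 10] by simp
    have far1: "30 * s / a \<le> 3" if "10 * s \<le> a" for a
      using that s(1) by (simp add: divide_le_eq)
    show "\<exists>y\<in>log_closure. \<forall>z\<in>frontier D. \<forall>a. \<bar>a - cmod (z - u)\<bar> \<le> 4 * s \<longrightarrow> c * s \<le> a \<longrightarrow>
       \<bar>y z - ln a\<bar> \<le> 30 + \<bar>ln c\<bar> \<and> (10 * s \<le> a \<longrightarrow> \<bar>y z - ln a\<bar> \<le> 30 * s / a)"
    proof (cases "s \<le> infdist u (frontier D)")
      case True
      then have "u \<notin> frontier D" using s(1) by auto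
      then have Yu: "(\<lambda>z. ln (cmod (z - u))) \<in> log_closure" by (rule log_closure_ln)
      show ?thesis
      proof (intro bexI[OF _ Yu] ballI allI impI)
        fix z and a :: real assume z: "z \<in> frontier D" and a: "\<bar>a - cmod (z - u)\<bar> \<le> 4 * s" "c * s \<le> a"
        define x where "x = cmod (z - u)"
        have xs: "s \<le> x" unfolding x_def using infdist_frontier_le[OF z, of u] True by simp
        have far: "\<bar>ln x - ln a\<bar> \<le> 30 * s / a" if "10 * s \<le> a"
        proof -
          have "\<bar>ln x - ln a\<bar> \<le> 2 * (4 * s) / a"
            using a that s(1) by (intro abs_ln_diff_le) (auto simp: x_def)
          also have "\<dots> \<le> 30 * s / a"
            using that s(1) by (intro divide_right_mono) auto
          finally show ?thesis .
        qed
        moreover have "\<bar>ln x - ln a\<bar> \<le> 30 + \<bar>ln c\<bar>"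
        proof (cases "10 * s \<le> a")
          case True
          then show ?thesis using far far1[OF True] by linarith
        next
          case False
          have "\<bar>ln x - ln s\<bar> \<le> \<bar>ln 1\<bar> + \<bar>ln 14\<bar>"
            using xs s False a(1) by (intro abs_ln_le_of_between) (auto simp: x_def)
          then show ?thesis using near_a[OF a(2)] False lnb[of 14] by simp
        qed
        ultimately show "\<bar>ln (cmod (z - u)) - ln a\<bar> \<le> 30 + \<bar>ln c\<bar> \<and>
           (10 * s \<le> a \<longrightarrow> \<bar>ln (cmod (z - u)) - ln a\<bar> \<le> 30 * s / a)"
          by (simp add: x_def)
      qed
    next
      case False
      obtain b where b: "b \<in> frontier D" "dist u b = infdist u (frontier D)"
        using nearest_frontier_point by blast
      obtain v where v: "v \<in> log_closure" "\<And>z. z \<in> frontier D \<Longrightarrow> cmod (z - b) \<le> 2 * s \<Longrightarrow> \<bar>v z - ln s\<bar> \<le> 7"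
        "\<And>z. z \<in> frontier D \<Longrightarrow> 2 * s \<le> cmod (z - b) \<Longrightarrow> \<bar>v z - ln (cmod (z - b))\<bar> \<le> 2 * s / cmod (z - b)"
        using r0(2)[OF b(1) s] by blast
      show ?thesis
      proof (intro bexI[OF _ v(1)] ballI allI impI)
        fix z and a :: real assume z: "z \<in> frontier D" and a: "\<bar>a - cmod (z - u)\<bar> \<le> 4 * s" "c * s \<le> a"
        define x where "x = cmod (z - b)"
        have "\<bar>cmod (z - u) - x\<bar> \<le> cmod (b - u)"
          unfolding x_def using norm_triangle_ineq3[of "z - u" "z - b"] by simp
        also have "\<dots> \<le> s"
          using b(2) False by (simp add: dist_norm norm_minus_commute)
        finally have ax: "\<bar>x - a\<bar> \<le> 5 * s" using a(1) by linarith
        have far: "\<bar>v z - ln a\<bar> \<le> 30 * s / a" if "10 * s \<le> a"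
        proof -
          have "\<bar>ln x - ln a\<bar> \<le> 2 * (5 * s) / a"
            using ax that s(1) by (intro abs_ln_diff_le) auto
          moreover have x: "a / 2 \<le> x" "2 * s \<le> x" using that ax s(1) by auto
          moreover have "\<bar>v z - ln x\<bar> \<le> 2 * s / x"
            using v(3)[OF z] x by (simp add: x_def)
          moreover have "2 * s / x \<le> 2 * s / (a / 2)"
            using x s that by (intro divide_left_mono) auto
          ultimately have "\<bar>v z - ln a\<bar> \<le> 2 * (5 * s) / a + 4 * s / a"
            by simp
          also have "\<dots> = 14 * s / a"
            by (simp add: add_divide_distrib[symmetric])
          also have "\<dots> \<le> 30 * s / a"
            using that s(1) by (intro divide_right_mono) auto
          finally show ?thesis .
        qed
        moreover have "\<bar>v z - ln a\<bar> \<le> 30 + \<bar>ln c\<bar>"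
        proof (cases "10 * s \<le> a")
          case True
          then show ?thesis using far far1[OF True] by linarith
        next
          case F: False
          have "\<bar>v z - ln s\<bar> \<le> 17"
          proof (cases "2 * s \<le> x")
            case True
            then have "2 * s / x \<le> 1" using s(1) by (simp add: divide_le_eq)
            moreover have "\<bar>v z - ln x\<bar> \<le> 2 * s / x"
              using v(3)[OF z] True by (simp add: x_def)
            moreover have "\<bar>ln x - ln s\<bar> \<le> \<bar>ln 2\<bar> + \<bar>ln 15\<bar>"
              using s True F ax by (intro abs_ln_le_of_between) auto
            ultimately show ?thesis using lnb[of 2] lnb[of 15] by linarith
          next
            case False
            then show ?thesis using v(2)[OF z] by (simp add: x_def)
          qed
          then show ?thesis using near_a[OF a(2)] F by linarith
        qed
        ultimately show "\<bar>v z - ln a\<bar> \<le> 30 + \<bar>ln c\<bar> \<and> (10 * s \<le> a \<longrightarrow> \<bar>v z - ln a\<bar> \<le> 30 * s / a)"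
          by blast
      qed
    qed
  qed
qed

text \<open>\<open>ln (max (cmod (z - w)) r)\<close> is the mean of \<open>ln (cmod (z - u))\<close> over the circle \<open>cmod (u - w) = r\<close>.
  The mean is discretised by \<open>n\<close> equidistant points; rotating \<open>z\<close> slightly keeps it away from all of them
  and makes \<open>(z - w) ^ n\<close> negative.\<close>

lemma log_closure_ln_max:
  assumes r: "r > 0"
  shows "(\<lambda>z. ln (max (cmod (z - w)) r)) \<in> log_closure"
proof (rule log_closure_limit)
  fix \<epsilon> :: real assume \<epsilon>: "\<epsilon> > 0"
  obtain B where B: "B > 0" "\<And>z. z \<in> closure D \<Longrightarrow> cmod z \<le> B"
    using diameter_bound by metis
  define R where "R = B + cmod w + r"
  have R: "R > 0" "r \<le> R" using B r by (auto simp: R_def add_pos_nonneg)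
  have RR: "cmod (z - w) + r \<le> R" if "z \<in> frontier D" for z
    using B(2)[OF frontier_in_closure[OF that]] norm_triangle_ineq4[of z w] by (simp add: R_def)
  obtain r0 :: real where r0: "r0 > 0" "\<And>u s c. 0 < s \<Longrightarrow> s < r0 \<Longrightarrow> 0 < c \<Longrightarrow>
    \<exists>y\<in>log_closure. \<forall>z\<in>frontier D. \<forall>a. \<bar>a - cmod (z - u)\<bar> \<le> 4 * s \<longrightarrow> c * s \<le> a \<longrightarrow>
       \<bar>y z - ln a\<bar> \<le> 30 + \<bar>ln c\<bar> \<and> (10 * s \<le> a \<longrightarrow> \<bar>y z - ln a\<bar> \<le> 30 * s / a)"
    using ln_replacement by blast
  \<comment> \<open>With s = R / n below, \<open>c * s\<close> is r / (2 * n), the lower bound that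
    \<open>dist_nth_root_ge\<close> gives for the distances to the roots.\<close>
  define c where "c = r / (2 * R)"
  have c: "c > 0" using r R by (simp add: c_def)
  define b where "b = \<bar>ln R - ln r\<bar> + 1"
  have b: "b > 0" by (simp add: b_def)
  have ke: "\<epsilon> / (4 * b) > 0" "\<epsilon> / 4 > 0" using \<epsilon> b by auto
  have C: "30 + \<bar>ln c\<bar> > 0" by (simp add: add_pos_nonneg)
  obtain s0 where s0: "s0 > 0" "\<And>s a e. 0 < s \<Longrightarrow> s \<le> s0 \<Longrightarrow> 0 < a \<Longrightarrow> a \<le> R \<Longrightarrow> e \<le> 30 + \<bar>ln c\<bar> \<Longrightarrow>
      (10 * s \<le> a \<Longrightarrow> e \<le> (30 + \<bar>ln c\<bar>) * s / a) \<Longrightarrow> e \<le> \<epsilon> / (4 * b) * (ln R - ln a) + \<epsilon> / 4"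
    using error_dominated_by_ln[OF C _ R(1) ke, of 10] by (metis zero_less_numeral)
  obtain n0 :: nat where n0: "max (R / s0) (max (R / r0) (4 / \<epsilon>)) < real n0"
    using reals_Archimedean2 by blast
  define n where "n = Suc n0"
  have n: "n > 0" "R / s0 < n" "R / r0 < n" "4 / \<epsilon> < n"
    using n0 by (auto simp: n_def)
  \<comment> \<open>At this scale the rotation moves \<open>z - w\<close> by at most 4 * s, as
    \<open>ln_replacement\<close> permits.\<close>
  define s where "s = R / n"
  have s: "0 < s" "s \<le> s0" "s < r0"
    using n R s0(1) r0(1) by (auto simp: s_def field_simps)
  have n\<epsilon>: "1 / n \<le> \<epsilon> / 4"
    using n \<epsilon> by (simp add: field_simps)
  define u where "u = (\<lambda>k::nat. of_real r * cis (2 * pi * real k / real n))"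
  obtain y where y: "\<And>k. y k \<in> log_closure" "\<And>k z a. z \<in> frontier D \<Longrightarrow> \<bar>a - cmod (z - (w + u k))\<bar> \<le> 4 * s \<Longrightarrow> c * s \<le> a \<Longrightarrow>
       \<bar>y k z - ln a\<bar> \<le> 30 + \<bar>ln c\<bar> \<and> (10 * s \<le> a \<longrightarrow> \<bar>y k z - ln a\<bar> \<le> 30 * s / a)"
  proof -
    have "\<forall>k. \<exists>y. y \<in> log_closure \<and> (\<forall>z\<in>frontier D. \<forall>a. \<bar>a - cmod (z - (w + u k))\<bar> \<le> 4 * s \<longrightarrow> c * s \<le> a \<longrightarrow>
       \<bar>y z - ln a\<bar> \<le> 30 + \<bar>ln c\<bar> \<and> (10 * s \<le> a \<longrightarrow> \<bar>y z - ln a\<bar> \<le> 30 * s / a))"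
      using r0(2)[OF s(1,3) c] by blast
    from choice[OF this] that show ?thesis by blast
  qed
  have "(\<lambda>z. \<Sum>k<n. y k z) \<in> log_closure"
    using y(1) by (intro log_closure_sum) auto
  from log_closure_scale[OF this, of "1 / real n"] have YY: "(\<lambda>z. (\<Sum>k<n. y k z) / real n) \<in> log_closure"
    by simp
  have fin: "\<bar>ln (max (cmod (z - w)) r) - (\<Sum>k<n. y k z) / real n\<bar> \<le> \<epsilon>" if z: "z \<in> frontier D" for z
  proof -
    define \<rho> where "\<rho> = cmod (z - w)"
    have \<rho>: "\<rho> \<ge> 0" "\<rho> + r \<le> R" using RR[OF z] by (auto simp: \<rho>_def)
    obtain x where x: "cmod x = \<rho>" "cmod (x - (z - w)) \<le> 4 * \<rho> / real n" "x ^ n = - of_real (\<rho> ^ n)"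
      using rotate_to_negative_power[OF n(1), of "z - w"] unfolding \<rho>_def by blast
    define a where "a = (\<lambda>k. cmod (x - u k))"
    have un: "u k ^ n = of_real (r ^ n)" "cmod (u k) = r" for k
    proof -
      have "real n * (2 * pi * real k / real n) = 2 * pi * real k"
        using n(1) by simp
      then have "cis (2 * pi * real k / real n) ^ n = cis (2 * pi * real k)"
        by (metis Complex.DeMoivre)
      also have "\<dots> = 1" by (simp add: cis_multiple_2pi)
      finally show "u k ^ n = of_real (r ^ n)" by (simp add: u_def power_mult_distrib)
      show "cmod (u k) = r" using r by (simp add: u_def norm_mult)
    qed
    have a_ge: "c * s \<le> a k" for k
    proof -
      have "r / (2 * real n) \<le> a k"
        unfolding a_def using \<rho>(1) by (intro dist_nth_root_ge[OF n(1) r un x(3)]) auto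
      moreover have "c * s = r / (2 * real n)"
        using R n(1) by (simp add: c_def s_def)
      ultimately show ?thesis by simp
    qed
    have a_pos: "0 < a k" for k
      using a_ge[of k] c s(1) by (meson less_le_trans mult_pos_pos)
    have a_R: "a k \<le> R" for k
      using norm_triangle_ineq4[of x "u k"] x(1) un(2)[of k] \<rho>(2) by (simp add: a_def)
    have a_z: "\<bar>a k - cmod (z - (w + u k))\<bar> \<le> 4 * s" for k
    proof -
      have "\<bar>a k - cmod (z - (w + u k))\<bar> \<le> cmod ((x - u k) - (z - (w + u k)))"
        unfolding a_def by (rule norm_triangle_ineq3)
      also have "(x - u k) - (z - (w + u k)) = x - (z - w)" by simp
      also have "cmod \<dots> \<le> 4 * \<rho> / n" by (rule x(2))
      also have "\<dots> \<le> 4 * R / n" using \<rho> r n(1) by (intro divide_right_mono) auto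
      finally show ?thesis by (simp add: s_def)
    qed
    have err: "\<bar>y k z - ln (a k)\<bar> \<le> \<epsilon> / (4 * b) * (ln R - ln (a k)) + \<epsilon> / 4" for k
    proof (rule s0(2)[OF s(1,2) a_pos a_R])
      show "\<bar>y k z - ln (a k)\<bar> \<le> 30 + \<bar>ln c\<bar>"
        using y(2)[OF z a_z a_ge] by blast
      assume "10 * s \<le> a k"
      then have "\<bar>y k z - ln (a k)\<bar> \<le> 30 * s / a k"
        using y(2)[OF z a_z a_ge] by blast
      also have "\<dots> \<le> (30 + \<bar>ln c\<bar>) * s / a k"
        using s(1) a_pos[of k] by (intro divide_right_mono mult_right_mono) auto
      finally show "\<bar>y k z - ln (a k)\<bar> \<le> (30 + \<bar>ln c\<bar>) * s / a k" .
    qed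
    define P where "P = (\<Sum>k<n. ln (a k)) / n"
    have "(\<Sum>k<n. ln (a k)) = ln (cmod (x ^ n - of_real r ^ n))"
      unfolding a_def u_def using a_pos by (intro sum_ln_roots_of_unity n) (auto simp: a_def u_def)
    also have "x ^ n - of_real r ^ n = of_real (- (\<rho> ^ n + r ^ n))"
      by (simp add: x(3))
    also have "cmod \<dots> = \<rho> ^ n + r ^ n"
    proof -
      have "0 \<le> \<rho> ^ n + r ^ n" using \<rho> r by simp
      then show ?thesis by (simp only: norm_of_real abs_minus_cancel abs_of_nonneg)
    qed
    finally have P: "P = ln (\<rho> ^ n + r ^ n) / n"
      by (simp add: P_def)
    \<comment> \<open>The larger of the two powers dominates: \<open>\<rho> ^ n + r ^ n\<close> lies
      between \<open>M ^ n\<close> and twice that, so \<open>P\<close> is within 1 / n of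
      \<open>ln M\<close>.\<close>
    define M where "M = max \<rho> r"
    have M: "M > 0" "r \<le> M" using r by (auto simp: M_def)
    have "M ^ n \<le> \<rho> ^ n + r ^ n" "\<rho> ^ n + r ^ n \<le> 2 * M ^ n"
      using \<rho> r power_mono[of \<rho> M n] power_mono[of r M n] unfolding M_def by (auto simp: max_def)
    then have "ln (M ^ n) \<le> ln (\<rho> ^ n + r ^ n)" "ln (\<rho> ^ n + r ^ n) \<le> ln (2 * M ^ n)"
      using M(1) \<rho>(1) r by (auto intro!: ln_mono add_nonneg_pos)
    then have "n * ln M \<le> ln (\<rho> ^ n + r ^ n)" "ln (\<rho> ^ n + r ^ n) \<le> 1 + n * ln M"
      using M(1) ln_2_less_1 by (auto simp: ln_realpow ln_mult)
    then have PM: "ln M \<le> P" "P \<le> ln M + 1 / n"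
      using n(1) unfolding P by (simp_all add: field_simps)
    have "\<bar>\<Sum>k<n. y k z - ln (a k)\<bar> \<le> (\<Sum>k<n. \<epsilon> / (4 * b) * (ln R - ln (a k)) + \<epsilon> / 4)"
      using err by (intro order_trans[OF sum_abs] sum_mono) auto
    then have "\<bar>\<Sum>k<n. y k z - ln (a k)\<bar> / n \<le> (\<Sum>k<n. \<epsilon> / (4 * b) * (ln R - ln (a k)) + \<epsilon> / 4) / n"
      by (rule divide_right_mono) simp
    moreover have "\<bar>\<Sum>k<n. y k z - ln (a k)\<bar> / n = \<bar>(\<Sum>k<n. y k z) / n - P\<bar>"
      by (simp add: P_def sum_subtractf diff_divide_distrib[symmetric])
    moreover have "(\<Sum>k<n. \<epsilon> / (4 * b) * (ln R - ln (a k)) + \<epsilon> / 4) / n = \<epsilon> / (4 * b) * (ln R - P) + \<epsilon> / 4"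
    proof -
      have "(\<Sum>k<n. \<epsilon> / (4 * b) * (ln R - ln (a k)) + \<epsilon> / 4) = \<epsilon> / (4 * b) * (\<Sum>k<n. ln R - ln (a k)) + n * (\<epsilon> / 4)"
        by (simp add: sum.distrib sum_distrib_left)
      also have "(\<Sum>k<n. ln R - ln (a k)) = n * (ln R - P)"
        using n(1) by (simp add: sum_subtractf P_def right_diff_distrib)
      finally show ?thesis using n(1) by (simp add: add_divide_distrib)
    qed
    moreover have "\<epsilon> / (4 * b) * (ln R - P) \<le> \<epsilon> / 4"
    proof -
      have "ln r \<le> ln M" using M r by simp
      then have "ln r \<le> P" using PM(1) by linarith
      then have "\<epsilon> / (4 * b) * (ln R - P) \<le> \<epsilon> / (4 * b) * b"
        using ke(1) by (intro mult_left_mono) (auto simp: b_def)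
      then show ?thesis using b by simp
    qed
    ultimately have "\<bar>(\<Sum>k<n. y k z) / n - P\<bar> \<le> \<epsilon> / 2" by simp
    then have "\<bar>ln M - (\<Sum>k<n. y k z) / n\<bar> \<le> \<epsilon>"
      using PM n\<epsilon> unfolding abs_le_iff by linarith
    then show ?thesis
      by (simp only: M_def \<rho>_def)
  qed
  show "\<exists>v\<in>log_closure. \<forall>z\<in>frontier D. \<bar>ln (max (cmod (z - w)) r) - v z\<bar> \<le> \<epsilon>"
    by (rule bexI[OF _ YY]) (rule ballI, rule fin)
qed

text \<open>\<open>log_closure\<close> is a linear space but not visibly an algebra, so
  \<open>k\<close> is replaced by a piecewise linear interpolant, which is a combination of
  truncations \<open>max (X z) c\<close>.\<close>

lemma log_closure_compose:
  assumes AB: "lo < hi" and X: "\<And>z. z \<in> frontier D \<Longrightarrow> lo \<le> X z \<and> X z \<le> hi"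
    and YX: "\<And>c. lo \<le> c \<Longrightarrow> (\<lambda>z. max (X z) c) \<in> log_closure"
    and k: "continuous_on {lo..hi} k"
  shows "(\<lambda>z. k (X z)) \<in> log_closure"
proof (rule log_closure_limit)
  fix \<epsilon> :: real assume \<epsilon>: "\<epsilon> > 0"
  have "uniformly_continuous_on {lo..hi} k"
    using k by (intro compact_uniformly_continuous) auto
  then obtain \<delta> where \<delta>: "\<delta> > 0" "\<And>x x'. x \<in> {lo..hi} \<Longrightarrow> x' \<in> {lo..hi} \<Longrightarrow> \<bar>x' - x\<bar> < \<delta> \<Longrightarrow> \<bar>k x' - k x\<bar> < \<epsilon> / 2"
    using \<epsilon> unfolding uniformly_continuous_on_def dist_real_def by (metis half_gt_zero)
  obtain n0 :: nat where n0: "(hi - lo) / \<delta> < real n0"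
    using reals_Archimedean2 by blast
  define n where "n = Suc n0"
  define h where "h = (hi - lo) / n"
  have n: "n > 0" "(hi - lo) / \<delta> < real n" using n0 by (auto simp: n_def)
  have h: "h > 0" "h < \<delta>" "n * h = hi - lo"
    using n AB \<delta>(1) by (auto simp: h_def field_simps)
  define p where "p = (\<lambda>i::nat. lo + i * h)"
  have p: "lo \<le> p i" "p (Suc i) = p i + h" for i
    using h by (auto simp: p_def algebra_simps)
  have pB: "p i \<le> hi" if "i \<le> n" for i
  proof -
    have "i * h \<le> n * h" using that h by (intro mult_right_mono) auto
    then show ?thesis using h by (simp add: p_def)
  qed
  have p_mono: "p i \<le> p j" if "i \<le> j" for i j
    using that h by (auto simp: p_def intro!: mult_right_mono)
  \<comment> \<open>A ramp in \<open>X z\<close> that is 0 up to \<open>p i\<close> and 1 from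
    \<open>p (Suc i)\<close> on; \<open>T\<close> is then the interpolant of \<open>k\<close> at the
    nodes.\<close>
  define \<phi> where "\<phi> = (\<lambda>i z. (max (X z) (p i) - max (X z) (p (Suc i)) + h) / h)"
  define T where "T = (\<lambda>z. k (p 0) + (\<Sum>i<n. (k (p (Suc i)) - k (p i)) * \<phi> i z))"
  have "(\<lambda>z. (max (X z) (p i) - max (X z) (p (Suc i))) + h) \<in> log_closure" for i
    by (intro log_closure_add log_closure_diff YX log_closure_const p(1))
  then have "(\<lambda>z. 1 / h * ((max (X z) (p i) - max (X z) (p (Suc i))) + h)) \<in> log_closure" for i
    by (rule log_closure_scale)
  then have \<phi>Y: "\<phi> i \<in> log_closure" for i
    by (simp add: \<phi>_def[abs_def])
  have TY: "T \<in> log_closure"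
    unfolding T_def by (intro log_closure_add log_closure_const log_closure_sum log_closure_scale \<phi>Y)
  have "\<bar>k (X z) - T z\<bar> \<le> \<epsilon>" if z: "z \<in> frontier D" for z
  proof -
    \<comment> \<open>The minimum with n - 1 puts the right end point \<open>hi\<close> into the
      last interval.\<close>
    define j where "j = min (nat \<lfloor>(X z - lo) / h\<rfloor>) (n - 1)"
    have Xz: "lo \<le> X z" "X z \<le> hi" using X[OF z] by auto
    have f: "real (nat \<lfloor>(X z - lo) / h\<rfloor>) \<le> (X z - lo) / h" "(X z - lo) / h < real (nat \<lfloor>(X z - lo) / h\<rfloor>) + 1"
      using Xz h by (auto simp: of_nat_nat floor_le_iff)
    have jn: "j < n" using n by (auto simp: j_def)
    have j: "p j \<le> X z" "X z \<le> p (Suc j)"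
    proof -
      have "real j \<le> (X z - lo) / h" using f by (auto simp: j_def min_def)
      then show "p j \<le> X z" using h by (simp add: p_def field_simps)
      show "X z \<le> p (Suc j)"
      proof (cases "nat \<lfloor>(X z - lo) / h\<rfloor> \<le> n - 1")
        case True
        then have "(X z - lo) / h \<le> real j + 1" using f by (simp add: j_def min_def)
        then show ?thesis using h by (simp add: p_def field_simps)
      next
        case False
        then have "Suc j = n" using n by (simp add: j_def)
        then show ?thesis using h Xz by (simp add: p_def)
      qed
    qed
    have \<phi>1: "\<phi> i z = 1" if "i < j" for i
    proof -
      have "p i \<le> p j" "p (Suc i) \<le> p j" using that by (auto intro: p_mono)
      then show ?thesis using j h by (simp add: \<phi>_def max_def)
    qed
    have \<phi>0: "\<phi> i z = 0" if "j < i" for i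
    proof -
      have "p (Suc j) \<le> p i" using that by (auto intro: p_mono)
      then show ?thesis using j h p(2)[of i] by (simp add: \<phi>_def max_def)
    qed
    have \<phi>j: "0 \<le> \<phi> j z" "\<phi> j z \<le> 1"
      using j h p(2)[of j] by (auto simp: \<phi>_def max_def field_simps)
    have "(\<Sum>i<n. (k (p (Suc i)) - k (p i)) * \<phi> i z) = (\<Sum>i<Suc j. (k (p (Suc i)) - k (p i)) * \<phi> i z)"
      using jn \<phi>0 by (intro sum.mono_neutral_right) auto
    also have "\<dots> = (\<Sum>i<j. k (p (Suc i)) - k (p i)) + (k (p (Suc j)) - k (p j)) * \<phi> j z"
      using \<phi>1 by simp
    also have "(\<Sum>i<j. k (p (Suc i)) - k (p i)) = k (p j) - k (p 0)"
      by (rule sum_lessThan_telescope)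
    finally have T: "T z = k (p j) + (k (p (Suc j)) - k (p j)) * \<phi> j z"
      by (simp add: T_def)
    have "\<bar>k (X z) - k (p j)\<bar> < \<epsilon> / 2" "\<bar>k (p (Suc j)) - k (p j)\<bar> < \<epsilon> / 2"
      using \<delta>(2)[of "p j" "X z"] \<delta>(2)[of "p j" "p (Suc j)"]
        j Xz h p(1)[of j] p(2)[of j] pB[of j] pB[of "Suc j"] jn by auto
    moreover have "\<bar>(k (p (Suc j)) - k (p j)) * \<phi> j z\<bar> \<le> \<bar>k (p (Suc j)) - k (p j)\<bar>"
      using \<phi>j by (simp add: abs_mult mult_left_le)
    ultimately show ?thesis unfolding T by linarith
  qed
  then show "\<exists>v\<in>log_closure. \<forall>z\<in>frontier D. \<bar>k (X z) - v z\<bar> \<le> \<epsilon>"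
    using TY by blast
qed

text \<open>The truncated logarithm suits \<open>log_closure_compose\<close>, as its further
  truncations are of the same kind. Truncating at a small radius removes the singularity and changes
  \<open>k\<close> little by uniform continuity.\<close>

lemma log_closure_radial:
  assumes k: "continuous_on UNIV (k :: real \<Rightarrow> real)"
  shows "(\<lambda>z. k (cmod (z - w))) \<in> log_closure"
proof (rule log_closure_limit)
  fix \<epsilon> :: real assume \<epsilon>: "\<epsilon> > 0"
  obtain B where B: "B > 0" "\<And>z. z \<in> closure D \<Longrightarrow> cmod z \<le> B"
    using diameter_bound by metis
  define R where "R = B + cmod w + 1"
  have R: "1 \<le> R" using B by (simp add: R_def)
  have RR: "cmod (z - w) \<le> R" if "z \<in> frontier D" for z
    using B(2)[OF frontier_in_closure[OF that]] norm_triangle_ineq4[of z w] by (simp add: R_def)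
  have "uniformly_continuous_on {0..R} k"
    using continuous_on_subset[OF k] by (intro compact_uniformly_continuous) auto
  then obtain \<delta> where \<delta>: "\<delta> > 0" "\<And>x x'. x \<in> {0..R} \<Longrightarrow> x' \<in> {0..R} \<Longrightarrow> \<bar>x' - x\<bar> < \<delta> \<Longrightarrow> \<bar>k x' - k x\<bar> < \<epsilon>"
    using \<epsilon> unfolding uniformly_continuous_on_def dist_real_def by metis
  define r where "r = min (\<delta> / 2) (1 / 2)"
  have r: "0 < r" "r < \<delta>" "r < R" using \<delta>(1) R by (auto simp: r_def)
  let ?X = "\<lambda>z. ln (max (cmod (z - w)) r)"
  have YY: "(\<lambda>z. (k \<circ> exp) (?X z)) \<in> log_closure"
  proof (rule log_closure_compose[where lo="ln r" and hi="ln R" and X = "?X" and k="k \<circ> exp"])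
    show "ln r < ln R" using r by simp
    show "ln r \<le> ?X z \<and> ?X z \<le> ln R" if "z \<in> frontier D" for z
      using r RR[OF that] by (auto intro!: ln_mono)
    show "(\<lambda>z. max (?X z) c) \<in> log_closure" if "ln r \<le> c" for c
    proof -
      have "max (?X z) c = ln (max (cmod (z - w)) (exp c))" for z
      proof -
        have rc: "r \<le> exp c" using that r by (metis exp_le_cancel_iff exp_ln)
        have "max (ln x) c = ln (max x (exp c))" if "x > 0" for x
        proof -
          have "x \<le> exp c \<longleftrightarrow> ln x \<le> c"
            using that by (metis exp_le_cancel_iff exp_ln)
          then show ?thesis by (auto simp: max_def)
        qed
        then have "max (?X z) c = ln (max (max (cmod (z - w)) r) (exp c))"
          using r by auto
        then show ?thesis using rc by (simp add: max.assoc max_absorb2)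
      qed
      then show ?thesis using log_closure_ln_max[of "exp c" w] by simp
    qed
    show "continuous_on {ln r..ln R} (k \<circ> exp)"
      by (intro continuous_on_compose continuous_on_subset[OF k] continuous_intros) auto
  qed
  have fin: "\<bar>k (cmod (z - w)) - (k \<circ> exp) (?X z)\<bar> \<le> \<epsilon>" if "z \<in> frontier D" for z
  proof -
    have "exp (?X z) = max (cmod (z - w)) r" using r by simp
    moreover have "\<bar>k (cmod (z - w)) - k (max (cmod (z - w)) r)\<bar> < \<epsilon>"
    proof (rule \<delta>(2))
      show "\<bar>cmod (z - w) - max (cmod (z - w)) r\<bar> < \<delta>"
        using r norm_ge_zero[of "z - w"] unfolding max_def by (simp only: split: if_split) linarith
    qed (use r RR[OF that] in auto)
    ultimately show ?thesis by simp
  qed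
  show "\<exists>v\<in>log_closure. \<forall>z\<in>frontier D. \<bar>k (cmod (z - w)) - v z\<bar> \<le> \<epsilon>"
    by (rule bexI[OF _ YY]) (rule ballI, rule fin)
qed

lemma gauss_ring_log_closure: "f \<in> gauss_ring \<Longrightarrow> f \<in> log_closure"
proof (induction rule: gauss_ring.induct)
  case (gauss t c v)
  \<comment> \<open>The centre found by completing the square, so that v = 2 * t * cnj w; the factor
    \<open>exp (t * (cmod w)\<^sup>2)\<close> restores the constant.\<close>
  define w where "w = cnj v / of_real (2 * t)"
  have "continuous_on UNIV (\<lambda>x::real. exp (- t * x\<^sup>2))"
    by (intro continuous_intros)
  from log_closure_radial[OF this, of w] have "(\<lambda>z. exp (- t * (cmod (z - w))\<^sup>2)) \<in> log_closure" .
  from log_closure_scale[OF this, of "c * exp (t * (cmod w)\<^sup>2)"]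
  have "(\<lambda>z. c * exp (t * (cmod w)\<^sup>2) * exp (- t * (cmod (z - w))\<^sup>2)) \<in> log_closure" .
  moreover have "c * exp (t * (cmod w)\<^sup>2) * exp (- t * (cmod (z - w))\<^sup>2) = c * exp (- t * (cmod z)\<^sup>2 + Re (z * v))" for z
  proof -
    have v: "v = of_real (2 * t) * cnj w"
      using gauss by (simp add: w_def)
    have "t * (cmod w)\<^sup>2 + - t * (cmod (z - w))\<^sup>2 = - t * (cmod z)\<^sup>2 + Re (z * v)"
      unfolding cmod_power2 v by (simp add: power2_eq_square algebra_simps)
    then show ?thesis by (simp only: exp_add[symmetric] mult.assoc)
  qed
  ultimately show ?case by (simp only:)
qed (auto intro: log_closure_const log_closure_add)

text \<open>Stone-Weierstrass needs an algebra; \<open>gauss_ring\<close> is one that lies inside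
  the linear space \<open>log_closure\<close>.\<close>

theorem log_closure_continuous:
  assumes "continuous_on (frontier D) u"
  shows "u \<in> log_closure"
proof -
  interpret function_ring_on gauss_ring "frontier D"
  proof
    fix x y :: complex assume xy: "x \<noteq> y"
    \<comment> \<open>Up to a factor this is the Gaussian centred at \<open>x\<close>, which has its
      strict maximum there and so separates \<open>x\<close> from \<open>y\<close>.\<close>
    let ?f = "\<lambda>z. 1 * exp (- 1 * (cmod z)\<^sup>2 + Re (z * (2 * cnj x)))"
    have f: "?f z = exp ((cmod x)\<^sup>2) * exp (- (cmod (z - x))\<^sup>2)" for z
      unfolding cmod_power2 exp_add[symmetric] by (simp add: power2_eq_square algebra_simps)
    show "\<exists>f\<in>gauss_ring. f x \<noteq> f y"
    proof (rule bexI[of _ ?f])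
      show "?f x \<noteq> ?f y"
        unfolding f using xy by auto
      show "?f \<in> gauss_ring"
        using gauss_ring.gauss[OF zero_less_one] .
    qed
  qed (auto intro: gauss_ring.intros gauss_ring_mult gauss_ring_continuous compact_frontier_D)
  show ?thesis
  proof (rule log_closure_limit)
    fix \<epsilon> :: real assume "\<epsilon> > 0"
    then obtain g where g: "g \<in> gauss_ring" "\<forall>z\<in>frontier D. \<bar>u z - g z\<bar> < \<epsilon>"
      using Stone_Weierstrass_basic[OF assms] by blast
    show "\<exists>v\<in>log_closure. \<forall>z\<in>frontier D. \<bar>u z - v z\<bar> \<le> \<epsilon>"
      by (rule bexI[OF _ gauss_ring_log_closure[OF g(1)]]) (use g(2) in \<open>auto intro: less_imp_le\<close>)
  qed
qed

end

section \<open>Finite codimension and harmonic extension\<close>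

text \<open>Closedness is tested on \<open>B\<close> only, so membership depends only on the values
  on \<open>B\<close>.\<close>

definition uclosed_subspace :: "'a set \<Rightarrow> ('a \<Rightarrow> real) set \<Rightarrow> bool" where
  "uclosed_subspace B S \<longleftrightarrow> (\<forall>u\<in>S. \<forall>v\<in>S. (\<lambda>z. u z + v z) \<in> S) \<and> (\<forall>u\<in>S. \<forall>c. (\<lambda>z. c * u z) \<in> S)
     \<and> (\<forall>u. (\<forall>\<epsilon>>0. \<exists>v\<in>S. \<forall>z\<in>B. \<bar>u z - v z\<bar> \<le> \<epsilon>) \<longrightarrow> u \<in> S)"

lemma uclosed_subspaceD:
  assumes "uclosed_subspace B S"
  shows "u \<in> S \<Longrightarrow> v \<in> S \<Longrightarrow> (\<lambda>z. u z + v z) \<in> S" "u \<in> S \<Longrightarrow> (\<lambda>z. c * u z) \<in> S"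
    "(\<And>\<epsilon>. \<epsilon> > 0 \<Longrightarrow> \<exists>v\<in>S. \<forall>z\<in>B. \<bar>u z - v z\<bar> \<le> \<epsilon>) \<Longrightarrow> u \<in> S"
  using assms unfolding uclosed_subspace_def by blast+

lemma uclosed_subspace_diff:
  assumes "uclosed_subspace B S" "u \<in> S" "v \<in> S"
  shows "(\<lambda>z. u z - v z) \<in> S"
  using uclosed_subspaceD(1)[OF assms(1,2) uclosed_subspaceD(2)[OF assms(1,3), of "-1"]] by simp

text \<open>Coefficients of an approximating sequence form a Cauchy sequence because \<open>l\<close> has positive
  distance from \<open>S\<close>.\<close>

lemma uclosed_subspace_add_line:
  assumes S: "uclosed_subspace B S" and l: "\<And>z. z \<in> B \<Longrightarrow> \<bar>l z\<bar> \<le> C"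
  shows "uclosed_subspace B {u. \<exists>c. (\<lambda>z. u z - c * l z) \<in> S}"
  unfolding uclosed_subspace_def
proof (intro conjI ballI allI impI)
  fix u v assume "u \<in> {u. \<exists>c. (\<lambda>z. u z - c * l z) \<in> S}" "v \<in> {u. \<exists>c. (\<lambda>z. u z - c * l z) \<in> S}"
  then obtain c d where c: "(\<lambda>z. u z - c * l z) \<in> S" "(\<lambda>z. v z - d * l z) \<in> S" by blast
  have "(\<lambda>z. (u z - c * l z) + (v z - d * l z)) \<in> S"
    by (rule uclosed_subspaceD(1)[OF S c])
  moreover have "(\<lambda>z. (u z - c * l z) + (v z - d * l z)) = (\<lambda>z. u z + v z - (c + d) * l z)"
    by (auto simp: algebra_simps)
  ultimately have "(\<lambda>z. u z + v z - (c + d) * l z) \<in> S" by simp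
  then show "(\<lambda>z. u z + v z) \<in> {u. \<exists>c. (\<lambda>z. u z - c * l z) \<in> S}" by blast
next
  fix u and k :: real assume "u \<in> {u. \<exists>c. (\<lambda>z. u z - c * l z) \<in> S}"
  then obtain c where c: "(\<lambda>z. u z - c * l z) \<in> S" by blast
  have "(\<lambda>z. k * (u z - c * l z)) \<in> S"
    by (rule uclosed_subspaceD(2)[OF S c])
  moreover have "(\<lambda>z. k * (u z - c * l z)) = (\<lambda>z. k * u z - (k * c) * l z)"
    by (auto simp: algebra_simps)
  ultimately have "(\<lambda>z. k * u z - (k * c) * l z) \<in> S" by simp
  then show "(\<lambda>z. k * u z) \<in> {u. \<exists>c. (\<lambda>z. u z - c * l z) \<in> S}" by blast
next
  fix u assume u: "\<forall>\<epsilon>>0. \<exists>v\<in>{u. \<exists>c. (\<lambda>z. u z - c * l z) \<in> S}. \<forall>z\<in>B. \<bar>u z - v z\<bar> \<le> \<epsilon>"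
  have C: "\<bar>C\<bar> \<ge> 0" by simp
  have "\<exists>c. (\<lambda>z. u z - c * l z) \<in> S"
  proof (cases "l \<in> S")
    case True
    have "u \<in> S"
    proof (rule uclosed_subspaceD(3)[OF S])
      fix \<epsilon> :: real assume "\<epsilon> > 0"
      then obtain v c where v: "(\<lambda>z. v z - c * l z) \<in> S" "\<forall>z\<in>B. \<bar>u z - v z\<bar> \<le> \<epsilon>"
        using u by blast
      have "(\<lambda>z. (v z - c * l z) + c * l z) \<in> S"
        by (rule uclosed_subspaceD(1)[OF S v(1) uclosed_subspaceD(2)[OF S True]])
      then have "v \<in> S" by simp
      then show "\<exists>v\<in>S. \<forall>z\<in>B. \<bar>u z - v z\<bar> \<le> \<epsilon>" using v(2) by blast
    qed
    then show ?thesis by (intro exI[of _ 0]) simp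
  next
    case False
    then obtain d where d: "d > 0" "\<And>s. s \<in> S \<Longrightarrow> \<exists>z\<in>B. d < \<bar>l z - s z\<bar>"
      using uclosed_subspaceD(3)[OF S, of l] by (meson not_le)
    have "\<forall>n. \<exists>vc. (\<lambda>z. fst vc z - snd vc * l z) \<in> S \<and> (\<forall>z\<in>B. \<bar>u z - fst vc z\<bar> \<le> 1 / real (Suc n))"
    proof
      fix n
      have "1 / real (Suc n) > 0" by simp
      then obtain v c where "(\<lambda>z. v z - c * l z) \<in> S" "\<forall>z\<in>B. \<bar>u z - v z\<bar> \<le> 1 / real (Suc n)"
        using u by blast
      then show "\<exists>vc. (\<lambda>z. fst vc z - snd vc * l z) \<in> S \<and> (\<forall>z\<in>B. \<bar>u z - fst vc z\<bar> \<le> 1 / real (Suc n))"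
        by (intro exI[of _ "(v, c)"]) simp
    qed
    from choice[OF this] obtain vc where vc: "\<And>n. (\<lambda>z. fst (vc n) z - snd (vc n) * l z) \<in> S"
      "\<And>n z. z \<in> B \<Longrightarrow> \<bar>u z - fst (vc n) z\<bar> \<le> 1 / real (Suc n)" by blast
    define c where "c = (\<lambda>n. snd (vc n))"
    have cc: "\<bar>c n - c k\<bar> * d \<le> 1 / real (Suc n) + 1 / real (Suc k)" for n k
    proof (cases "c n = c k")
      case False
      let ?s = "\<lambda>z. - (1 / (c n - c k)) * ((fst (vc n) z - snd (vc n) * l z) - (fst (vc k) z - snd (vc k) * l z))"
      have "?s \<in> S"
        by (rule uclosed_subspaceD(2)[OF S uclosed_subspace_diff[OF S vc(1)[of n] vc(1)[of k]]])
      from d(2)[OF this] obtain z where z: "z \<in> B" "d < \<bar>l z - ?s z\<bar>"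
        by blast
      have "l z - ?s z = (fst (vc n) z - fst (vc k) z) / (c n - c k)"
        using False by (simp add: c_def field_simps)
      then have "\<bar>c n - c k\<bar> * d \<le> \<bar>fst (vc n) z - fst (vc k) z\<bar>"
        using z(2) False by (simp add: abs_divide pos_less_divide_eq mult.commute)
      also have "\<dots> \<le> 1 / real (Suc n) + 1 / real (Suc k)"
        using vc(2)[OF z(1), of n] vc(2)[OF z(1), of k] by linarith
      finally show ?thesis .
    qed simp
    have "Cauchy c"
    proof (rule metric_CauchyI)
      fix e :: real assume e: "e > 0"
      obtain N :: nat where N: "2 / (e * d) < real N"
        using reals_Archimedean2 by blast
      have "dist (c n) (c k) < e" if nk: "n \<ge> N" "k \<ge> N" for n k
      proof -
        have "1 / real (Suc n) \<le> 1 / real (Suc N)" "1 / real (Suc k) \<le> 1 / real (Suc N)"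
          using nk by (auto simp: field_simps)
        then have "\<bar>c n - c k\<bar> * d \<le> 2 / real (Suc N)"
          using cc[of n k] by simp
        also have "\<dots> < e * d"
        proof -
          have "e * d > 0" using e d(1) by simp
          then have "2 < real N * (e * d)" using N by (simp only: pos_divide_less_eq)
          also have "\<dots> \<le> real (Suc N) * (e * d)"
            using \<open>e * d > 0\<close> by (intro mult_right_mono) auto
          finally show ?thesis
            by (simp only: pos_divide_less_eq of_nat_0_less_iff zero_less_Suc mult.commute)
        qed
        finally show ?thesis using d(1) by (simp add: dist_real_def)
      qed
      then show "\<exists>M. \<forall>m\<ge>M. \<forall>n\<ge>M. dist (c m) (c n) < e" by blast
    qed
    then obtain c0 where c0: "c \<longlonglongrightarrow> c0"
      using Cauchy_convergent_iff convergent_def by blast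
    have "(\<lambda>z. u z - c0 * l z) \<in> S"
    proof (rule uclosed_subspaceD(3)[OF S])
      fix \<epsilon> :: real assume e: "\<epsilon> > 0"
      have "(\<lambda>n. 1 / real (Suc n)) \<longlonglongrightarrow> 0"
        using LIMSEQ_inverse_real_of_nat by (simp add: inverse_eq_divide)
      then have "eventually (\<lambda>n. 1 / real (Suc n) < \<epsilon> / 2) sequentially"
        using e by (intro order_tendstoD) auto
      moreover have "eventually (\<lambda>n. dist (c n) c0 < \<epsilon> / (2 * (\<bar>C\<bar> + 1))) sequentially"
        using c0 e by (intro tendstoD) (auto simp: add_nonneg_pos)
      ultimately have "eventually (\<lambda>n. 1 / real (Suc n) < \<epsilon> / 2 \<and> dist (c n) c0 < \<epsilon> / (2 * (\<bar>C\<bar> + 1))) sequentially"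
        by (rule eventually_conj)
      then obtain n where n: "1 / real (Suc n) < \<epsilon> / 2" "dist (c n) c0 < \<epsilon> / (2 * (\<bar>C\<bar> + 1))"
        using eventually_happens'[OF sequentially_bot] by blast
      show "\<exists>v\<in>S. \<forall>z\<in>B. \<bar>u z - c0 * l z - v z\<bar> \<le> \<epsilon>"
      proof (rule bexI[OF _ vc(1)[of n]], rule ballI)
        fix z assume z: "z \<in> B"
        have "\<bar>(c n - c0) * l z\<bar> \<le> \<epsilon> / (2 * (\<bar>C\<bar> + 1)) * (\<bar>C\<bar> + 1)"
          unfolding abs_mult using n(2) l[OF z] by (intro mult_mono) (auto simp: dist_real_def)
        also have "\<dots> = \<epsilon> / 2"
        proof -
          have "\<bar>C\<bar> + 1 > 0" by (simp add: add_nonneg_pos)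
          then show ?thesis by (simp add: divide_simps)
        qed
        finally have 1: "\<bar>(c n - c0) * l z\<bar> \<le> \<epsilon> / 2" .
        have "u z - c0 * l z - (fst (vc n) z - snd (vc n) * l z) = (u z - fst (vc n) z) + (c n - c0) * l z"
          by (simp add: c_def algebra_simps)
        then have "\<bar>u z - c0 * l z - (fst (vc n) z - snd (vc n) * l z)\<bar> \<le> \<bar>u z - fst (vc n) z\<bar> + \<bar>(c n - c0) * l z\<bar>"
          by (simp only: abs_triangle_ineq)
        then show "\<bar>u z - c0 * l z - (fst (vc n) z - snd (vc n) * l z)\<bar> \<le> \<epsilon>"
          using 1 vc(2)[OF z, of n] n(1) by linarith
      qed
    qed
    then show ?thesis by blast
  qed
  then show "u \<in> {u. \<exists>c. (\<lambda>z. u z - c * l z) \<in> S}" by blast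
qed

text \<open>Gaussian elimination: an equation with a nonzero coefficient is solved for one unknown
  \<open>i0\<close>, which is then substituted into the remaining equations.\<close>

lemma underdetermined_system:
  fixes v :: "'i \<Rightarrow> 'j \<Rightarrow> real"
  assumes "finite J" "finite I" "card J < card I"
  shows "\<exists>a. (\<exists>i\<in>I. a i \<noteq> 0) \<and> (\<forall>j\<in>J. (\<Sum>i\<in>I. a i * v i j) = 0)"
  using assms
proof (induction J arbitrary: I v rule: finite_induct)
  case empty
  then have "I \<noteq> {}" by auto
  then show ?case by (intro exI[of _ "\<lambda>i. 1"]) auto
next
  case (insert j J)
  show ?case
  proof (cases "\<forall>i\<in>I. v i j = 0")
    case True
    obtain a where "\<exists>i\<in>I. a i \<noteq> 0" "\<forall>j\<in>J. (\<Sum>i\<in>I. a i * v i j) = 0"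
      using insert.IH[of I v] insert.prems insert.hyps by auto
    then show ?thesis using True by (intro exI[of _ a]) auto
  next
    case False
    then obtain i0 where i0: "i0 \<in> I" "v i0 j \<noteq> 0" by blast
    let ?I = "I - {i0}"
    let ?w = "\<lambda>i j'. v i j' - v i j / v i0 j * v i0 j'"
    have "card J < card ?I"
      using insert.prems insert.hyps i0 by auto
    then obtain a where a: "\<exists>i\<in>?I. a i \<noteq> 0" "\<forall>j'\<in>J. (\<Sum>i\<in>?I. a i * ?w i j') = 0"
      using insert.IH[of ?I ?w] insert.prems by auto
    define a' where "a' = (\<lambda>i. if i = i0 then - (\<Sum>i\<in>?I. a i * v i j) / v i0 j else a i)"
    have sum: "(\<Sum>i\<in>I. a' i * v i j') = (\<Sum>i\<in>?I. a i * v i j') - (\<Sum>i\<in>?I. a i * v i j) / v i0 j * v i0 j'" for j'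
    proof -
      have "(\<Sum>i\<in>I. a' i * v i j') = a' i0 * v i0 j' + (\<Sum>i\<in>?I. a' i * v i j')"
        using insert.prems i0 by (intro sum.remove) auto
      also have "(\<Sum>i\<in>?I. a' i * v i j') = (\<Sum>i\<in>?I. a i * v i j')"
        by (intro sum.cong) (auto simp: a'_def)
      finally show ?thesis by (simp add: a'_def)
    qed
    show ?thesis
    proof (intro exI[of _ a'] conjI ballI)
      show "\<exists>i\<in>I. a' i \<noteq> 0" using a(1) by (auto simp: a'_def)
      fix j' assume j': "j' \<in> insert j J"
      show "(\<Sum>i\<in>I. a' i * v i j') = 0"
      proof (cases "j' = j")
        case True
        then show ?thesis unfolding sum using i0 by simp
      next
        case False
        then have "(\<Sum>i\<in>?I. a i * ?w i j') = 0" using a(2) j' by blast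
        moreover have "(\<Sum>i\<in>?I. a i * ?w i j') = (\<Sum>i\<in>?I. a i * v i j') - (\<Sum>i\<in>?I. a i * v i j / v i0 j * v i0 j')"
          by (simp add: right_diff_distrib sum_subtractf mult.assoc)
        moreover have "(\<Sum>i\<in>?I. a i * v i j / v i0 j * v i0 j') = (\<Sum>i\<in>?I. a i * v i j) / v i0 j * v i0 j'"
          by (simp add: sum_divide_distrib sum_distrib_right)
        ultimately show ?thesis unfolding sum by simp
      qed
    qed
  qed
qed

lemma mean_value_circle:
  assumes "\<rho> > 0" "continuous_on (cball w \<rho>) f" "f holomorphic_on ball w \<rho>"
  shows "((\<lambda>t. f (w + of_real \<rho> * exp (2 * of_real pi * \<i> * of_real t))) has_integral f w) {0..1}"
proof -
  have "((\<lambda>u. f u / (u - w)) has_contour_integral (2 * of_real pi * \<i> * f w)) (circlepath w \<rho>)"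
    using assms by (intro Cauchy_integral_circlepath) auto
  then have "((\<lambda>t. f (circlepath w \<rho> t) / (circlepath w \<rho> t - w) * vector_derivative (circlepath w \<rho>) (at t within {0..1}))
     has_integral (2 * of_real pi * \<i> * f w)) {0..1}"
    by (simp add: has_contour_integral_def)
  then have "((\<lambda>t. (2 * of_real pi * \<i>) * f (w + of_real \<rho> * exp (2 * of_real pi * \<i> * of_real t)))
     has_integral (2 * of_real pi * \<i> * f w)) {0..1}"
  proof (rule has_integral_eq[rotated])
    fix t :: real assume t: "t \<in> {0..1}"
    have vd: "vector_derivative (circlepath w \<rho>) (at t within {0..1})
        = 2 * of_real pi * \<i> * of_real \<rho> * exp (2 * of_real pi * \<i> * of_real t)"
      using t vector_derivative_circlepath01[of t w \<rho>] by (simp add: exp_of_real[symmetric] mult_ac)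
    show "f (circlepath w \<rho> t) / (circlepath w \<rho> t - w) * vector_derivative (circlepath w \<rho>) (at t within {0..1})
        = (2 * of_real pi * \<i>) * f (w + of_real \<rho> * exp (2 * of_real pi * \<i> * of_real t))"
      unfolding vd unfolding circlepath using assms(1) by simp
  qed
  from has_integral_mult_right[OF this, of "1 / (2 * of_real pi * \<i>)"]
  show ?thesis by simp
qed

section \<open>Real parts of \<open>disc_alg D\<close> and harmonic extension\<close>

context jordan_domain
begin

definition Re_closure :: "(complex \<Rightarrow> real) set" where
  "Re_closure = {u. \<forall>\<epsilon>>0. \<exists>q\<in>disc_alg D. \<forall>z\<in>frontier D. \<bar>u z - Re (q z)\<bar> \<le> \<epsilon>}"

lemma Re_closure_uclosed: "uclosed_subspace (frontier D) Re_closure"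
  unfolding uclosed_subspace_def
proof (intro conjI ballI allI impI)
  fix u v assume uv: "u \<in> Re_closure" "v \<in> Re_closure"
  show "(\<lambda>z. u z + v z) \<in> Re_closure"
    unfolding Re_closure_def
  proof (intro CollectI allI impI)
    fix \<epsilon> :: real assume "\<epsilon> > 0"
    then have e: "\<epsilon> / 2 > 0" by simp
    obtain q q' where q: "q \<in> disc_alg D" "\<forall>z\<in>frontier D. \<bar>u z - Re (q z)\<bar> \<le> \<epsilon> / 2"
      "q' \<in> disc_alg D" "\<forall>z\<in>frontier D. \<bar>v z - Re (q' z)\<bar> \<le> \<epsilon> / 2"
      using uv e unfolding Re_closure_def by blast
    show "\<exists>q\<in>disc_alg D. \<forall>z\<in>frontier D. \<bar>u z + v z - Re (q z)\<bar> \<le> \<epsilon>"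
    proof (rule bexI[OF _ disc_alg_add[OF q(1,3)]], rule ballI)
      fix z assume "z \<in> frontier D"
      then have "\<bar>u z - Re (q z)\<bar> \<le> \<epsilon> / 2" "\<bar>v z - Re (q' z)\<bar> \<le> \<epsilon> / 2" using q by blast+
      then show "\<bar>u z + v z - Re (q z + q' z)\<bar> \<le> \<epsilon>" unfolding plus_complex.simps by linarith
    qed
  qed
next
  fix u and c :: real assume u: "u \<in> Re_closure"
  show "(\<lambda>z. c * u z) \<in> Re_closure"
    unfolding Re_closure_def
  proof (intro CollectI allI impI)
    fix \<epsilon> :: real assume "\<epsilon> > 0"
    then have e: "\<epsilon> / (\<bar>c\<bar> + 1) > 0" by (simp add: add_nonneg_pos)
    obtain q where q: "q \<in> disc_alg D" "\<forall>z\<in>frontier D. \<bar>u z - Re (q z)\<bar> \<le> \<epsilon> / (\<bar>c\<bar> + 1)"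
      using u e unfolding Re_closure_def by blast
    show "\<exists>q\<in>disc_alg D. \<forall>z\<in>frontier D. \<bar>c * u z - Re (q z)\<bar> \<le> \<epsilon>"
    proof (rule bexI[OF _ disc_alg_mult[OF disc_alg_const[of "of_real c"] q(1)]], rule ballI)
      fix z assume z: "z \<in> frontier D"
      have "\<bar>c * u z - Re (of_real c * q z)\<bar> = \<bar>c\<bar> * \<bar>u z - Re (q z)\<bar>"
        by (simp add: abs_mult[symmetric] algebra_simps)
      also have "\<dots> \<le> (\<bar>c\<bar> + 1) * (\<epsilon> / (\<bar>c\<bar> + 1))"
        using bspec[OF q(2) z] by (intro mult_mono) auto
      also have "\<dots> = \<epsilon>" by (simp add: add_nonneg_pos)
      finally show "\<bar>c * u z - Re (of_real c * q z)\<bar> \<le> \<epsilon>" .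
    qed
  qed
next
  fix u assume u: "\<forall>\<epsilon>>0. \<exists>v\<in>Re_closure. \<forall>z\<in>frontier D. \<bar>u z - v z\<bar> \<le> \<epsilon>"
  show "u \<in> Re_closure"
    unfolding Re_closure_def
  proof (intro CollectI allI impI)
    fix \<epsilon> :: real assume "\<epsilon> > 0"
    then have e: "\<epsilon> / 2 > 0" by simp
    then obtain v where v: "v \<in> Re_closure" "\<forall>z\<in>frontier D. \<bar>u z - v z\<bar> \<le> \<epsilon> / 2" using u by blast
    then obtain q where q: "q \<in> disc_alg D" "\<forall>z\<in>frontier D. \<bar>v z - Re (q z)\<bar> \<le> \<epsilon> / 2"
      using e unfolding Re_closure_def by blast
    show "\<exists>q\<in>disc_alg D. \<forall>z\<in>frontier D. \<bar>u z - Re (q z)\<bar> \<le> \<epsilon>"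
    proof (rule bexI[OF _ q(1)], rule ballI)
      fix z assume "z \<in> frontier D"
      then have "\<bar>u z - v z\<bar> \<le> \<epsilon> / 2" "\<bar>v z - Re (q z)\<bar> \<le> \<epsilon> / 2" using q v by blast+
      then show "\<bar>u z - Re (q z)\<bar> \<le> \<epsilon>" by linarith
    qed
  qed
qed

lemma X_Re: "q \<in> disc_alg D \<Longrightarrow> (\<lambda>z. Re (q z)) \<in> Re_closure"
  unfolding Re_closure_def by force

lemma Re_closure_sum: "(\<And>i. i \<in> I \<Longrightarrow> u i \<in> Re_closure) \<Longrightarrow> (\<lambda>z. \<Sum>i\<in>I. u i z) \<in> Re_closure"
  by (induction I rule: infinite_finite_induct)
     (auto intro: uclosed_subspaceD(1)[OF Re_closure_uclosed] simp: X_Re[OF disc_alg_const[of 0], simplified])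

lemma ln_ctr_bounded:
  assumes "j \<in> holes"
  obtains C where "\<And>z. z \<in> closure D \<Longrightarrow> \<bar>ln (cmod (z - ctr j))\<bar> \<le> C"
proof -
  have "continuous_on (closure D) (\<lambda>z. ln (cmod (z - ctr j)))"
    using ctr_notin[OF assms] by (auto intro!: continuous_intros)
  then have "bounded ((\<lambda>z. ln (cmod (z - ctr j))) ` closure D)"
    using compact_closure_D by (intro compact_imp_bounded compact_continuous_image)
  then show ?thesis using that unfolding bounded_iff by auto
qed

text \<open>In \<open>log_closure\<close> the coefficients of the logarithms vary with the accuracy.
  A uniformly closed subspace plus a line is again uniformly closed, so adding one line per hole
  allows fixed coefficients and leaves only the real parts to be approximated.\<close>

lemma finite_codimension:
  assumes "continuous_on (frontier D) u"
  obtains t where "(\<lambda>z. u z - (\<Sum>j\<in>holes. t j * ln (cmod (z - ctr j)))) \<in> Re_closure"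
proof -
  let ?S = "\<lambda>J. {u. \<exists>t. (\<lambda>z. u z - (\<Sum>j\<in>J. t j * ln (cmod (z - ctr j)))) \<in> Re_closure}"
  have cl: "uclosed_subspace (frontier D) (?S J)" if "finite J" "J \<subseteq> holes" for J
    using that
  proof (induction J rule: finite_induct)
    case empty
    then show ?case using Re_closure_uclosed by simp
  next
    case (insert i J)
    obtain C where C: "\<And>z. z \<in> closure D \<Longrightarrow> \<bar>ln (cmod (z - ctr i))\<bar> \<le> C"
      using ln_ctr_bounded insert.prems by blast
    have "uclosed_subspace (frontier D) {u. \<exists>c. (\<lambda>z. u z - c * ln (cmod (z - ctr i))) \<in> ?S J}"
      using insert C frontier_in_closure by (intro uclosed_subspace_add_line) auto
    moreover have "{u. \<exists>c. (\<lambda>z. u z - c * ln (cmod (z - ctr i))) \<in> ?S J} = ?S (insert i J)"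
    proof (intro set_eqI iffI)
      fix u assume "u \<in> {u. \<exists>c. (\<lambda>z. u z - c * ln (cmod (z - ctr i))) \<in> ?S J}"
      then obtain c t where t: "(\<lambda>z. u z - c * ln (cmod (z - ctr i)) - (\<Sum>j\<in>J. t j * ln (cmod (z - ctr j)))) \<in> Re_closure"
        by blast
      have "(\<Sum>j\<in>J. t j * ln (cmod (z - ctr j))) = (\<Sum>j\<in>J. (t(i := c)) j * ln (cmod (z - ctr j)))" for z
        using insert.hyps by (intro sum.cong) auto
      then have "(\<lambda>z. u z - (\<Sum>j\<in>insert i J. (t(i := c)) j * ln (cmod (z - ctr j)))) \<in> Re_closure"
        using t insert.hyps by (simp add: algebra_simps)
      then show "u \<in> ?S (insert i J)" by blast
    next
      fix u assume "u \<in> ?S (insert i J)"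
      then obtain t where "(\<lambda>z. u z - (\<Sum>j\<in>insert i J. t j * ln (cmod (z - ctr j)))) \<in> Re_closure" by blast
      then have "(\<lambda>z. u z - t i * ln (cmod (z - ctr i)) - (\<Sum>j\<in>J. t j * ln (cmod (z - ctr j)))) \<in> Re_closure"
        using insert.hyps by (simp add: algebra_simps)
      then show "u \<in> {u. \<exists>c. (\<lambda>z. u z - c * ln (cmod (z - ctr i))) \<in> ?S J}" by blast
    qed
    ultimately show ?case by simp
  qed
  have "u \<in> ?S holes"
  proof (rule uclosed_subspaceD(3)[OF cl])
    fix \<epsilon> :: real assume "\<epsilon> > 0"
    then obtain q t where q: "q \<in> disc_alg D" "\<forall>z\<in>frontier D. \<bar>u z - lcomb q t z\<bar> \<le> \<epsilon>"
      using log_closure_continuous[OF assms] unfolding log_closure_def by blast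
    have "lcomb q t \<in> ?S holes"
      using X_Re[OF q(1)] by (auto simp: lcomb_def intro!: exI[of _ t])
    then show "\<exists>v\<in>?S holes. \<forall>z\<in>frontier D. \<bar>u z - v z\<bar> \<le> \<epsilon>"
      using q(2) by blast
  qed auto
  then show ?thesis using that by blast
qed

text \<open>Rotate the value at z to a positive number by some \<open>e\<close> of modulus 1. The
  real part of \<open>e * (\<alpha> z + cnj (\<beta> z))\<close> is that of the holomorphic function
  \<open>e * \<alpha> z + cnj e * \<beta> z\<close>, which obeys the maximum principle.\<close>

lemma harmonic_max:
  assumes "\<alpha> \<in> disc_alg D" "\<beta> \<in> disc_alg D" "\<And>z. z \<in> frontier D \<Longrightarrow> cmod (\<alpha> z + cnj (\<beta> z)) \<le> c" "z \<in> closure D"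
  shows "cmod (\<alpha> z + cnj (\<beta> z)) \<le> c"
proof (cases "z \<in> frontier D")
  case False
  then have zD: "z \<in> D" using assms(4) closure_eq by auto
  define v where "v = \<alpha> z + cnj (\<beta> z)"
  show ?thesis
  proof (cases "v = 0")
    case True
    obtain b where "b \<in> frontier D" using frontier_nonempty by auto
    then have "0 \<le> c" using assms(3)[of b] norm_ge_zero order_trans by blast
    then show ?thesis using True by (simp add: v_def)
  next
    case False
    define e where "e = cnj v / of_real (cmod v)"
    have e: "cmod e = 1" using False by (simp add: e_def norm_divide)
    have ev: "e * v = of_real (cmod v)"
      using False by (simp add: e_def complex_norm_square[symmetric] power2_eq_square mult.commute)
    let ?g = "\<lambda>z. e * \<alpha> z + cnj e * \<beta> z"
    have gA: "?g \<in> disc_alg D"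
      by (intro disc_alg_add disc_alg_mult disc_alg_const assms)
    have Re: "Re (?g z) = Re (e * (\<alpha> z + cnj (\<beta> z)))" for z
      by (simp add: algebra_simps)
    have "Re (?g z) \<le> c"
    proof (rule maximum_real_frontier[of ?g D])
      show "?g holomorphic_on interior D"
        using disc_algD(2)[OF gA] open_D by (simp add: interior_open)
      show "Re (?g z) \<le> c" if "z \<in> frontier D" for z
        unfolding Re using complex_Re_le_cmod[of "e * (\<alpha> z + cnj (\<beta> z))"] assms(3)[OF that] e
        by (simp add: norm_mult)
    qed (use disc_algD(1)[OF gA] bdd_D zD in auto)
    then show ?thesis
      unfolding Re v_def[symmetric] ev by simp
  qed
qed (use assms in auto)

text \<open>\<open>H\<close> is the harmonic extension of \<open>G\<close> in disguise. Recording
  uniform approximants on the closure instead of harmonicity reduces mean values and derivatives to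
  those of functions in \<open>disc_alg D\<close>.\<close>

definition is_ext :: "(complex \<Rightarrow> complex) \<Rightarrow> (complex \<Rightarrow> complex) \<Rightarrow> bool" where
  "is_ext G H \<longleftrightarrow> continuous_on (closure D) H \<and> (\<forall>z\<in>frontier D. H z = G z) \<and>
     (\<forall>\<epsilon>>0. \<exists>\<alpha>\<in>disc_alg D. \<exists>\<beta>\<in>disc_alg D. \<forall>z\<in>closure D. cmod (H z - (\<alpha> z + cnj (\<beta> z))) \<le> \<epsilon>)"

text \<open>Approximants on the frontier are uniformly Cauchy there, and \<open>harmonic_max\<close>
  carries this over to the closure.\<close>

lemma is_ext_exists:
  assumes "(\<lambda>z. Re (G z)) \<in> Re_closure" "(\<lambda>z. Im (G z)) \<in> Re_closure"
  obtains H where "is_ext G H"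
proof -
  have ap: "\<exists>\<alpha>\<in>disc_alg D. \<exists>\<beta>\<in>disc_alg D. \<forall>z\<in>frontier D. cmod (G z - (\<alpha> z + cnj (\<beta> z))) \<le> \<epsilon>" if "\<epsilon> > 0" for \<epsilon>
  proof -
    have e: "\<epsilon> / 2 > 0" using that by simp
    obtain q where q: "q \<in> disc_alg D" "\<forall>z\<in>frontier D. \<bar>Re (G z) - Re (q z)\<bar> \<le> \<epsilon> / 2"
      using assms(1) e unfolding Re_closure_def by blast
    obtain q' where q': "q' \<in> disc_alg D" "\<forall>z\<in>frontier D. \<bar>Im (G z) - Re (q' z)\<bar> \<le> \<epsilon> / 2"
      using assms(2) e unfolding Re_closure_def by blast
    \<comment> \<open>Chosen so that \<open>?\<alpha> z + cnj (?\<beta> z)\<close> has real part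
      \<open>Re (q z)\<close> and imaginary part \<open>Re (q' z)\<close>.\<close>
    let ?\<alpha> = "\<lambda>z. (1/2) * q z + (\<i>/2) * q' z" and ?\<beta> = "\<lambda>z. (1/2) * q z + (-\<i>/2) * q' z"
    have A: "?\<alpha> \<in> disc_alg D" "?\<beta> \<in> disc_alg D"
      by (intro disc_alg_add disc_alg_mult disc_alg_const q q')+
    have fin: "cmod (G z - (?\<alpha> z + cnj (?\<beta> z))) \<le> \<epsilon>" if "z \<in> frontier D" for z
    proof -
      have "G z - (?\<alpha> z + cnj (?\<beta> z)) = Complex (Re (G z) - Re (q z)) (Im (G z) - Re (q' z))"
        by (simp add: complex_eq_iff)
      then have "cmod (G z - (?\<alpha> z + cnj (?\<beta> z))) \<le> \<bar>Re (G z) - Re (q z)\<bar> + \<bar>Im (G z) - Re (q' z)\<bar>"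
        using cmod_le by (metis complex.sel)
      then show ?thesis using bspec[OF q(2) that] bspec[OF q'(2) that] by linarith
    qed
    show ?thesis
      by (rule bexI[OF bexI[OF ballI A(2)] A(1)]) (rule fin)
  qed
  have "\<forall>n. \<exists>p. fst p \<in> disc_alg D \<and> snd p \<in> disc_alg D \<and>
     (\<forall>z\<in>frontier D. cmod (G z - (fst p z + cnj (snd p z))) \<le> 1 / real (Suc n))"
  proof
    fix n
    have "1 / real (Suc n) > 0" by simp
    from ap[OF this] obtain \<alpha> \<beta> where "\<alpha> \<in> disc_alg D" "\<beta> \<in> disc_alg D"
      "\<forall>z\<in>frontier D. cmod (G z - (\<alpha> z + cnj (\<beta> z))) \<le> 1 / real (Suc n)" by blast
    then show "\<exists>p. fst p \<in> disc_alg D \<and> snd p \<in> disc_alg D \<and>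
     (\<forall>z\<in>frontier D. cmod (G z - (fst p z + cnj (snd p z))) \<le> 1 / real (Suc n))"
      by (intro exI[of _ "(\<alpha>, \<beta>)"]) auto
  qed
  from choice[OF this] obtain p where p: "\<And>n. fst (p n) \<in> disc_alg D" "\<And>n. snd (p n) \<in> disc_alg D"
     "\<And>n z. z \<in> frontier D \<Longrightarrow> cmod (G z - (fst (p n) z + cnj (snd (p n) z))) \<le> 1 / real (Suc n)" by blast
  define h where "h = (\<lambda>n z. fst (p n) z + cnj (snd (p n) z))"
  have hh: "cmod (h n z - h k z) \<le> 1 / real (Suc n) + 1 / real (Suc k)" if z: "z \<in> closure D" for n k z
  proof -
    have eq: "h n z - h k z = (fst (p n) z - fst (p k) z) + cnj (snd (p n) z - snd (p k) z)" for z
      by (simp add: h_def)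
    show ?thesis unfolding eq
    proof (rule harmonic_max[OF _ _ _ z])
      fix z assume z: "z \<in> frontier D"
      have "cmod (h n z - h k z) \<le> cmod (G z - h k z) + cmod (G z - h n z)"
        using norm_triangle_ineq4[of "G z - h k z" "G z - h n z"] by simp
      also have "\<dots> \<le> 1 / real (Suc k) + 1 / real (Suc n)"
        using p(3)[OF z] unfolding h_def by (intro add_mono)
      finally show "cmod (fst (p n) z - fst (p k) z + cnj (snd (p n) z - snd (p k) z)) \<le> 1 / real (Suc n) + 1 / real (Suc k)"
        unfolding eq[symmetric] by simp
    qed (intro disc_alg_diff p)+
  qed
  have sm: "\<exists>N. \<forall>n\<ge>N. 1 / real (Suc n) < e" if "e > 0" for e
  proof -
    obtain N where "inverse (real (Suc N)) < e" using reals_Archimedean[OF \<open>e > 0\<close>] by blast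
    moreover have "1 / real (Suc n) \<le> inverse (real (Suc N))" if "n \<ge> N" for n
      using that by (simp add: field_simps)
    ultimately show ?thesis by (meson le_less_trans)
  qed
  have "uniformly_Cauchy_on (closure D) h"
  proof (rule uniformly_Cauchy_onI)
    fix e :: real assume "e > 0"
    then obtain N where N: "\<And>n. n \<ge> N \<Longrightarrow> 1 / real (Suc n) < e / 2" using sm[of "e / 2"] by auto
    have "dist (h n z) (h k z) < e" if "z \<in> closure D" "n \<ge> N" "k \<ge> N" for z n k
      using hh[OF that(1), of n k] N[OF that(2)] N[OF that(3)] by (simp add: dist_norm)
    then show "\<exists>M. \<forall>x\<in>closure D. \<forall>m\<ge>M. \<forall>n\<ge>M. dist (h m x) (h n x) < e" by blast
  qed
  then obtain H where H: "uniform_limit (closure D) h H sequentially"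
    using Cauchy_uniformly_convergent uniformly_convergent_on_def by blast
  have hc: "continuous_on (closure D) (h n)" for n
    unfolding h_def by (intro continuous_intros disc_algD p)
  have apH: "\<exists>n. \<forall>z\<in>closure D. cmod (H z - h n z) \<le> e \<and> 1 / real (Suc n) < e" if "e > 0" for e
  proof -
    obtain N where N: "\<And>n. n \<ge> N \<Longrightarrow> 1 / real (Suc n) < e" using sm[OF \<open>e > 0\<close>] by auto
    have "eventually (\<lambda>n. (\<forall>z\<in>closure D. dist (h n z) (H z) < e) \<and> n \<ge> N) sequentially"
      using uniform_limitD[OF H that] eventually_ge_at_top by (rule eventually_conj)
    then obtain n where "\<forall>z\<in>closure D. dist (h n z) (H z) < e" "n \<ge> N"
      using eventually_happens'[OF sequentially_bot] by blast
    then show ?thesis using N by (intro exI[of _ n]) (auto simp: dist_norm norm_minus_commute intro: less_imp_le)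
  qed
  have "is_ext G H"
    unfolding is_ext_def
  proof (intro conjI ballI allI impI)
    show "continuous_on (closure D) H"
      using hc by (intro uniform_limit_theorem[OF _ H]) auto
    fix \<epsilon> :: real assume "\<epsilon> > 0"
    then obtain n where "\<forall>z\<in>closure D. cmod (H z - h n z) \<le> \<epsilon>" using apH by blast
    then show "\<exists>\<alpha>\<in>disc_alg D. \<exists>\<beta>\<in>disc_alg D. \<forall>z\<in>closure D. cmod (H z - (\<alpha> z + cnj (\<beta> z))) \<le> \<epsilon>"
      using p(1,2)[of n] unfolding h_def by blast
  next
    fix z assume z: "z \<in> frontier D"
    have "cmod (H z - G z) \<le> e" if "e > 0" for e
    proof -
      obtain n where n: "\<forall>z\<in>closure D. cmod (H z - h n z) \<le> e / 2 \<and> 1 / real (Suc n) < e / 2"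
        using apH[OF half_gt_zero[OF \<open>e > 0\<close>]] by blast
      have "cmod (H z - h n z) \<le> e / 2" "cmod (G z - h n z) \<le> e / 2"
        using n frontier_in_closure[OF z] p(3)[OF z, of n] unfolding h_def by fastforce+
      then show ?thesis
        using norm_triangle_ineq4[of "H z - h n z" "G z - h n z"] by simp
    qed
    then have "cmod (H z - G z) \<le> 0" by (rule field_le_epsilon) simp
    then show "H z = G z" by simp
  qed
  then show ?thesis by (rule that)
qed

text \<open>On the circle \<open>(c t - w) * cnj (c t - w)\<close> is the square of \<rho>. Hence
  the factor \<open>c t - w\<close> kills the holomorphic part in the mean and turns the difference
  \<open>cnj (\<beta> (c t)) - cnj (\<beta> w)\<close> into a multiple of the conjugated difference
  quotient, whose mean is its value at \<open>w\<close>.\<close>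

lemma mean_conj:
  assumes \<rho>: "\<rho> > 0" "cball w \<rho> \<subseteq> D" and A: "\<alpha> \<in> disc_alg D" "\<beta> \<in> disc_alg D"
  defines "c \<equiv> \<lambda>t. w + of_real \<rho> * exp (2 * of_real pi * \<i> * of_real t)"
  shows "((\<lambda>t. \<alpha> (c t) + cnj (\<beta> (c t))) has_integral (\<alpha> w + cnj (\<beta> w))) {0..1}"
    and "((\<lambda>t. (c t - w) * (\<alpha> (c t) + cnj (\<beta> (c t)))) has_integral (of_real \<rho>)\<^sup>2 * cnj (deriv \<beta> w)) {0..1}"
proof -
  have mean: "((\<lambda>t. f (c t)) has_integral f w) {0..1}" if "f holomorphic_on D" for f
    unfolding c_def
  proof (rule mean_value_circle[OF \<rho>(1)])
    show "continuous_on (cball w \<rho>) f"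
      using that \<rho>(2) holomorphic_on_imp_continuous_on holomorphic_on_subset by blast
    show "f holomorphic_on ball w \<rho>"
      using that \<rho>(2) ball_subset_cball holomorphic_on_subset by blast
  qed
  have meanc: "((\<lambda>t. cnj (f (c t))) has_integral cnj (f w)) {0..1}" if "f holomorphic_on D" for f
    using has_integral_cnj[of "\<lambda>t. f (c t)" "f w" "{0..1}"] mean[OF that] by (simp add: o_def)
  show "((\<lambda>t. \<alpha> (c t) + cnj (\<beta> (c t))) has_integral (\<alpha> w + cnj (\<beta> w))) {0..1}"
    by (intro has_integral_add mean meanc disc_algD A)
  have wD: "w \<in> D" using \<rho> by (meson centre_in_cball less_imp_le subsetD)
  obtain \<beta>1 where b1: "\<beta>1 \<in> disc_alg D" "\<And>z. z \<in> closure D \<Longrightarrow> \<beta> z - \<beta> w = (z - w) * \<beta>1 z"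
    using disc_alg_factor[OF open_D disc_alg_diff[OF A(2) disc_alg_const[of "\<beta> w"]] wD] by auto
  have der: "deriv \<beta> w = \<beta>1 w"
  proof -
    have "(\<beta>1 has_field_derivative deriv \<beta>1 w) (at w)"
      using disc_algD(2)[OF b1(1)] wD open_D holomorphic_derivI by blast
    then have "((\<lambda>z. \<beta> w + (z - w) * \<beta>1 z) has_field_derivative \<beta>1 w) (at w)"
      by (auto intro!: derivative_eq_intros)
    then have "(\<beta> has_field_derivative \<beta>1 w) (at w)"
    proof (rule has_field_derivative_transform_within_open[OF _ open_D wD])
      show "\<beta> w + (x - w) * \<beta>1 x = \<beta> x" if "x \<in> D" for x
        using b1(2)[OF D_in_closure[OF that]] by (simp add: algebra_simps)
    qed
    then show ?thesis by (rule DERIV_imp_deriv)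
  qed
  have cD: "c t \<in> D" for t
  proof -
    have "dist w (c t) = \<rho>" using \<rho>(1) by (simp add: c_def dist_norm norm_mult)
    then show ?thesis using \<rho>(2) by (meson mem_cball order_refl subsetD)
  qed
  have cc: "(c t - w) * cnj (c t - w) = (of_real \<rho>)\<^sup>2" for t
  proof -
    have "cmod (c t - w) = \<rho>" using \<rho>(1) by (simp add: c_def norm_mult)
    then show ?thesis using complex_norm_square[of "c t - w"] by (simp only: of_real_power)
  qed
  have i1: "((\<lambda>t. (c t - w) * \<alpha> (c t)) has_integral (w - w) * \<alpha> w) {0..1}"
    by (rule mean) (intro holomorphic_intros disc_algD A)
  have i2: "((\<lambda>t. (c t - w)) has_integral (w - w)) {0..1}"
    by (rule mean) (intro holomorphic_intros)
  have i3: "((\<lambda>t. (of_real \<rho>)\<^sup>2 * cnj (\<beta>1 (c t))) has_integral (of_real \<rho>)\<^sup>2 * cnj (\<beta>1 w)) {0..1}"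
    by (intro has_integral_mult_right meanc disc_algD b1)
  have "((\<lambda>t. (c t - w) * \<alpha> (c t) + cnj (\<beta> w) * (c t - w) + (of_real \<rho>)\<^sup>2 * cnj (\<beta>1 (c t)))
     has_integral (w - w) * \<alpha> w + cnj (\<beta> w) * (w - w) + (of_real \<rho>)\<^sup>2 * cnj (\<beta>1 w)) {0..1}"
    by (intro has_integral_add i1 i3 has_integral_mult_right i2)
  moreover have "(c t - w) * \<alpha> (c t) + cnj (\<beta> w) * (c t - w) + (of_real \<rho>)\<^sup>2 * cnj (\<beta>1 (c t))
      = (c t - w) * (\<alpha> (c t) + cnj (\<beta> (c t)))" for t
  proof -
    have "\<beta> (c t) = \<beta> w + (c t - w) * \<beta>1 (c t)"
      using b1(2)[OF D_in_closure[OF cD[of t]]] by (simp add: algebra_simps)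
    then have "cnj (\<beta> (c t)) = cnj (\<beta> w) + cnj (c t - w) * cnj (\<beta>1 (c t))"
      by (simp only: complex_cnj_add complex_cnj_mult)
    then have "(c t - w) * cnj (\<beta> (c t)) = (c t - w) * cnj (\<beta> w) + ((c t - w) * cnj (c t - w)) * cnj (\<beta>1 (c t))"
      by (simp only: distrib_left mult.assoc)
    then show ?thesis unfolding cc by (simp add: algebra_simps)
  qed
  ultimately show "((\<lambda>t. (c t - w) * (\<alpha> (c t) + cnj (\<beta> (c t)))) has_integral (of_real \<rho>)\<^sup>2 * cnj (deriv \<beta> w)) {0..1}"
    by (simp add: der)
qed

text \<open>The mean of \<open>(z - w) * H z\<close> over a circle around \<open>w\<close> isolates the antiholomorphic derivative of
  \<open>H\<close> at \<open>w\<close>. It equals the mean of \<open>H2 z - w * H z\<close>, which is \<open>H2 w - w * H w = 0\<close>.\<close>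

lemma ext_holomorphic:
  assumes H: "is_ext G H" and H2: "is_ext G2 H2" and rel: "\<And>w. w \<in> D \<Longrightarrow> H2 w = w * H w"
  shows "H \<in> disc_alg D"
proof -
  have cont: "continuous_on (closure D) H" "continuous_on (closure D) H2"
    using H H2 by (auto simp: is_ext_def)
  have main: "cmod (deriv \<beta> w) \<le> \<epsilon> / \<rho>"
    if \<rho>: "\<rho> > 0" "cball w \<rho> \<subseteq> D" and A: "\<alpha> \<in> disc_alg D" "\<beta> \<in> disc_alg D" and \<epsilon>: "\<epsilon> > 0"
      and ap: "\<And>z. z \<in> closure D \<Longrightarrow> cmod (H z - (\<alpha> z + cnj (\<beta> z))) \<le> \<epsilon>" for \<alpha> \<beta> w \<rho> \<epsilon>
  proof -
    define c where "c = (\<lambda>t::real. w + of_real \<rho> * exp (2 * of_real pi * \<i> * of_real t))"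
    have wD: "w \<in> D" using \<rho> by (meson centre_in_cball less_imp_le subsetD)
    have cD: "c t \<in> D" and cw: "cmod (c t - w) = \<rho>" for t
    proof -
      have "dist w (c t) = \<rho>" using \<rho>(1) by (simp add: c_def dist_norm norm_mult)
      then show "c t \<in> D" using \<rho>(2) by (meson mem_cball order_refl subsetD)
      show "cmod (c t - w) = \<rho>" using \<rho>(1) by (simp add: c_def norm_mult)
    qed
    have cc: "continuous_on {0..1} (\<lambda>t. f (c t))" if "continuous_on (closure D) f" for f :: "complex \<Rightarrow> complex"
    proof (rule continuous_on_compose2[OF that])
      show "continuous_on {0..1} c" unfolding c_def by (intro continuous_intros)
      show "c ` {0..1} \<subseteq> closure D" using cD D_in_closure by auto
    qed
    have meanH: "integral {0..1} (\<lambda>t. K (c t)) = K w" if K: "is_ext G' K" for G' K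
    proof -
      have cK: "continuous_on (closure D) K" using K by (simp add: is_ext_def)
      have "cmod (integral {0..1} (\<lambda>t. K (c t)) - K w) \<le> e" if "e > 0" for e
      proof -
        have "e / 2 > 0" using that by simp
        then obtain \<alpha>' \<beta>' where A': "\<alpha>' \<in> disc_alg D" "\<beta>' \<in> disc_alg D"
          "\<forall>z\<in>closure D. cmod (K z - (\<alpha>' z + cnj (\<beta>' z))) \<le> e / 2"
          using K unfolding is_ext_def by blast
        have i: "((\<lambda>t. \<alpha>' (c t) + cnj (\<beta>' (c t))) has_integral (\<alpha>' w + cnj (\<beta>' w))) {0..1}"
          unfolding c_def by (rule mean_conj(1)[OF \<rho> A'(1,2)])
        have iK: "((\<lambda>t. K (c t)) has_integral integral {0..1} (\<lambda>t. K (c t))) {0..1}"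
          by (intro integrable_integral integrable_continuous_real cc cK)
        have "((\<lambda>t. K (c t) - (\<alpha>' (c t) + cnj (\<beta>' (c t)))) has_integral
            (integral {0..1} (\<lambda>t. K (c t)) - (\<alpha>' w + cnj (\<beta>' w)))) {0..1}"
          by (rule has_integral_diff[OF iK i])
        then have "cmod (integral {0..1} (\<lambda>t. K (c t)) - (\<alpha>' w + cnj (\<beta>' w))) \<le> e / 2 * measure lborel (cbox 0 (1::real))"
          unfolding cbox_interval[symmetric]
        proof (rule has_integral_bound[rotated])
          show "cmod (K (c t) - (\<alpha>' (c t) + cnj (\<beta>' (c t)))) \<le> e / 2" for t
            using A'(3) D_in_closure[OF cD[of t]] by blast
        qed (use that in auto)
        moreover have "cmod (K w - (\<alpha>' w + cnj (\<beta>' w))) \<le> e / 2"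
          using A'(3) D_in_closure[OF wD] by blast
        ultimately show ?thesis
          using norm_triangle_ineq4[of "integral {0..1} (\<lambda>t. K (c t)) - (\<alpha>' w + cnj (\<beta>' w))" "K w - (\<alpha>' w + cnj (\<beta>' w))"]
          by simp
      qed
      then have "cmod (integral {0..1} (\<lambda>t. K (c t)) - K w) \<le> 0" by (rule field_le_epsilon) simp
      then show ?thesis by simp
    qed
    have iH: "((\<lambda>t. H (c t)) has_integral H w) {0..1}" "((\<lambda>t. H2 (c t)) has_integral H2 w) {0..1}"
      using meanH[OF H] meanH[OF H2] integrable_integral[OF integrable_continuous_real[OF cc]] cont by metis+
    have "((\<lambda>t. H2 (c t) - w * H (c t)) has_integral (H2 w - w * H w)) {0..1}"
      by (intro has_integral_diff has_integral_mult_right iH)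
    moreover have "H2 (c t) - w * H (c t) = (c t - w) * H (c t)" for t
      using rel[OF cD[of t]] by (simp add: algebra_simps)
    ultimately have i0: "((\<lambda>t. (c t - w) * H (c t)) has_integral 0) {0..1}"
      using rel[OF wD] by simp
    have i1: "((\<lambda>t. (c t - w) * (\<alpha> (c t) + cnj (\<beta> (c t)))) has_integral (of_real \<rho>)\<^sup>2 * cnj (deriv \<beta> w)) {0..1}"
      unfolding c_def by (rule mean_conj(2)[OF \<rho> A])
    have "((\<lambda>t. (c t - w) * H (c t) - (c t - w) * (\<alpha> (c t) + cnj (\<beta> (c t)))) has_integral
        0 - (of_real \<rho>)\<^sup>2 * cnj (deriv \<beta> w)) {0..1}"
      by (rule has_integral_diff[OF i0 i1])
    then have "cmod (0 - (of_real \<rho>)\<^sup>2 * cnj (deriv \<beta> w)) \<le> (\<rho> * \<epsilon>) * measure lborel (cbox 0 (1::real))"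
      unfolding cbox_interval[symmetric]
    proof (rule has_integral_bound[rotated])
      show "cmod ((c t - w) * H (c t) - (c t - w) * (\<alpha> (c t) + cnj (\<beta> (c t)))) \<le> \<rho> * \<epsilon>" for t
        unfolding right_diff_distrib[symmetric] norm_mult cw
        using ap[OF D_in_closure[OF cD[of t]]] \<rho>(1) by (intro mult_left_mono) auto
    qed (use \<rho> \<epsilon> in auto)
    then have "\<rho>\<^sup>2 * cmod (deriv \<beta> w) \<le> \<rho> * \<epsilon>"
      by (simp add: norm_mult norm_power)
    then show ?thesis
      using \<rho>(1) by (simp add: power2_eq_square field_simps)
  qed
  have "\<exists>T. open T \<and> w0 \<in> T \<and> H holomorphic_on T" if w0: "w0 \<in> D" for w0
  proof -
    obtain e where e: "e > 0" "cball w0 e \<subseteq> D"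
      using open_D w0 open_contains_cball by blast
    define \<rho> where "\<rho> = e / 2"
    have \<rho>: "\<rho> > 0" using e by (simp add: \<rho>_def)
    have sub: "cball w \<rho> \<subseteq> D" if "w \<in> cball w0 \<rho>" for w
    proof -
      have "cball w \<rho> \<subseteq> cball w0 e"
      proof
        fix x assume "x \<in> cball w \<rho>"
        then show "x \<in> cball w0 e"
          using that dist_triangle[of w0 x w] by (simp add: \<rho>_def dist_commute)
      qed
      then show ?thesis using e(2) by blast
    qed
    \<comment> \<open>Since the derivative of \<beta> is small near \<open>w0\<close>, freezing
      \<beta> at its value there leaves a holomorphic approximant of \<open>H\<close>, and uniform
      limits of these are holomorphic.\<close>
    have ap: "\<exists>g. g holomorphic_on D \<and> (\<forall>z\<in>cball w0 \<rho>. cmod (H z - g z) \<le> \<epsilon>)" if \<epsilon>: "\<epsilon> > 0" for \<epsilon>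
    proof -
      have "\<epsilon> / 2 > 0" using \<epsilon> by simp
      then obtain \<alpha> \<beta> where A: "\<alpha> \<in> disc_alg D" "\<beta> \<in> disc_alg D"
          "\<forall>z\<in>closure D. cmod (H z - (\<alpha> z + cnj (\<beta> z))) \<le> \<epsilon> / 2"
        using H unfolding is_ext_def by blast
      have d: "cmod (deriv \<beta> w) \<le> (\<epsilon> / 2) / \<rho>" if "w \<in> cball w0 \<rho>" for w
        using main[OF \<rho> sub[OF that] A(1,2) \<open>\<epsilon> / 2 > 0\<close>] A(3) by blast
      show ?thesis
      proof (intro exI[of _ "\<lambda>z. \<alpha> z + cnj (\<beta> w0)"] conjI ballI)
        show "(\<lambda>z. \<alpha> z + cnj (\<beta> w0)) holomorphic_on D"
          by (intro holomorphic_intros disc_algD A)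
        fix z assume z: "z \<in> cball w0 \<rho>"
        have zD: "z \<in> D" using sub[OF z] \<rho> by (meson centre_in_cball less_imp_le subsetD)
        have "cmod (\<beta> z - \<beta> w0) \<le> (\<epsilon> / 2) / \<rho> * cmod (z - w0)"
        proof (rule field_differentiable_bound[of "cball w0 \<rho>" \<beta> "deriv \<beta>"])
          show "(\<beta> has_field_derivative deriv \<beta> x) (at x within cball w0 \<rho>)" if "x \<in> cball w0 \<rho>" for x
          proof -
            have "x \<in> D" using sub[OF that] \<rho> by (meson centre_in_cball less_imp_le subsetD)
            then show ?thesis
              using disc_algD(2)[OF A(2)] open_D holomorphic_derivI by blast
          qed
        qed (use d z \<rho> in auto)
        also have "\<dots> \<le> (\<epsilon> / 2) / \<rho> * \<rho>"
          using z \<rho> \<epsilon> by (intro mult_left_mono) (auto simp: dist_norm norm_minus_commute)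
        finally have "cmod (\<beta> z - \<beta> w0) \<le> \<epsilon> / 2" using \<rho> by simp
        then have n1: "cmod (cnj (\<beta> z) - cnj (\<beta> w0)) \<le> \<epsilon> / 2"
          by (metis complex_cnj_diff complex_mod_cnj)
        have n2: "cmod (H z - (\<alpha> z + cnj (\<beta> z))) \<le> \<epsilon> / 2"
          using A(3) D_in_closure[OF zD] by blast
        show "cmod (H z - (\<alpha> z + cnj (\<beta> w0))) \<le> \<epsilon>"
        proof -
          have "H z - (\<alpha> z + cnj (\<beta> w0)) = (H z - (\<alpha> z + cnj (\<beta> z))) + (cnj (\<beta> z) - cnj (\<beta> w0))"
            by simp
          then have "cmod (H z - (\<alpha> z + cnj (\<beta> w0))) \<le> cmod (H z - (\<alpha> z + cnj (\<beta> z))) + cmod (cnj (\<beta> z) - cnj (\<beta> w0))"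
            by (metis norm_triangle_ineq)
          then show ?thesis using n1 n2 by linarith
        qed
      qed
    qed
    have "\<forall>n. \<exists>g. g holomorphic_on D \<and> (\<forall>z\<in>cball w0 \<rho>. cmod (H z - g z) \<le> 1 / real (Suc n))"
      using ap by simp
    from choice[OF this] obtain g where g: "\<And>n. g n holomorphic_on D"
      "\<And>n z. z \<in> cball w0 \<rho> \<Longrightarrow> cmod (H z - g n z) \<le> 1 / real (Suc n)" by blast
    have sD: "cball w0 \<rho> \<subseteq> D" using sub[of w0] \<rho> by simp
    have "H holomorphic_on ball w0 \<rho>"
    proof (rule holomorphic_uniform_limit[of w0 \<rho> g sequentially H])
      show "\<forall>\<^sub>F n in sequentially. continuous_on (cball w0 \<rho>) (g n) \<and> g n holomorphic_on ball w0 \<rho>"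
      proof (intro always_eventually allI conjI)
        fix n
        have gc: "g n holomorphic_on cball w0 \<rho>"
          using g(1) sD by (rule holomorphic_on_subset)
        then show "continuous_on (cball w0 \<rho>) (g n)"
          by (rule holomorphic_on_imp_continuous_on)
        show "g n holomorphic_on ball w0 \<rho>"
          using gc ball_subset_cball by (rule holomorphic_on_subset)
      qed
      show "uniform_limit (cball w0 \<rho>) g H sequentially"
        unfolding uniform_limit_iff
      proof (intro allI impI)
        fix e :: real assume "e > 0"
        then have "\<forall>\<^sub>F n in sequentially. inverse (real (Suc n)) < e"
          using order_tendstoD(2)[OF LIMSEQ_inverse_real_of_nat] by blast
        then show "\<forall>\<^sub>F n in sequentially. \<forall>x\<in>cball w0 \<rho>. dist (g n x) (H x) < e"
        proof eventually_elim
          case (elim n)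
          show ?case
          proof
            fix x assume "x \<in> cball w0 \<rho>"
            then show "dist (g n x) (H x) < e"
              using g(2)[of x n] elim by (simp add: dist_norm norm_minus_commute inverse_eq_divide)
          qed
        qed
      qed
    qed auto
    then show ?thesis using \<rho> by (intro exI[of _ "ball w0 \<rho>"]) auto
  qed
  then have "H field_differentiable at w" if "w \<in> D" for w
    using that by (meson holomorphic_on_imp_differentiable_at)
  then have "H holomorphic_on D"
    by (simp add: field_differentiable_at_within holomorphic_on_def)
  then show ?thesis using cont(1) by (simp add: disc_alg_def)
qed

section \<open>Functions with nonnegative winding\<close>

lemma inv_on_frontier_Re_pos:
  assumes "continuous_on (frontier D) g" "\<And>z. z \<in> frontier D \<Longrightarrow> Re (g z) > 0"
  shows "inv_on_frontier g"
proof -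
  have "g z \<noteq> 0" if "z \<in> frontier D" for z
    using assms(2)[OF that] by auto
  then show ?thesis using assms(1) by (simp add: inv_on_frontier_def)
qed

definition nonneg_winding :: "(complex \<Rightarrow> complex) \<Rightarrow> bool" where
  "nonneg_winding F \<longleftrightarrow> (\<forall>P\<in>disc_alg D. \<forall>Q\<in>disc_alg D. (\<forall>z\<in>frontier D. P z * F z + Q z \<noteq> 0) \<longrightarrow>
     0 \<le> bdry_winding m \<gamma> (\<lambda>z. P z * F z + Q z))"

text \<open>Removing a factor \<open>z - w\<close> with \<open>w\<close> in \<open>D\<close> lowers
  the winding by 1, so a function of winding 0 that is divisible in this way would produce winding
  -1. The later consequences of nonnegative winding are all drawn through this
  contradiction.\<close>

lemma quotient_winding:
  assumes F: "continuous_on (frontier D) F" "nonneg_winding F"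
    and w: "w \<in> D" and PQ: "P \<in> disc_alg D" "Q \<in> disc_alg D"
    and g: "inv_on_frontier g" "bdry_winding m \<gamma> g = 0"
    and eq: "\<And>z. z \<in> frontier D \<Longrightarrow> (z - w) * (P z * F z + Q z) = g z"
  shows False
proof -
  have inv: "inv_on_frontier (\<lambda>z. z - w)"
    using w D_frontier_disj by (intro inv_on_frontier_linear) auto
  have ne: "P z * F z + Q z \<noteq> 0" if "z \<in> frontier D" for z
    using eq[OF that] g(1) that by (auto simp: inv_on_frontier_def)
  have "bdry_winding m \<gamma> (\<lambda>z. P z * F z + Q z) = bdry_winding m \<gamma> (\<lambda>z. g z / (z - w))"
  proof (rule bdry_winding_cong)
    fix z assume z: "z \<in> frontier D"
    then have "z - w \<noteq> 0" using inv by (auto simp: inv_on_frontier_def)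
    then show "P z * F z + Q z = g z / (z - w)" using eq[OF z] by (simp add: field_simps)
  qed
  also have "\<dots> = - 1"
    using bdry_winding_divide[OF g(1) inv] g(2) winding_in[OF w] by simp
  finally show False
    using F(2) PQ ne unfolding nonneg_winding_def by fastforce
qed

text \<open>If \<open>H w\<close> were not 0, it could be rotated to the positive axis by
  \<open>e\<close>. Some \<open>q\<close> in \<open>disc_alg D\<close> has real part close to that
  of e * H, so \<open>e * (p z * F z) + (q w - q z)\<close> has positive real part on the frontier
  and winding 0; but \<open>p\<close> and \<open>q w - q z\<close> are both divisible by
  \<open>z - w\<close>.\<close>

lemma ext_zero:
  assumes F: "continuous_on (frontier D) F" "nonneg_winding F"
    and H: "is_ext (\<lambda>z. p z * F z) H" and p: "p \<in> disc_alg D" "w \<in> D" "p w = 0"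
  shows "H w = 0"
proof (rule ccontr)
  assume c0: "H w \<noteq> 0"
  define e where "e = cnj (H w) / of_real (cmod (H w))"
  \<comment> \<open>A quarter of the modulus leaves room: \<open>Re (q w)\<close> is at least 3 *
    \<epsilon>, and the approximation on the frontier costs one more \<epsilon>.\<close>
  define \<epsilon> where "\<epsilon> = cmod (H w) / 4"
  have \<epsilon>: "\<epsilon> > 0" using c0 by (simp add: \<epsilon>_def)
  have e: "cmod e = 1" "e * H w = of_real (cmod (H w))"
    using c0 by (simp_all add: e_def norm_divide complex_norm_square[symmetric] power2_eq_square mult.commute)
  obtain \<alpha> \<beta> where A: "\<alpha> \<in> disc_alg D" "\<beta> \<in> disc_alg D"
    "\<And>z. z \<in> closure D \<Longrightarrow> cmod (H z - (\<alpha> z + cnj (\<beta> z))) \<le> \<epsilon>"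
    using H \<epsilon> unfolding is_ext_def by blast
  define q where "q = (\<lambda>z. e * \<alpha> z + cnj e * \<beta> z)"
  have q: "q \<in> disc_alg D"
    unfolding q_def by (intro disc_alg_add disc_alg_mult disc_alg_const A)
  have near: "\<bar>Re (e * H z) - Re (q z)\<bar> \<le> \<epsilon>" if "z \<in> closure D" for z
  proof -
    have "Re (e * H z) - Re (q z) = Re (e * (H z - (\<alpha> z + cnj (\<beta> z))))"
      by (simp add: q_def algebra_simps)
    also have "\<bar>\<dots>\<bar> \<le> cmod (e * (H z - (\<alpha> z + cnj (\<beta> z))))"
      by (rule abs_Re_le_cmod)
    also have "\<dots> \<le> \<epsilon>" using A(3)[OF that] e(1) by (simp add: norm_mult)
    finally show ?thesis .
  qed
  have qw: "Re (q w) \<ge> 3 * \<epsilon>"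
  proof -
    have "Re (e * H w) = 4 * \<epsilon>" by (simp only: e(2) \<epsilon>_def) simp
    then show ?thesis using near[OF D_in_closure[OF p(2)]] by linarith
  qed
  obtain p1 where p1: "p1 \<in> disc_alg D" "\<And>z. z \<in> closure D \<Longrightarrow> p z = (z - w) * p1 z"
    using disc_alg_factor[OF open_D p(1,2,3)] by blast
  obtain q1 where q1: "q1 \<in> disc_alg D" "\<And>z. z \<in> closure D \<Longrightarrow> q w - q z = (z - w) * q1 z"
    using disc_alg_factor[OF open_D disc_alg_diff[OF disc_alg_const[of "q w"] q] p(2)] by auto
  let ?g = "\<lambda>z. e * (p z * F z) + (q w - q z)"
  have contg: "continuous_on (frontier D) ?g"
    by (intro continuous_intros F(1) disc_alg_cont_frontier p(1) q)
  have Re: "Re (?g z) > 0" if z: "z \<in> frontier D" for z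
  proof -
    have "H z = p z * F z" using H z by (simp add: is_ext_def)
    then have "Re (?g z) = (Re (e * H z) - Re (q z)) + Re (q w)" by simp
    then show ?thesis using near[OF frontier_in_closure[OF z]] qw \<epsilon> by linarith
  qed
  show False
  proof (rule quotient_winding[OF F p(2)])
    show "(\<lambda>z. e * p1 z) \<in> disc_alg D" by (intro disc_alg_mult disc_alg_const p1)
    show "q1 \<in> disc_alg D" by fact
    show "inv_on_frontier ?g"
      by (rule inv_on_frontier_Re_pos[OF contg Re])
    show "bdry_winding m \<gamma> ?g = 0" by (rule bdry_winding_Re_pos[OF contg Re])
    show "(z - w) * (e * p1 z * F z + q1 z) = ?g z" if "z \<in> frontier D" for z
      unfolding p1(2)[OF frontier_in_closure[OF that]] q1(2)[OF frontier_in_closure[OF that]]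
      by (simp add: algebra_simps)
  qed
qed

lemma polynomial_multiple_in_disc_alg:
  assumes F: "continuous_on (frontier D) F" "nonneg_winding F"
  obtains p h where "p \<noteq> 0" "h \<in> disc_alg D" "\<And>z. z \<in> frontier D \<Longrightarrow> h z = poly p z * F z"
proof -
  \<comment> \<open>For each power i the four indices k stand for the real and imaginary parts of
    \<open>z ^ i * F z\<close> and of \<open>z ^ Suc i * F z\<close>, each with its own logarithmic
    coefficients.\<close>
  define u where "u = (\<lambda>i (k::nat) z. (if k = 0 then Re (z ^ i * F z) else if k = 1 then Im (z ^ i * F z)
     else if k = 2 then Re (z ^ Suc i * F z) else Im (z ^ Suc i * F z)))"
  have cu: "continuous_on (frontier D) (u i k)" for i k
  proof -
    have c: "continuous_on (frontier D) (\<lambda>z. Re (z ^ j * F z))" "continuous_on (frontier D) (\<lambda>z. Im (z ^ j * F z))" for j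
      by (intro continuous_intros F(1))+
    show ?thesis
      unfolding u_def using c[of i] c[of "Suc i"] by (cases "k = 0"; cases "k = 1"; cases "k = 2") simp_all
  qed
  have "\<forall>ik. \<exists>t. (\<lambda>z. u (fst ik) (snd ik) z - (\<Sum>j\<in>holes. t j * ln (cmod (z - ctr j)))) \<in> Re_closure"
    by (intro allI, rule finite_codimension[OF cu]) (rule exI)
  from choice[OF this] obtain t where t:
    "\<And>ik. (\<lambda>z. u (fst ik) (snd ik) z - (\<Sum>j\<in>holes. t ik j * ln (cmod (z - ctr j)))) \<in> Re_closure" by blast
  \<comment> \<open>One unknown more than there are linear conditions, of which there are four for
    each hole.\<close>
  define n where "n = card (holes \<times> {..<4::nat}) + 1"
  obtain a where a: "\<exists>i\<in>{..<n}. a i \<noteq> 0" "\<forall>jk\<in>holes \<times> {..<4::nat}. (\<Sum>i<n. a i * t (i, snd jk) (fst jk)) = 0"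
    using underdetermined_system[of "holes \<times> {..<4::nat}" "{..<n}" "\<lambda>i jk. t (i, snd jk) (fst jk)"]
    by (auto simp: n_def)
  define p where "p = (\<Sum>i<n. monom (of_real (a i) :: complex) i)"
  have pp: "poly p z = (\<Sum>i<n. of_real (a i) * z ^ i)" for z
    by (simp add: p_def poly_sum poly_monom)
  have p0: "p \<noteq> 0"
  proof
    assume "p = 0"
    obtain i where i: "i < n" "a i \<noteq> 0" using a(1) by auto
    have "coeff p i = (\<Sum>k<n. if k = i then of_real (a k) else 0)"
      by (simp add: p_def coeff_sum)
    also have "\<dots> = of_real (a i)" using i(1) by simp
    finally show False using i(2) \<open>p = 0\<close> by simp
  qed
  have main: "(\<lambda>z. \<Sum>i<n. a i * u i k z) \<in> Re_closure" if k: "k < 4" for k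
  proof -
    have "(\<lambda>z. \<Sum>i<n. a i * (u i k z - (\<Sum>j\<in>holes. t (i, k) j * ln (cmod (z - ctr j))))) \<in> Re_closure"
      using t[of "(_, k)"] by (intro Re_closure_sum uclosed_subspaceD(2)[OF Re_closure_uclosed]) simp
    moreover have "(\<Sum>i<n. a i * (u i k z - (\<Sum>j\<in>holes. t (i, k) j * ln (cmod (z - ctr j))))) = (\<Sum>i<n. a i * u i k z)" for z
    proof -
      have "(\<Sum>i<n. a i * (\<Sum>j\<in>holes. t (i, k) j * ln (cmod (z - ctr j))))
          = (\<Sum>j\<in>holes. (\<Sum>i<n. a i * t (i, k) j) * ln (cmod (z - ctr j)))"
        by (simp add: sum_distrib_left sum_distrib_right mult.assoc) (rule sum.swap)
      also have "\<dots> = 0"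
        using a(2) k by (intro sum.neutral) auto
      finally show ?thesis by (simp add: right_diff_distrib sum_subtractf)
    qed
    ultimately show ?thesis by simp
  qed
  have Re0: "(\<Sum>i<n. a i * u i 0 z) = Re (poly p z * F z)" and Im0: "(\<Sum>i<n. a i * u i 1 z) = Im (poly p z * F z)"
    and Re1: "(\<Sum>i<n. a i * u i 2 z) = Re (z * poly p z * F z)" and Im1: "(\<Sum>i<n. a i * u i 3 z) = Im (z * poly p z * F z)" for z
  proof -
    have e0: "poly p z * F z = (\<Sum>i<n. of_real (a i) * (z ^ i * F z))"
      unfolding pp by (simp add: sum_distrib_right mult.assoc)
    have e1: "z * poly p z * F z = (\<Sum>i<n. of_real (a i) * (z ^ Suc i * F z))"
      unfolding pp by (simp add: sum_distrib_right sum_distrib_left mult_ac)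
    have R: "Re (of_real c * x) = c * Re x" "Im (of_real c * x) = c * Im x" for c x by simp_all
    show "(\<Sum>i<n. a i * u i 0 z) = Re (poly p z * F z)" "(\<Sum>i<n. a i * u i 1 z) = Im (poly p z * F z)"
      unfolding e0 Re_sum Im_sum R by (simp_all add: u_def)
    show "(\<Sum>i<n. a i * u i 2 z) = Re (z * poly p z * F z)" "(\<Sum>i<n. a i * u i 3 z) = Im (z * poly p z * F z)"
      unfolding e1 Re_sum Im_sum R by (simp_all add: u_def)
  qed
  have RX: "(\<lambda>z. Re (poly p z * F z)) \<in> Re_closure" "(\<lambda>z. Im (poly p z * F z)) \<in> Re_closure"
    "(\<lambda>z. Re (z * poly p z * F z)) \<in> Re_closure" "(\<lambda>z. Im (z * poly p z * F z)) \<in> Re_closure"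
    using main[of 0] main[of 1] main[of 2] main[of 3] unfolding Re0 Im0 Re1 Im1 by simp_all
  obtain H where H: "is_ext (\<lambda>z. poly p z * F z) H" using is_ext_exists[OF RX(1,2)] by blast
  obtain H2 where H2: "is_ext (\<lambda>z. z * poly p z * F z) H2" using is_ext_exists[OF RX(3,4)] by blast
  \<comment> \<open>The function \<open>H2 z - w * H z\<close> extends
    \<open>(z - w) * poly p z * F z\<close>, in which the polynomial factor vanishes at
    \<open>w\<close>, so \<open>ext_zero\<close> applies.\<close>
  have rel: "H2 w = w * H w" if w: "w \<in> D" for w
  proof -
    have ext: "is_ext (\<lambda>z. ((z - w) * poly p z) * F z) (\<lambda>z. H2 z - w * H z)"
      unfolding is_ext_def
    proof (intro conjI ballI allI impI)
      show "continuous_on (closure D) (\<lambda>z. H2 z - w * H z)"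
        using H H2 unfolding is_ext_def by (intro continuous_intros) auto
      show "H2 z - w * H z = (z - w) * poly p z * F z" if "z \<in> frontier D" for z
        using H H2 that unfolding is_ext_def by (simp add: algebra_simps)
      fix \<epsilon> :: real assume \<epsilon>: "\<epsilon> > 0"
      define \<delta> where "\<delta> = \<epsilon> / (1 + cmod w)"
      have \<delta>: "\<delta> > 0" "\<delta> + cmod w * \<delta> = \<epsilon>"
      proof -
        have "1 + cmod w > 0" by (simp add: add_pos_nonneg)
        then show "\<delta> > 0" using \<epsilon> by (simp add: \<delta>_def)
        have "(1 + cmod w) * \<delta> = \<epsilon>" using \<open>1 + cmod w > 0\<close> by (simp add: \<delta>_def)
        then show "\<delta> + cmod w * \<delta> = \<epsilon>" by (simp add: distrib_right)
      qed
      obtain \<alpha> \<beta> where A: "\<alpha> \<in> disc_alg D" "\<beta> \<in> disc_alg D" "\<And>z. z \<in> closure D \<Longrightarrow> cmod (H z - (\<alpha> z + cnj (\<beta> z))) \<le> \<delta>"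
        using H \<delta>(1) unfolding is_ext_def by blast
      obtain \<alpha>' \<beta>' where A': "\<alpha>' \<in> disc_alg D" "\<beta>' \<in> disc_alg D" "\<And>z. z \<in> closure D \<Longrightarrow> cmod (H2 z - (\<alpha>' z + cnj (\<beta>' z))) \<le> \<delta>"
        using H2 \<delta>(1) unfolding is_ext_def by blast
      have m: "(\<lambda>z. \<alpha>' z - w * \<alpha> z) \<in> disc_alg D" "(\<lambda>z. \<beta>' z - cnj w * \<beta> z) \<in> disc_alg D"
        by (intro disc_alg_diff disc_alg_mult disc_alg_const A A')+
      show "\<exists>\<alpha>\<in>disc_alg D. \<exists>\<beta>\<in>disc_alg D. \<forall>z\<in>closure D. cmod (H2 z - w * H z - (\<alpha> z + cnj (\<beta> z))) \<le> \<epsilon>"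
      proof (rule bexI[OF bexI[OF ballI m(2)] m(1)])
        fix z assume z: "z \<in> closure D"
        have "H2 z - w * H z - (\<alpha>' z - w * \<alpha> z + cnj (\<beta>' z - cnj w * \<beta> z))
            = (H2 z - (\<alpha>' z + cnj (\<beta>' z))) - w * (H z - (\<alpha> z + cnj (\<beta> z)))"
          by (simp add: algebra_simps)
        then have "cmod (H2 z - w * H z - (\<alpha>' z - w * \<alpha> z + cnj (\<beta>' z - cnj w * \<beta> z)))
            \<le> cmod (H2 z - (\<alpha>' z + cnj (\<beta>' z))) + cmod w * cmod (H z - (\<alpha> z + cnj (\<beta> z)))"
          by (metis norm_mult norm_triangle_ineq4)
        also have "\<dots> \<le> \<delta> + cmod w * \<delta>"
          using A(3)[OF z] A'(3)[OF z] by (intro add_mono mult_left_mono) auto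
        finally show "cmod (H2 z - w * H z - (\<alpha>' z - w * \<alpha> z + cnj (\<beta>' z - cnj w * \<beta> z))) \<le> \<epsilon>"
          using \<delta>(2) by simp
      qed
    qed
    have pA: "(\<lambda>z. (z - w) * poly p z) \<in> disc_alg D"
      by (intro disc_alg_mult disc_alg_diff disc_alg_ident disc_alg_const disc_alg_poly)
    show ?thesis
      using ext_zero[OF F ext pA w] by simp
  qed
  have "H \<in> disc_alg D" by (rule ext_holomorphic[OF H H2 rel])
  then show ?thesis
    using that[OF p0, of H] H unfolding is_ext_def by blast
qed

text \<open>With p = (z - a) * p1 and h - h a = (z - a) * h1, the function p1 * F - h1 equals h a /
  (z - a) on the frontier, which has winding -1 unless h a = 0.\<close>

lemma winding_excludes_pole:
  assumes F: "continuous_on (frontier D) F" "nonneg_winding F"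
    and h: "h \<in> disc_alg D" "\<And>z. z \<in> frontier D \<Longrightarrow> h z = poly p z * F z"
    and a: "a \<in> D" "poly p a = 0"
  shows "h a = 0"
proof (rule ccontr)
  assume ha: "h a \<noteq> 0"
  obtain p1 where p1: "p = [:-a, 1:] * p1" using a(2) by (metis dvdE poly_eq_0_iff_dvd)
  obtain h1 where h1: "h1 \<in> disc_alg D" "\<And>z. z \<in> closure D \<Longrightarrow> h z - h a = (z - a) * h1 z"
    using disc_alg_factor[OF open_D disc_alg_diff[OF h(1) disc_alg_const[of "h a"]] a(1)] by auto
  show False
  proof (rule quotient_winding[OF F a(1)])
    show "poly p1 \<in> disc_alg D" by (rule disc_alg_poly)
    show "(\<lambda>z. - h1 z) \<in> disc_alg D" by (rule disc_alg_minus[OF h1(1)])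
    show "inv_on_frontier (\<lambda>z. h a)" using ha by (simp add: inv_on_frontier_def)
    show "bdry_winding m \<gamma> (\<lambda>z. h a) = 0" using ha by (intro bdry_winding_nonvanishing) auto
    show "(z - a) * (poly p1 z * F z + - h1 z) = h a" if z: "z \<in> frontier D" for z
      using h1(2)[OF frontier_in_closure[OF z]] h(2)[OF z] by (simp add: p1 algebra_simps)
  qed
qed

text \<open>If the value c at \<open>a\<close> exceeded the bound of F in modulus, then F - c would
  have winding 0, although it is divisible by \<open>z - a\<close> in the sense of
  \<open>quotient_winding\<close>.\<close>

lemma winding_bounds_quotient:
  assumes F: "continuous_on (frontier D) F" "nonneg_winding F" "\<And>z. z \<in> frontier D \<Longrightarrow> cmod (F z) \<le> M"
    and h: "h \<in> disc_alg D" "\<And>z. z \<in> frontier D \<Longrightarrow> h z = poly p z * F z"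
    and a: "a \<in> D" "poly p a \<noteq> 0"
  shows "cmod (h a / poly p a) \<le> M"
proof (rule ccontr)
  assume M: "\<not> ?thesis"
  define c where "c = h a / poly p a"
  have c: "M < cmod c" using M by (simp add: c_def)
  have cne: "c \<noteq> 0"
  proof -
    obtain b where "b \<in> frontier D" using frontier_nonempty by auto
    then have "0 \<le> M" using F(3)[of b] norm_ge_zero order_trans by blast
    then show ?thesis using c by auto
  qed
  let ?g = "\<lambda>z. - c * (1 - F z / c)"
  have cont1: "continuous_on (frontier D) (\<lambda>z. 1 - F z / c)"
    using cne by (intro continuous_intros F) auto
  have Re: "Re (1 - F z / c) > 0" if "z \<in> frontier D" for z
  proof -
    have "cmod (F z / c) < 1"
      using F(3)[OF that] c cne by (simp add: norm_divide)
    then show ?thesis using complex_Re_le_cmod[of "F z / c"] by simp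
  qed
  have inv1: "inv_on_frontier (\<lambda>z. 1 - F z / c)"
    by (rule inv_on_frontier_Re_pos[OF cont1 Re])
  have invc: "inv_on_frontier (\<lambda>z. - c)" using cne by (simp add: inv_on_frontier_def)
  have W: "bdry_winding m \<gamma> ?g = 0"
    using bdry_winding_mult[OF invc inv1] bdry_winding_Re_pos[OF cont1 Re]
      bdry_winding_nonvanishing[of "\<lambda>z. - c"] cne by simp
  obtain k where k: "k \<in> disc_alg D" "\<And>z. z \<in> closure D \<Longrightarrow> h z - c * poly p z = (z - a) * k z"
    using disc_alg_factor[OF open_D disc_alg_diff[OF h(1) disc_alg_mult[OF disc_alg_const[of c] disc_alg_poly[of p]]] a(1)]
      a(2) by (auto simp: c_def)
  obtain p' where p': "p' \<in> disc_alg D" "\<And>z. z \<in> closure D \<Longrightarrow> poly p z - poly p a = (z - a) * p' z"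
    using disc_alg_factor[OF open_D disc_alg_diff[OF disc_alg_poly[of p] disc_alg_const[of "poly p a"]] a(1)] by auto
  \<comment> \<open>The coefficients come from poly p a * (F - c) = (h - c * p) - (p - poly p a) *
    (F - c), in which both h - c * p and p - poly p a vanish at \<open>a\<close>.\<close>
  show False
  proof (rule quotient_winding[OF F(1,2) a(1)])
    show "(\<lambda>z. (- 1 / poly p a) * p' z) \<in> disc_alg D"
      by (intro disc_alg_mult disc_alg_const p')
    show "(\<lambda>z. (1 / poly p a) * (k z + c * p' z)) \<in> disc_alg D"
      by (intro disc_alg_mult disc_alg_add disc_alg_const p' k)
    show "inv_on_frontier ?g" by (rule inv_on_frontier_mult[OF invc inv1])
    show "bdry_winding m \<gamma> ?g = 0" by (rule W)
    fix z assume z: "z \<in> frontier D"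
    have 1: "(z - a) * k z = poly p z * (F z - c)"
      using k(2)[OF frontier_in_closure[OF z]] h(2)[OF z] by (simp add: algebra_simps)
    have 2: "(z - a) * p' z = poly p z - poly p a"
      using p'(2)[OF frontier_in_closure[OF z]] by simp
    have "(z - a) * ((- 1 / poly p a) * p' z * F z + (1 / poly p a) * (k z + c * p' z))
        = ((z - a) * k z - ((z - a) * p' z) * (F z - c)) / poly p a"
      by (simp add: algebra_simps add_divide_distrib diff_divide_distrib)
    also have "\<dots> = F z - c"
      unfolding 1 2 using a(2) by (simp add: field_simps)
    also have "\<dots> = ?g z" using cne by (simp add: algebra_simps)
    finally show "(z - a) * ((- 1 / poly p a) * p' z * F z + (1 / poly p a) * (k z + c * p' z)) = ?g z" .
  qed
qed

text \<open>Take \<open>p\<close> of least degree. At a root in \<open>D\<close> the function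
  \<open>h\<close> vanishes too by \<open>winding_excludes_pole\<close>, and at a root off the
  closure division by \<open>z - a\<close> stays in \<open>disc_alg D\<close>; so either kind could
  be cancelled.\<close>

lemma denominator_zeros_on_frontier:
  assumes F: "continuous_on (frontier D) F" "nonneg_winding F"
  obtains p h where "p \<noteq> 0" "h \<in> disc_alg D" "\<And>z. z \<in> frontier D \<Longrightarrow> h z = poly p z * F z"
    "\<And>z. poly p z = 0 \<Longrightarrow> z \<in> frontier D"
proof -
  let ?Q = "\<lambda>p. p \<noteq> 0 \<and> (\<exists>h\<in>disc_alg D. \<forall>z\<in>frontier D. h z = poly p z * F z)"
  have "\<exists>p. ?Q p" using polynomial_multiple_in_disc_alg[OF F] by metis
  then obtain p where p: "?Q p" "\<And>p'. ?Q p' \<Longrightarrow> degree p \<le> degree p'"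
    using ex_has_least_nat[of ?Q _ degree] by blast
  then obtain h where h: "h \<in> disc_alg D" "\<And>z. z \<in> frontier D \<Longrightarrow> h z = poly p z * F z" by blast
  have "a \<in> frontier D" if a: "poly p a = 0" for a
  proof (rule ccontr)
    assume na: "a \<notin> frontier D"
    obtain p1 where p1: "p = [:-a, 1:] * p1" using a by (metis dvdE poly_eq_0_iff_dvd)
    have p1ne: "p1 \<noteq> 0" using p(1) p1 by auto
    have "\<exists>k\<in>disc_alg D. \<forall>z\<in>closure D. h z = (z - a) * k z"
    proof (cases "a \<in> D")
      case True
      have ha: "h a = 0" by (rule winding_excludes_pole[OF F h True a])
      show ?thesis
        by (rule disc_alg_factor[OF open_D h(1) True ha]) (intro bexI ballI)
    next
      case False
      then have nk: "a \<notin> closure D" using na closure_eq by auto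
      have "(\<lambda>z. h z / (z - a)) \<in> disc_alg D"
        using nk by (intro disc_alg_divide h disc_alg_diff disc_alg_ident disc_alg_const) auto
      then show ?thesis using nk by (intro bexI[of _ "\<lambda>z. h z / (z - a)"]) auto
    qed
    then obtain k where k: "k \<in> disc_alg D" "\<And>z. z \<in> closure D \<Longrightarrow> h z = (z - a) * k z" by blast
    have "k z = poly p1 z * F z" if z: "z \<in> frontier D" for z
    proof -
      have "(z - a) * k z = (z - a) * (poly p1 z * F z)"
        using k(2)[OF frontier_in_closure[OF z]] h(2)[OF z] by (simp add: p1 algebra_simps)
      moreover have "z - a \<noteq> 0" using z na by auto
      ultimately show ?thesis by simp
    qed
    then have "degree p \<le> degree p1" using k(1) p1ne by (intro p(2)) blast
    moreover have "degree p = Suc (degree p1)"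
      unfolding p1 using p1ne by (subst degree_mult_eq) auto
    ultimately show False by simp
  qed
  then show ?thesis using that p(1) h by blast
qed

text \<open>A real multiple of \<open>ln (cmod (z - ctr j))\<close> is in general no log-modulus of
  a single-valued function. After multiplication by n the coefficients are rounded to integers, and
  n is so large that the rounding error is small after division by n.\<close>

lemma logmodular_approximation:
  assumes "continuous_on (frontier D) u" "\<epsilon> > 0"
  obtains n r where "n > (0::nat)" "r \<in> disc_alg D" "\<And>z. z \<in> closure D \<Longrightarrow> r z \<noteq> 0"
    "\<And>z. z \<in> frontier D \<Longrightarrow> \<bar>u z - ln (cmod (r z)) / n\<bar> \<le> \<epsilon>"
proof -
  have "\<epsilon> / 2 > 0" using assms(2) by simp
  then obtain q t where q: "q \<in> disc_alg D" "\<forall>z\<in>frontier D. \<bar>u z - lcomb q t z\<bar> \<le> \<epsilon> / 2"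
    using log_closure_continuous[OF assms(1)] unfolding log_closure_def by blast
  have "\<exists>C. \<forall>z\<in>closure D. \<bar>ln (cmod (z - ctr j))\<bar> \<le> C" if "j \<in> holes" for j
    using ln_ctr_bounded[OF that] by metis
  then obtain C where C: "\<And>j z. j \<in> holes \<Longrightarrow> z \<in> closure D \<Longrightarrow> \<bar>ln (cmod (z - ctr j))\<bar> \<le> C j"
    by metis
  obtain n0 :: nat where n0: "2 * (\<Sum>j\<in>holes. C j) / \<epsilon> < real n0"
    using reals_Archimedean2 by blast
  define n where "n = Suc n0"
  have n: "n > 0" "2 * (\<Sum>j\<in>holes. C j) / \<epsilon> < real n" using n0 by (auto simp: n_def)
  have nC: "(\<Sum>j\<in>holes. C j) / n \<le> \<epsilon> / 2"
    using n assms(2) by (simp add: field_simps)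
  define k where "k = (\<lambda>j. \<lfloor>n * t j\<rfloor>)"
  have tk: "\<bar>t j - k j / n\<bar> \<le> 1 / n" for j
  proof -
    have "\<bar>n * t j - k j\<bar> \<le> 1" unfolding k_def by linarith
    then have "\<bar>(n * t j - k j) / n\<bar> \<le> 1 / n" using n(1) by (simp add: abs_divide divide_right_mono)
    then show ?thesis using n(1) by (simp add: diff_divide_distrib)
  qed
  let ?r = "\<lambda>z. exp (of_nat n * q z) * (\<Prod>j\<in>holes. (z - ctr j) powi (k j))"
  show ?thesis
  proof (rule that[OF n(1), of ?r])
    show "?r \<in> disc_alg D"
      using ctr_notin by (intro disc_alg_mult disc_alg_exp disc_alg_const disc_alg_prod disc_alg_powi disc_alg_diff disc_alg_ident q) auto
    show "?r z \<noteq> 0" if "z \<in> closure D" for z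
      using that ctr_notin by (auto simp: power_int_eq_0_iff)
    fix z assume z: "z \<in> frontier D"
    have pos: "cmod (z - ctr j) > 0" if "j \<in> holes" for j
      using ctr_notin[OF that] frontier_in_closure[OF z] by auto
    have "cmod (?r z) = exp (n * Re (q z)) * (\<Prod>j\<in>holes. cmod (z - ctr j) powi (k j))"
      by (simp add: norm_mult norm_power_int prod_norm[symmetric])
    also have "ln \<dots> = n * Re (q z) + (\<Sum>j\<in>holes. ln (cmod (z - ctr j) powi (k j)))"
      using pos by (subst ln_mult) (auto intro!: prod_pos simp: ln_prod)
    also have "(\<Sum>j\<in>holes. ln (cmod (z - ctr j) powi (k j))) = (\<Sum>j\<in>holes. k j * ln (cmod (z - ctr j)))"
    proof (rule sum.cong[OF refl])
      fix j assume j: "j \<in> holes"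
      have "cmod (z - ctr j) powi (k j) = cmod (z - ctr j) powr (of_int (k j))"
        using pos[OF j] by (simp add: powr_real_of_int')
      then show "ln (cmod (z - ctr j) powi (k j)) = k j * ln (cmod (z - ctr j))"
        by (simp add: ln_powr)
    qed
    finally have "ln (cmod (?r z)) / n = Re (q z) + (\<Sum>j\<in>holes. k j * ln (cmod (z - ctr j))) / n"
      using n(1) by (simp add: add_divide_distrib)
    then have "lcomb q t z - ln (cmod (?r z)) / n = (\<Sum>j\<in>holes. (t j - k j / n) * ln (cmod (z - ctr j)))"
      by (simp add: lcomb_def left_diff_distrib sum_subtractf sum_divide_distrib)
    also have "\<bar>\<dots>\<bar> \<le> (\<Sum>j\<in>holes. 1 / n * C j)"
    proof (intro order_trans[OF sum_abs] sum_mono)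
      fix j assume j: "j \<in> holes"
      show "\<bar>(t j - k j / n) * ln (cmod (z - ctr j))\<bar> \<le> 1 / n * C j"
        unfolding abs_mult by (intro mult_mono tk C j frontier_in_closure[OF z]) auto
    qed
    also have "\<dots> = (\<Sum>j\<in>holes. C j) / n"
      by (simp add: sum_divide_distrib)
    also have "\<dots> \<le> \<epsilon> / 2" by (rule nC)
    finally show "\<bar>u z - ln (cmod (?r z)) / n\<bar> \<le> \<epsilon>"
      using bspec[OF q(2) z] by linarith
  qed
qed

text \<open>Multiplying a power of the bounded function by \<open>poly p\<close> makes it continuous at the zeros of \<open>p\<close>,
  and the influence of this factor disappears as the power grows.\<close>

lemma max_principle_exceptional:
  assumes p: "p \<noteq> 0" "\<And>z. poly p z = 0 \<Longrightarrow> z \<in> frontier D"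
    and h: "h \<in> disc_alg D" "\<And>z. z \<in> frontier D \<Longrightarrow> h z = poly p z * F z"
    and F: "continuous_on (frontier D) F" "\<And>z. z \<in> frontier D \<Longrightarrow> cmod (F z) \<le> M"
    and bd: "\<And>z. z \<in> D \<Longrightarrow> cmod (h z / poly p z) \<le> M"
    and r: "n > (0::nat)" "r \<in> disc_alg D" "\<And>z. z \<in> closure D \<Longrightarrow> r z \<noteq> 0"
    and le: "\<And>z. z \<in> frontier D \<Longrightarrow> Re (F z) - ln (cmod (r z)) / n \<le> \<epsilon>"
    and a: "a \<in> D"
  shows "Re (h a / poly p a) - ln (cmod (r a)) / n \<le> \<epsilon>"
proof -
  define \<Phi> where "\<Phi> = (\<lambda>z. if z \<in> D then h z / poly p z else F z)"
  \<comment> \<open>The assumption \<open>le\<close> says that \<open>E\<close> has modulus at most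
    \<open>exp (n * \<epsilon>)\<close> on the frontier; the claim is the same bound at
    \<open>a\<close>.\<close>
  define E where "E = (\<lambda>z. exp (of_nat n * \<Phi> z) / r z)"
  have \<Phi>M: "cmod (\<Phi> z) \<le> M" if "z \<in> closure D" for z
    using that bd F(2) closure_eq by (auto simp: \<Phi>_def)
  have p\<Phi>: "\<Phi> z = h z / poly p z" if "z \<in> closure D" "poly p z \<noteq> 0" for z
    using that h(2) closure_eq by (auto simp: \<Phi>_def)
  have "continuous_on (closure D) (\<lambda>z. 1 / r z)"
    using r by (intro continuous_intros disc_algD) auto
  then have "bounded ((\<lambda>z. 1 / r z) ` closure D)"
    using compact_closure_D by (intro compact_imp_bounded compact_continuous_image)
  then obtain C0 where C0: "\<And>z. z \<in> closure D \<Longrightarrow> cmod (1 / r z) \<le> C0"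
    unfolding bounded_iff by auto
  define C where "C = exp (n * M) * C0"
  have EC: "cmod (E z) \<le> C" if z: "z \<in> closure D" for z
  proof -
    have "cmod (E z) = exp (n * Re (\<Phi> z)) * cmod (1 / r z)"
      by (simp add: E_def norm_divide)
    also have "\<dots> \<le> exp (n * M) * C0"
      using \<Phi>M[OF z] complex_Re_le_cmod[of "\<Phi> z"] C0[OF z]
      by (intro mult_mono) (auto intro: mult_left_mono order_trans)
    finally show ?thesis by (simp add: C_def)
  qed
  have C1: "0 \<le> C" using EC[OF D_in_closure[OF a]] norm_ge_zero order_trans by blast
  let ?Z = "{z. poly p z = 0}"
  have finZ: "finite ?Z" using p(1) by (simp add: poly_roots_finite)
  have "bounded (poly p ` closure D)"
    using compact_closure_D by (intro compact_imp_bounded compact_continuous_image continuous_intros)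
  then obtain P0 where P0: "\<And>z. z \<in> closure D \<Longrightarrow> cmod (poly p z) \<le> P0"
    unfolding bounded_iff by auto
  have pa: "poly p a \<noteq> 0" using p(2) a D_frontier_disj by blast
  have key: "cmod (E a) ^ N * cmod (poly p a) \<le> exp (n * \<epsilon>) ^ N * P0" for N
  proof -
    define T where "T = (\<lambda>z. E z ^ N * poly p z)"
    have hol: "T holomorphic_on D"
    proof -
      have "(\<lambda>z. (exp (of_nat n * (h z / poly p z)) / r z) ^ N * poly p z) holomorphic_on D"
        using p(2) D_frontier_disj r(3) D_in_closure
        by (intro holomorphic_intros disc_algD h r) auto
      then show ?thesis
        by (rule holomorphic_transform) (auto simp: T_def E_def \<Phi>_def)
    qed
    have cont: "continuous_on (closure D) T"
      unfolding continuous_on_eq_continuous_within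
    proof
      fix z assume z: "z \<in> closure D"
      show "continuous (at z within closure D) T"
      proof (cases "poly p z = 0")
        case False
        let ?T = "\<lambda>z. (exp (of_nat n * (h z / poly p z)) / r z) ^ N * poly p z"
        have "continuous_on (closure D - ?Z) ?T"
          using r(3) by (intro continuous_intros continuous_on_subset[OF disc_algD(1)[OF h(1)]]
            continuous_on_subset[OF disc_algD(1)[OF r(2)]]) auto
        then have "continuous_on (closure D - ?Z) T"
          by (rule continuous_on_eq) (auto simp: T_def E_def p\<Phi>)
        then have "continuous (at z within (closure D \<inter> - ?Z)) T"
          using z False by (auto simp: continuous_on_eq_continuous_within Diff_eq)
        moreover have "at z within (closure D \<inter> - ?Z) = at z within closure D"
          using False finZ by (intro at_within_nhd[of z "- ?Z"]) (auto simp: open_Compl finite_imp_closed)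
        ultimately show ?thesis by simp
      next
        case True
        have T0: "T z = 0" by (simp add: T_def True)
        have "((\<lambda>x. C ^ N * cmod (poly p x)) \<longlongrightarrow> C ^ N * cmod (poly p z)) (at z within closure D)"
          by (intro tendsto_intros)
        then have "((\<lambda>x. C ^ N * cmod (poly p x)) \<longlongrightarrow> 0) (at z within closure D)"
          by (simp add: True)
        moreover have "eventually (\<lambda>x. cmod (T x) \<le> C ^ N * cmod (poly p x)) (at z within closure D)"
          unfolding eventually_at_filter
          using EC by (auto simp: T_def norm_mult norm_power intro!: always_eventually mult_right_mono power_mono)
        ultimately have "(T \<longlongrightarrow> 0) (at z within closure D)"
          by (rule Lim_null_comparison[rotated])
        then show ?thesis by (simp add: continuous_within T0)
      qed
    qed
    have "cmod (T a) \<le> exp (n * \<epsilon>) ^ N * P0"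
    proof (rule maximum_modulus_frontier[of T D])
      show "T holomorphic_on interior D" using hol open_D by (simp add: interior_open)
      fix z assume z: "z \<in> frontier D"
      have rz: "cmod (r z) > 0" using r(3) frontier_in_closure[OF z] by simp
      have "n * Re (F z) - ln (cmod (r z)) \<le> n * \<epsilon>"
        using le[OF z] r(1) by (simp add: field_simps)
      then have "exp (n * Re (F z) - ln (cmod (r z))) \<le> exp (n * \<epsilon>)" by simp
      moreover have "cmod (E z) = exp (n * Re (F z) - ln (cmod (r z)))"
        using z D_frontier_disj rz by (auto simp: E_def \<Phi>_def norm_divide exp_diff)
      ultimately have "cmod (E z) \<le> exp (n * \<epsilon>)" by simp
      then show "cmod (T z) \<le> exp (n * \<epsilon>) ^ N * P0"
        unfolding T_def norm_mult norm_power using P0[OF frontier_in_closure[OF z]]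
        by (intro mult_mono power_mono) auto
    qed (use cont bdd_D a in auto)
    then show ?thesis by (simp add: T_def norm_mult norm_power)
  qed
  have "cmod (E a) \<le> exp (n * \<epsilon>)"
  proof (rule ccontr)
    assume "\<not> ?thesis"
    then have x: "1 < cmod (E a) / exp (n * \<epsilon>)" by (simp add: field_simps)
    obtain N where "P0 / cmod (poly p a) < (cmod (E a) / exp (n * \<epsilon>)) ^ N"
      using real_arch_pow[OF x] by blast
    then have "exp (n * \<epsilon>) ^ N * P0 < cmod (E a) ^ N * cmod (poly p a)"
      using pa by (simp add: power_divide field_simps)
    then show False using key[of N] by simp
  qed
  moreover have "cmod (E a) = exp (n * Re (h a / poly p a) - ln (cmod (r a)))"
  proof -
    have Re_mult: "Re (of_nat n * x) = n * Re x" for x by simp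
    have \<Phi>a: "\<Phi> a = h a / poly p a" using a by (simp add: \<Phi>_def)
    have "0 < cmod (r a)" using r(3)[OF D_in_closure[OF a]] by simp
    then show ?thesis
      unfolding E_def \<Phi>a norm_divide[of "exp _"] norm_exp_eq_Re Re_mult by (simp only: exp_diff exp_ln)
  qed
  ultimately have "n * Re (h a / poly p a) - ln (cmod (r a)) \<le> n * \<epsilon>" by simp
  then show ?thesis using r(1) by (simp add: field_simps)
qed

lemma continuous_on_uniform_approx:
  fixes f :: "complex \<Rightarrow> real"
  assumes "\<And>\<epsilon>. \<epsilon> > 0 \<Longrightarrow> \<exists>g. continuous_on S g \<and> (\<forall>z\<in>S. \<bar>f z - g z\<bar> \<le> \<epsilon>)"
  shows "continuous_on S f"
proof -
  have "\<forall>n. \<exists>g. continuous_on S g \<and> (\<forall>z\<in>S. \<bar>f z - g z\<bar> \<le> 1 / real (Suc n))"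
    using assms by simp
  from choice[OF this] obtain g where g: "\<And>n. continuous_on S (g n)"
    "\<And>n z. z \<in> S \<Longrightarrow> \<bar>f z - g n z\<bar> \<le> 1 / real (Suc n)" by blast
  have "uniform_limit S g f sequentially"
    unfolding uniform_limit_iff
  proof (intro allI impI)
    fix e :: real assume "e > 0"
    then have "\<forall>\<^sub>F n in sequentially. inverse (real (Suc n)) < e"
      using order_tendstoD(2)[OF LIMSEQ_inverse_real_of_nat] by blast
    then show "\<forall>\<^sub>F n in sequentially. \<forall>x\<in>S. dist (g n x) (f x) < e"
    proof eventually_elim
      case (elim n)
      show ?case
      proof
        fix x assume "x \<in> S"
        then show "dist (g n x) (f x) < e"
          using g(2)[of x n] elim by (simp add: dist_real_def abs_minus_commute inverse_eq_divide)
      qed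
    qed
  qed
  then show ?thesis
    using g(1) by (intro uniform_limit_theorem[where F=sequentially and f=g]) auto
qed

theorem nonneg_winding_imp_extends:
  assumes F: "continuous_on (frontier D) F" "nonneg_winding F"
  obtains \<Phi> where "\<Phi> \<in> disc_alg D" "\<And>z. z \<in> frontier D \<Longrightarrow> \<Phi> z = F z"
proof -
  obtain p h where p: "p \<noteq> 0" "h \<in> disc_alg D" "\<And>z. z \<in> frontier D \<Longrightarrow> h z = poly p z * F z"
    "\<And>z. poly p z = 0 \<Longrightarrow> z \<in> frontier D"
    using denominator_zeros_on_frontier[OF F] by blast
  have "bounded (F ` frontier D)"
    using compact_frontier_D F(1) by (intro compact_imp_bounded compact_continuous_image)
  then obtain M where M: "\<And>z. z \<in> frontier D \<Longrightarrow> cmod (F z) \<le> M"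
    unfolding bounded_iff by auto
  have pD: "poly p z \<noteq> 0" if "z \<in> D" for z using p(4) that D_frontier_disj by blast
  have bd: "cmod (h z / poly p z) \<le> M" if "z \<in> D" for z
    by (rule winding_bounds_quotient[OF F M p(2,3) that pD[OF that]])
  define \<Phi> where "\<Phi> = (\<lambda>z. if z \<in> D then h z / poly p z else F z)"
  have cont: "continuous_on (closure D) (\<lambda>z. Re (c * \<Phi> z))" if c: "cmod c = 1" for c
  proof (rule continuous_on_uniform_approx)
    fix \<epsilon> :: real assume \<epsilon>: "\<epsilon> > 0"
    have "continuous_on (frontier D) (\<lambda>z. Re (c * F z))"
      by (intro continuous_intros F(1))
    from logmodular_approximation[OF this \<epsilon>] obtain n r where r: "n > (0::nat)" "r \<in> disc_alg D"
      "\<And>z. z \<in> closure D \<Longrightarrow> r z \<noteq> 0" "\<And>z. z \<in> frontier D \<Longrightarrow> \<bar>Re (c * F z) - ln (cmod (r z)) / n\<bar> \<le> \<epsilon>"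
      by blast
    \<comment> \<open>To be used for c with \<open>r\<close> and for -c with \<open>1 / r\<close>:
      as \<open>r\<close> has no zeros, the one-sided maximum principle yields a two-sided
      estimate.\<close>
    have up: "Re (d * h a / poly p a) - ln (cmod (s a)) / n \<le> \<epsilon>"
      if d: "cmod d = 1" and s: "s \<in> disc_alg D" "\<And>z. z \<in> closure D \<Longrightarrow> s z \<noteq> 0"
        "\<And>z. z \<in> frontier D \<Longrightarrow> Re (d * F z) - ln (cmod (s z)) / n \<le> \<epsilon>" and a: "a \<in> D" for d s a
      by (rule max_principle_exceptional[where F="\<lambda>z. d * F z" and M=M, OF p(1,4) _ _ _ _ _ r(1) s a])
         (use p(2,3) M bd d F(1) in \<open>auto simp: norm_mult norm_divide intro!: disc_alg_mult disc_alg_const continuous_intros\<close>)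
    have "\<bar>Re (c * \<Phi> z) - ln (cmod (r z)) / n\<bar> \<le> \<epsilon>" if z: "z \<in> closure D" for z
    proof (cases "z \<in> D")
      case False
      then show ?thesis using r(4)[of z] z closure_eq by (auto simp: \<Phi>_def)
    next
      case True
      have "Re (c * h z / poly p z) - ln (cmod (r z)) / n \<le> \<epsilon>"
        using r(4) by (intro up[OF c r(2,3) _ True]) (auto simp: abs_le_iff)
      moreover have "Re (- c * h z / poly p z) - ln (cmod (1 / r z)) / n \<le> \<epsilon>"
      proof (rule up[OF _ _ _ _ True])
        show "(\<lambda>z. 1 / r z) \<in> disc_alg D" by (intro disc_alg_divide disc_alg_const r)
        show "Re (- c * F x) - ln (cmod (1 / r x)) / n \<le> \<epsilon>" if "x \<in> frontier D" for x
          using r(4)[OF that] r(3)[OF frontier_in_closure[OF that]]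
          by (simp add: norm_divide ln_div abs_le_iff)
      qed (use c r in auto)
      ultimately show ?thesis
        using True r(3)[OF z] by (simp add: \<Phi>_def norm_divide ln_div abs_le_iff)
    qed
    moreover have "continuous_on (closure D) (\<lambda>z. ln (cmod (r z)) / n)"
      using r by (intro continuous_intros disc_algD) auto
    ultimately show "\<exists>g. continuous_on (closure D) g \<and> (\<forall>z\<in>closure D. \<bar>Re (c * \<Phi> z) - g z\<bar> \<le> \<epsilon>)"
      by (intro exI[of _ "\<lambda>z. ln (cmod (r z)) / n"]) blast
  qed
  \<comment> \<open>The rotations 1 and -i give the real and the imaginary part of \<Phi>.\<close>
  have "continuous_on (closure D) (\<lambda>z. Complex (Re (1 * \<Phi> z)) (Re (- \<i> * \<Phi> z)))"
    unfolding Complex_eq by (intro continuous_intros cont) auto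
  then have "continuous_on (closure D) \<Phi>"
    by simp
  moreover have "\<Phi> holomorphic_on D"
  proof -
    have "(\<lambda>z. h z / poly p z) holomorphic_on D"
      using pD by (intro holomorphic_intros disc_algD p) auto
    then show ?thesis by (rule holomorphic_transform) (simp add: \<Phi>_def)
  qed
  ultimately have "\<Phi> \<in> disc_alg D" by (simp add: disc_alg_def)
  then show ?thesis
    by (rule that) (use D_frontier_disj in \<open>auto simp: \<Phi>_def\<close>)
qed

section \<open>Meromorphic extension\<close>

text \<open>Induction over the roots: for one root \<open>a\<close> the function
  \<open>1 - 1 / h a * h z\<close> vanishes at \<open>a\<close> and so equals
  \<open>(z - a) * k z\<close>. Multiplying this identity by the one for \<open>s'\<close> gives the
  one for \<open>s\<close>.\<close>

lemma bezout_disc_alg: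
  assumes "h \<in> disc_alg D" "s \<noteq> 0" "\<And>a. poly s a = 0 \<Longrightarrow> a \<in> D \<and> h a \<noteq> 0"
  shows "\<exists>P\<in>disc_alg D. \<exists>T\<in>disc_alg D. \<forall>z\<in>closure D. P z * h z + T z * poly s z = 1"
  using assms(2,3)
proof (induction "degree s" arbitrary: s)
  case 0
  then obtain c where c: "s = [:c:]" "c \<noteq> 0"
    by (metis degree_eq_zeroE pCons_eq_0_iff)
  show ?case
    by (rule bexI[of _ "\<lambda>z. 0"], rule bexI[of _ "\<lambda>z. 1 / c"]) (use c in \<open>auto simp: disc_alg_const\<close>)
next
  case (Suc n)
  have "\<not> constant (poly s)"
    using Suc(2) by (simp add: constant_degree)
  then obtain a where a: "poly s a = 0"
    using Fundamental_Theorem_Algebra.fundamental_theorem_of_algebra by blast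
  then obtain s' where s': "s = [:-a, 1:] * s'"
    by (metis dvdE poly_eq_0_iff_dvd)
  have ne: "s' \<noteq> 0" using Suc.prems s' by auto
  have deg: "n = degree s'"
    using Suc(2) s' ne by (subst (asm) s', subst (asm) degree_mult_eq) auto
  have aD: "a \<in> D" "h a \<noteq> 0" using a Suc.prems(2) by auto
  have "poly s b = 0" if "poly s' b = 0" for b using that s' by simp
  then obtain P T where PT: "P \<in> disc_alg D" "T \<in> disc_alg D" "\<And>z. z \<in> closure D \<Longrightarrow> P z * h z + T z * poly s' z = 1"
    using Suc(1)[OF deg ne] Suc.prems(2) by blast
  have "(\<lambda>z. 1 - 1 / h a * h z) \<in> disc_alg D"
    by (intro disc_alg_diff disc_alg_mult disc_alg_const assms)
  then obtain k where k: "k \<in> disc_alg D" "\<And>z. z \<in> closure D \<Longrightarrow> 1 - 1 / h a * h z = (z - a) * k z"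
    using disc_alg_factor[OF open_D _ aD(1)] aD(2) by (metis (no_types, lifting) nonzero_eq_divide_eq right_minus_eq)
  \<comment> \<open>Expand the product of the two identities: the terms with a factor h are
    collected in \<open>?P\<close>, and the term with \<open>poly s' z * (z - a)\<close> but without
    h gives \<open>?T\<close>.\<close>
  let ?P = "\<lambda>z. P z * (1 / h a * h z + k z * (z - a)) + T z * poly s' z * (1 / h a)" and ?T = "\<lambda>z. T z * k z"
  have A: "?P \<in> disc_alg D" "?T \<in> disc_alg D"
    by (intro disc_alg_add disc_alg_mult disc_alg_diff disc_alg_const disc_alg_ident disc_alg_poly PT k assms)+
  have fin: "?P z * h z + ?T z * poly s z = 1" if z: "z \<in> closure D" for z
  proof -
    have 1: "1 / h a * h z + k z * (z - a) = 1"
      using k(2)[OF z] by (simp add: algebra_simps)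
    have "?P z * h z + ?T z * poly s z = (P z * h z + T z * poly s' z) * (1 / h a * h z + k z * (z - a))"
      by (simp add: s' algebra_simps)
    then show ?thesis using PT(3)[OF z] 1 by simp
  qed
  show ?case
    by (rule bexI[OF _ A(1)], rule bexI[OF _ A(2)], rule ballI, rule fin)
qed

lemma mero_rep_facts:
  assumes "mero_rep D f h Q"
  shows "h \<in> disc_alg D" "Q \<noteq> 0" "poly Q z = 0 \<Longrightarrow> z \<in> D" "z \<in> frontier D \<Longrightarrow> f z = h z / poly Q z"
    "z \<in> frontier D \<Longrightarrow> poly Q z \<noteq> 0" "inv_on_frontier (poly Q)"
proof -
  show 1: "h \<in> disc_alg D" "Q \<noteq> 0" "poly Q z = 0 \<Longrightarrow> z \<in> D" "z \<in> frontier D \<Longrightarrow> f z = h z / poly Q z"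
    "z \<in> frontier D \<Longrightarrow> poly Q z \<noteq> 0" for z
    using assms D_frontier_disj unfolding mero_rep_def by auto
  show "inv_on_frontier (poly Q)"
    using 1(5) by (intro inv_on_frontier_disc_alg disc_alg_poly)
qed

lemma extends_mero_imp_winding_bound:
  assumes "mero_rep D f h Q"
  shows "winding_bound D m \<gamma> f (degree Q)"
  unfolding winding_bound_def
proof (intro allI impI)
  note Q = mero_rep_facts[OF assms]
  fix P T assume A: "P \<in> disc_alg D" "T \<in> disc_alg D" and ne: "\<forall>z\<in>frontier D. P z * f z + T z \<noteq> 0"
  let ?g = "\<lambda>z. P z * h z + T z * poly Q z"
  have eq: "P z * f z + T z = ?g z / poly Q z" if "z \<in> frontier D" for z
    using Q(4)[OF that] Q(5)[OF that] by (simp add: field_simps)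
  have gA: "?g \<in> disc_alg D"
    by (intro disc_alg_add disc_alg_mult disc_alg_poly A Q)
  have gne: "?g z \<noteq> 0" if "z \<in> frontier D" for z
    using ne that eq[OF that] by auto
  have "bdry_winding m \<gamma> (\<lambda>z. P z * f z + T z) = bdry_winding m \<gamma> (\<lambda>z. ?g z / poly Q z)"
    by (rule bdry_winding_cong) (rule eq)
  also have "\<dots> = bdry_winding m \<gamma> ?g - degree Q"
    using bdry_winding_divide[OF inv_on_frontier_disc_alg[OF gA gne] Q(6)] bdry_winding_poly[OF Q(2,3)] by simp
  finally show "- real (degree Q) \<le> bdry_winding m \<gamma> (\<lambda>z. P z * f z + T z)"
    using argument_principle_disc_alg[OF gA gne] by simp
qed

lemma winding_bound_imp_extends_mero:
  assumes f: "continuous_on (frontier D) f" and wb: "winding_bound D m \<gamma> f N"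
  shows "extends_mero D f"
proof -
  let ?g = "\<lambda>PQ z. fst PQ z * f z + snd PQ z"
  let ?V = "\<lambda>PQ. fst PQ \<in> disc_alg D \<and> snd PQ \<in> disc_alg D \<and> (\<forall>z\<in>frontier D. ?g PQ z \<noteq> 0)"
  have inv: "inv_on_frontier (?g PQ)" if "?V PQ" for PQ
  proof -
    have "continuous_on (frontier D) (fst PQ)" "continuous_on (frontier D) (snd PQ)"
      using that disc_alg_cont_frontier by blast+
    then have "continuous_on (frontier D) (?g PQ)" using f by (intro continuous_on_add continuous_on_mult)
    then show ?thesis using that by (simp add: inv_on_frontier_def)
  qed
  have lb: "- real N \<le> bdry_winding m \<gamma> (?g PQ)" if "?V PQ" for PQ
    using wb that unfolding winding_bound_def by blast
  have "?V (\<lambda>z. 0, \<lambda>z. 1)" by (simp add: disc_alg_const)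
  \<comment> \<open>Winding numbers are integers bounded below by -N; adding N makes them natural
    numbers, so a least one exists.\<close>
  then obtain PQ where V: "?V PQ"
    and least: "\<And>PQ'. ?V PQ' \<Longrightarrow> nat \<lfloor>bdry_winding m \<gamma> (?g PQ) + N\<rfloor> \<le> nat \<lfloor>bdry_winding m \<gamma> (?g PQ') + N\<rfloor>"
    using ex_has_least_nat[of ?V _ "\<lambda>PQ. nat \<lfloor>bdry_winding m \<gamma> (?g PQ) + N\<rfloor>"] by blast
  have min: "bdry_winding m \<gamma> (?g PQ) \<le> bdry_winding m \<gamma> (?g PQ')" if V': "?V PQ'" for PQ'
  proof -
    obtain k k' :: int where k: "bdry_winding m \<gamma> (?g PQ) = of_int k" "bdry_winding m \<gamma> (?g PQ') = of_int k'"
      using bdry_winding_Ints[OF inv[OF V]] bdry_winding_Ints[OF inv[OF V']] by (metis Ints_cases)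
    have "- real N \<le> of_int k" "- real N \<le> of_int k'"
      using lb[OF V] lb[OF V'] k by simp_all
    then have "0 \<le> k + int N" "0 \<le> k' + int N"
      by linarith+
    moreover have "nat \<lfloor>real_of_int k + real N\<rfloor> \<le> nat \<lfloor>real_of_int k' + real N\<rfloor>"
      using least[OF V'] k by simp
    moreover have "\<lfloor>real_of_int k + real N\<rfloor> = k + int N" "\<lfloor>real_of_int k' + real N\<rfloor> = k' + int N"
      by linarith+
    ultimately show ?thesis using k by simp
  qed
  obtain P0 Q0 where PQ: "PQ = (P0, Q0)" by fastforce
  define g0 where "g0 = (\<lambda>z. P0 z * f z + Q0 z)"
  have A0: "P0 \<in> disc_alg D" "Q0 \<in> disc_alg D" using V PQ by auto
  have g0: "inv_on_frontier g0" using inv[OF V] by (simp add: PQ g0_def)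
  have g0ne: "g0 z \<noteq> 0" if "z \<in> frontier D" for z using g0 that by (simp add: inv_on_frontier_def)
  have quot: "0 \<le> bdry_winding m \<gamma> G"
    if A: "P \<in> disc_alg D" "Q \<in> disc_alg D" and G: "\<And>z. z \<in> frontier D \<Longrightarrow> G z \<noteq> 0"
      "\<And>z. z \<in> frontier D \<Longrightarrow> G z * g0 z = P z * f z + Q z" for P Q G
  proof -
    have "P z * f z + Q z \<noteq> 0" if "z \<in> frontier D" for z
      using G[OF that] g0ne[OF that] by (metis mult_eq_0_iff)
    then have V': "?V (P, Q)" using A by simp
    have "bdry_winding m \<gamma> G = bdry_winding m \<gamma> (\<lambda>z. ?g (P, Q) z / g0 z)"
    proof (rule bdry_winding_cong)
      fix z assume "z \<in> frontier D"
      then show "G z = ?g (P, Q) z / g0 z" using G(2)[of z] g0ne[of z] by (simp add: field_simps)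
    qed
    also have "\<dots> = bdry_winding m \<gamma> (?g (P, Q)) - bdry_winding m \<gamma> g0"
      by (rule bdry_winding_divide[OF inv[OF V'] g0])
    also have "\<dots> \<ge> 0" using min[OF V'] by (simp add: PQ g0_def)
    finally show ?thesis .
  qed
  have cont1: "continuous_on (frontier D) (\<lambda>z. 1 / g0 z)" and cont2: "continuous_on (frontier D) (\<lambda>z. f z / g0 z)"
    using g0 f unfolding inv_on_frontier_def by (auto intro!: continuous_intros)
  have nn1: "nonneg_winding (\<lambda>z. 1 / g0 z)"
    unfolding nonneg_winding_def
  proof (intro ballI impI)
    fix P Q assume A: "P \<in> disc_alg D" "Q \<in> disc_alg D" and ne: "\<forall>z\<in>frontier D. P z * (1 / g0 z) + Q z \<noteq> 0"
    show "0 \<le> bdry_winding m \<gamma> (\<lambda>z. P z * (1 / g0 z) + Q z)"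
    proof (rule quot[of "\<lambda>z. Q z * P0 z" "\<lambda>z. P z + Q z * Q0 z"])
      show "(P z * (1 / g0 z) + Q z) * g0 z = Q z * P0 z * f z + (P z + Q z * Q0 z)" if "z \<in> frontier D" for z
      proof -
        have "(P z * (1 / g0 z) + Q z) * g0 z = P z + Q z * g0 z" using g0ne[OF that] by (simp add: field_simps)
        then show ?thesis by (simp add: g0_def algebra_simps)
      qed
    qed (use ne in \<open>auto intro!: disc_alg_add disc_alg_mult A A0\<close>)
  qed
  have nn2: "nonneg_winding (\<lambda>z. f z / g0 z)"
    unfolding nonneg_winding_def
  proof (intro ballI impI)
    fix P Q assume A: "P \<in> disc_alg D" "Q \<in> disc_alg D" and ne: "\<forall>z\<in>frontier D. P z * (f z / g0 z) + Q z \<noteq> 0"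
    show "0 \<le> bdry_winding m \<gamma> (\<lambda>z. P z * (f z / g0 z) + Q z)"
    proof (rule quot[of "\<lambda>z. P z + Q z * P0 z" "\<lambda>z. Q z * Q0 z"])
      show "(P z * (f z / g0 z) + Q z) * g0 z = (P z + Q z * P0 z) * f z + Q z * Q0 z" if "z \<in> frontier D" for z
      proof -
        have "(P z * (f z / g0 z) + Q z) * g0 z = P z * f z + Q z * g0 z" using g0ne[OF that] by (simp add: field_simps)
        then show ?thesis by (simp add: g0_def algebra_simps)
      qed
    qed (use ne in \<open>auto intro!: disc_alg_add disc_alg_mult A A0\<close>)
  qed
  obtain \<Phi>1 where \<Phi>1: "\<Phi>1 \<in> disc_alg D" "\<And>z. z \<in> frontier D \<Longrightarrow> \<Phi>1 z = 1 / g0 z"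
    using nonneg_winding_imp_extends[OF cont1 nn1] by blast
  obtain \<Phi>2 where \<Phi>2: "\<Phi>2 \<in> disc_alg D" "\<And>z. z \<in> frontier D \<Longrightarrow> \<Phi>2 z = f z / g0 z"
    using nonneg_winding_imp_extends[OF cont2 nn2] by blast
  \<comment> \<open>On the frontier f is the quotient of \<open>\<Phi>2\<close> by
    \<open>\<Phi>1\<close>. The zeros of \<open>\<Phi>1\<close> lie in \<open>D\<close>, and moving
    its nowhere zero factor to the numerator leaves a polynomial denominator.\<close>
  have "\<Phi>1 z \<noteq> 0" if "z \<in> frontier D" for z
    using \<Phi>1(2)[OF that] g0ne[OF that] by simp
  then obtain s g1 where s: "s \<noteq> 0" "\<And>z. poly s z = 0 \<Longrightarrow> z \<in> D" "g1 \<in> disc_alg D"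
    "\<And>z. z \<in> closure D \<Longrightarrow> g1 z \<noteq> 0" "\<And>z. z \<in> closure D \<Longrightarrow> \<Phi>1 z = poly s z * g1 z"
    using zeros_factor[OF \<Phi>1(1)] by blast
  have "mero_rep D f (\<lambda>z. \<Phi>2 z / g1 z) s"
    unfolding mero_rep_def
  proof (intro conjI allI ballI impI)
    show "(\<lambda>z. \<Phi>2 z / g1 z) \<in> disc_alg D"
      using s by (intro disc_alg_divide \<Phi>2) auto
    fix z assume z: "z \<in> frontier D"
    have "\<Phi>2 z = f z * \<Phi>1 z" using \<Phi>1(2)[OF z] \<Phi>2(2)[OF z] by simp
    then have "\<Phi>2 z = f z * (poly s z * g1 z)" using s(5)[OF frontier_in_closure[OF z]] by simp
    moreover have "poly s z \<noteq> 0" "g1 z \<noteq> 0"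
      using s(2)[of z] s(4) z D_frontier_disj frontier_in_closure by auto
    ultimately show "f z = \<Phi>2 z / g1 z / poly s z" by (simp add: field_simps)
  qed (use s in auto)
  then show ?thesis unfolding extends_mero_def by blast
qed

text \<open>Near \<open>a\<close> the function \<open>(z - a) ^ order a s * (h z / poly Q z)\<close>
  equals h1 / s2, where s2 is the factor of \<open>s\<close> that does not vanish at
  \<open>a\<close>. This is bounded, and \<open>pole_order\<close> is the least exponent with this
  effect.\<close>

lemma pole_order_le:
  assumes "a \<in> D" "h1 \<in> disc_alg D" "Q \<noteq> 0" "s \<noteq> 0"
    and eq: "\<And>z. z \<in> D \<Longrightarrow> h z * poly s z = h1 z * poly Q z"
  shows "pole_order (\<lambda>z. h z / poly Q z) a \<le> order a s"
  unfolding pole_order_def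
proof (rule Least_le)
  let ?k = "order a s"
  obtain s2 where s2: "s = [:-a, 1:] ^ ?k * s2" "\<not> [:-a, 1:] dvd s2"
    using order_decomp[OF assms(4)] by blast
  have s2a: "poly s2 a \<noteq> 0" using s2(2) by (simp add: poly_eq_0_iff_dvd)
  \<comment> \<open>All roots of \<open>Q\<close> and \<open>s\<close> other than \<open>a\<close>
    are avoided, so both quotients make sense on the punctured disc.\<close>
  let ?R = "{z. poly (Q * s) z = 0} - {a}"
  have "finite ?R" using assms(3,4) by (intro finite_Diff poly_roots_finite) simp
  then have "open (D - ?R)" using open_D by (simp add: open_Diff finite_imp_closed)
  then obtain e where e: "e > 0" "cball a e \<subseteq> D - ?R"
    using assms(1) open_contains_cball by blast
  have s2ne: "poly s2 z \<noteq> 0" if "z \<in> cball a e" for z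
  proof
    assume z0: "poly s2 z = 0"
    then have "poly s z = 0" by (subst s2(1)) simp
    then have "z = a" using e(2) that by auto
    then show False using s2a z0 by simp
  qed
  have "continuous_on (cball a e) (\<lambda>z. h1 z / poly s2 z)"
    using s2ne e(2) disc_algD(1)[OF assms(2)] D_in_closure
    by (intro continuous_intros continuous_on_subset[OF disc_algD(1)[OF assms(2)]]) auto
  then have "bounded ((\<lambda>z. h1 z / poly s2 z) ` cball a e)"
    by (intro compact_imp_bounded compact_continuous_image) auto
  then have "bounded ((\<lambda>z. (z - a) ^ ?k * (h z / poly Q z)) ` (ball a e - {a}))"
  proof (rule bounded_subset)
    show "(\<lambda>z. (z - a) ^ ?k * (h z / poly Q z)) ` (ball a e - {a}) \<subseteq> (\<lambda>z. h1 z / poly s2 z) ` cball a e"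
    proof
      fix y assume "y \<in> (\<lambda>z. (z - a) ^ ?k * (h z / poly Q z)) ` (ball a e - {a})"
      then obtain z where z: "z \<in> ball a e" "z \<noteq> a" "y = (z - a) ^ ?k * (h z / poly Q z)" by blast
      have zc: "z \<in> cball a e" using z(1) by auto
      then have zD: "z \<in> D" "poly Q z \<noteq> 0" using e(2) z(2) by auto
      have "poly s z = (z - a) ^ ?k * poly s2 z" by (subst s2(1)) simp
      then have "(z - a) ^ ?k * h z * poly s2 z = h1 z * poly Q z"
        using eq[OF zD(1)] by (simp add: algebra_simps)
      then have "y = h1 z / poly s2 z"
      proof -
        assume e: "(z - a) ^ ?k * h z * poly s2 z = h1 z * poly Q z"
        have "y * poly Q z = (z - a) ^ ?k * h z" using z(3) zD(2) by simp
        then have "(y * poly s2 z) * poly Q z = h1 z * poly Q z"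
          using e by (metis mult.assoc mult.commute)
        then have "y * poly s2 z = h1 z" using zD(2) by simp
        then show ?thesis using s2ne[OF zc] by (metis nonzero_mult_div_cancel_right)
      qed
      then show "y \<in> (\<lambda>z. h1 z / poly s2 z) ` cball a e" using zc by blast
    qed
  qed
  then show "\<exists>e>0. bounded ((\<lambda>z. (z - a) ^ ?k * (h z / poly Q z)) ` (ball a e - {a}))"
    using e(1) by blast
qed

text \<open>The given \<open>Q\<close> may share zeros with \<open>h\<close>. A representation h1 /
  s of least degree has no common zeros, so a Bezout identity yields P * f + T = 1 / s on the
  frontier, of winding minus the degree of \<open>s\<close>. Hence \<open>degree s \<le> N\<close>,
  and the root orders of \<open>s\<close> bound the pole orders.\<close>

lemma num_poles_le:
  assumes wb: "winding_bound D m \<gamma> f N" and rep: "mero_rep D f h Q"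
  shows "num_poles D h Q \<le> N"
proof -
  let ?R = "\<lambda>s. \<exists>h1. mero_rep D f h1 s"
  have "?R Q" using rep by blast
  then obtain s where s: "?R s" "\<And>s'. ?R s' \<Longrightarrow> degree s \<le> degree s'"
    using ex_has_least_nat[of ?R Q degree] by blast
  then obtain h1 where rep1: "mero_rep D f h1 s" by blast
  note F = mero_rep_facts[OF rep] and F1 = mero_rep_facts[OF rep1]
  have "a \<in> D \<and> h1 a \<noteq> 0" if a: "poly s a = 0" for a
  proof (rule ccontr)
    assume "\<not> ?thesis"
    then have aD: "a \<in> D" "h1 a = 0" using F1(3)[OF a] by auto
    obtain s' where s': "s = [:-a, 1:] * s'" using a by (metis dvdE poly_eq_0_iff_dvd)
    have ne: "s' \<noteq> 0" using F1(2) s' by auto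
    obtain k where k: "k \<in> disc_alg D" "\<And>z. z \<in> closure D \<Longrightarrow> h1 z = (z - a) * k z"
      using disc_alg_factor[OF open_D F1(1) aD] by blast
    have "mero_rep D f k s'"
      unfolding mero_rep_def
    proof (intro conjI allI ballI impI)
      show "z \<in> D" if "poly s' z = 0" for z using F1(3)[of z] that s' by simp
      fix z assume z: "z \<in> frontier D"
      have "z \<noteq> a" using z aD D_frontier_disj by auto
      then show "f z = k z / poly s' z"
        using F1(4)[OF z] k(2)[OF frontier_in_closure[OF z]] by (simp add: s' left_diff_distrib[symmetric])
    qed (use k ne in auto)
    then have "degree s \<le> degree s'" using s(2) by blast
    moreover have "degree s = Suc (degree s')"
      unfolding s' using ne by (subst degree_mult_eq) auto
    ultimately show False by simp
  qed
  then obtain P T where PT: "P \<in> disc_alg D" "T \<in> disc_alg D"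
    "\<And>z. z \<in> closure D \<Longrightarrow> P z * h1 z + T z * poly s z = 1"
    using bezout_disc_alg[OF F1(1,2)] by blast
  have eq: "P z * f z + T z = 1 / poly s z" if z: "z \<in> frontier D" for z
    using PT(3)[OF frontier_in_closure[OF z]] F1(4)[OF z] F1(5)[OF z] by (simp add: field_simps)
  have "- real N \<le> bdry_winding m \<gamma> (\<lambda>z. P z * f z + T z)"
    using wb PT(1,2) eq F1(5) unfolding winding_bound_def by fastforce
  also have "\<dots> = bdry_winding m \<gamma> (\<lambda>z. 1 / poly s z)"
    by (rule bdry_winding_cong) (rule eq)
  also have "\<dots> = - real (degree s)"
    using bdry_winding_divide[OF _ F1(6), of "\<lambda>z. 1"] bdry_winding_poly[OF F1(2,3)] bdry_winding_one
    by (simp add: inv_on_frontier_def)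
  finally have degN: "degree s \<le> N" by simp
  \<comment> \<open>Both representations equal f on the frontier, so the cross-multiplied identity
    holds there, and the maximum modulus principle carries it into \<open>D\<close>.\<close>
  have same: "h z * poly s z = h1 z * poly Q z" if z: "z \<in> D" for z
  proof -
    let ?d = "\<lambda>z. h z * poly s z - h1 z * poly Q z"
    have dA: "?d \<in> disc_alg D" by (intro disc_alg_diff disc_alg_mult disc_alg_poly F F1)
    have "cmod (?d z) \<le> 0"
    proof (rule maximum_modulus_frontier[of ?d D])
      show "?d holomorphic_on interior D" using disc_algD(2)[OF dA] open_D by (simp add: interior_open)
      show "cmod (?d x) \<le> 0" if x: "x \<in> frontier D" for x
        using F(4)[OF x] F1(4)[OF x] F(5)[OF x] F1(5)[OF x] by (simp add: frac_eq_eq)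
    qed (use disc_algD(1)[OF dA] bdd_D z in auto)
    then show ?thesis by simp
  qed
  have "num_poles D h Q \<le> (\<Sum>a\<in>{a\<in>D. poly Q a = 0}. order a s)"
    unfolding num_poles_def using F F1 same by (intro sum_mono pole_order_le[of _ h1]) auto
  also have "\<dots> \<le> (\<Sum>a | poly s a = 0. order a s)"
  proof -
    have fin: "finite {a\<in>D. poly Q a = 0}" "finite {a. poly s a = 0}"
      using F(2) F1(2) by (auto simp: poly_roots_finite intro: finite_subset[OF _ poly_roots_finite[OF F(2)]])
    have "(\<Sum>a\<in>{a\<in>D. poly Q a = 0}. order a s) = (\<Sum>a\<in>{a\<in>D. poly Q a = 0} \<inter> {a. poly s a = 0}. order a s)"
      using fin by (intro sum.mono_neutral_right) (auto simp: order_0I)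
    also have "\<dots> \<le> (\<Sum>a | poly s a = 0. order a s)"
      using fin by (intro sum_mono2) auto
    finally show ?thesis .
  qed
  also have "\<dots> \<le> degree s"
    using F1(2) by (rule sum_order_le_degree)
  finally show ?thesis using degN by simp
qed

end

theorem theorem5p1:
  fixes D :: "complex set" and f :: "complex \<Rightarrow> complex"
    and m :: nat and \<gamma> :: "nat \<Rightarrow> real \<Rightarrow> complex"
  assumes "open D" and "connected D" and "bounded D" and "D \<noteq> {}"
    and "\<And>j. j < m \<Longrightarrow> simple_path (\<gamma> j) \<and> pathfinish (\<gamma> j) = pathstart (\<gamma> j)"
    and "\<And>i j. i < m \<Longrightarrow> j < m \<Longrightarrow> i \<noteq> j \<Longrightarrow> path_image (\<gamma> i) \<inter> path_image (\<gamma> j) = {}"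
    and "(\<Union>j<m. path_image (\<gamma> j)) = frontier D"
    and "\<And>w. w \<in> D \<Longrightarrow> bdry_winding m \<gamma> (\<lambda>z. z - w) = 1"
    and "\<And>w. w \<notin> closure D \<Longrightarrow> bdry_winding m \<gamma> (\<lambda>z. z - w) = 0"
    and "continuous_on (frontier D) f"
  shows "(extends_mero D f \<longleftrightarrow> (\<exists>N. winding_bound D m \<gamma> f N))
    \<and> (\<forall>N. winding_bound D m \<gamma> f N \<longrightarrow>
          (\<forall>h Q. mero_rep D f h Q \<longrightarrow> num_poles D h Q \<le> N))"
proof -
  interpret jordan_domain D m \<gamma>
    by unfold_locales (use assms in auto)
  show ?thesis
    using extends_mero_imp_winding_bound winding_bound_imp_extends_mero[OF assms(10)] num_poles_le
    unfolding extends_mero_def by blast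
qed

end
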